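(* Every sequence $\{G_i\}_{i=1}^\infty$ of finite graphs, each having at least one edge, has a random walk convergent subsequence. If $\{G_i\}$ is random walk convergent, then there is a Markov graphop $A$ such that $\lim_{i\to\infty}d_M(M(G_i),A)=0$.
   Context: For a finite graph $G$ on $[n]$ with at least one edge, let $\nu_G$ be the probability measure on $[n]$ with $\nu_G(i)=d(i)/(2|E(G)|)$, $d(i)$ the degree, and $M(G)$ the operator on functions on $([n],\nu_G)$ given by $(vM(G))(i)=d(i)^{-1}\sum_{(i,j)\in E(G)}v(j)$ for $i$ in the support of $\nu_G$. A $P$-operator on a probability space $\Omega$ is a linear $A:L^\infty(\Omega)\to L^1(\Omega)$, $v\mapsto vA$, with $\sup_v\|vA\|_1/\|v\|_\infty<\infty$. With $(f,g)_A=\int(fA)g$, a Markov graphop is a $P$-operator that is self-adjoint ($(v,w)_A=(w,v)_A$), positivity-preserving ($v\ge0$ a.e. $\Rightarrow vA\ge0$ a.e.) and satisfies $1_\Omega A=1_\Omega$. $\mathcal{S}_k(A)$ is the set of joint distributions of $(v_1,\dots,v_k,v_1A,\dots,v_kA)$ over measurable $v_i:\Omega\to[-1,1]$; $d_M(A,B)=\sum_k2^{-k}d_H(\mathcal{S}_k(A),\mathcal{S}_k(B))$, $d_H$ the Hausdorff distance induced by the Lévy–Prokhorov metric. $\{G_i\}$ is random walk convergent if $\{M(G_i)\}$ is action convergent, i.e. each $\{\mathcal{S}_k(M(G_i))\}_i$ is $d_H$-Cauchy. *)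

theory Defs
  imports "HOL-Probability.Probability"
begin

text \<open>A graph on [n] = {1..n}: a pair (n, E) where E is a symmetric irreflexive
  set of ordered pairs of vertices (each undirected edge appears in both directions).\<close>
type_synonym graph = "nat \<times> (nat \<times> nat) set"

definition edges :: "graph \<Rightarrow> (nat \<times> nat) set" where
  "edges G = snd G"

definition graph_on :: "graph \<Rightarrow> bool" where
  "graph_on G \<longleftrightarrow> edges G \<subseteq> {1..fst G} \<times> {1..fst G} \<and> sym (edges G) \<and> irrefl (edges G)"

definition deg :: "graph \<Rightarrow> nat \<Rightarrow> nat" where
  "deg G i = card {j. (i, j) \<in> edges G}"

definition num_edges :: "graph \<Rightarrow> nat" where
  "num_edges G = card (edges G) div 2"

definition nu :: "graph \<Rightarrow> nat \<Rightarrow> real" where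
  "nu G i = real (deg G i) / (2 * real (num_edges G))"

text \<open>The probability space ([n], nu_G), realised on the type nat (vertices outside [n] get weight 0).\<close>
definition nu_meas :: "graph \<Rightarrow> nat measure" where
  "nu_meas G = point_measure UNIV (\<lambda>i. ennreal (nu G i))"

text \<open>The random walk operator M(G); off the support of nu_G it is set to 0 (irrelevant a.e.).\<close>
definition walk_op :: "graph \<Rightarrow> (nat \<Rightarrow> real) \<Rightarrow> (nat \<Rightarrow> real)" where
  "walk_op G v = (\<lambda>i. if nu G i > 0
      then (\<Sum>j\<in>{j. (i, j) \<in> edges G}. v j) / real (deg G i) else 0)"

definition Linf :: "'a measure \<Rightarrow> ('a \<Rightarrow> real) set" where
  "Linf M = {v \<in> borel_measurable M. \<exists>c. AE x in M. \<bar>v x\<bar> \<le> c}"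

definition p_operator :: "'a measure \<Rightarrow> (('a \<Rightarrow> real) \<Rightarrow> ('a \<Rightarrow> real)) \<Rightarrow> bool" where
  "p_operator M A \<longleftrightarrow> prob_space M \<and>
     (\<forall>v\<in>Linf M. integrable M (A v)) \<and>
     (\<forall>v\<in>Linf M. \<forall>w\<in>Linf M. (AE x in M. v x = w x) \<longrightarrow> (AE x in M. A v x = A w x)) \<and>
     (\<forall>v\<in>Linf M. \<forall>w\<in>Linf M. \<forall>a b :: real.
        AE x in M. A (\<lambda>y. a * v y + b * w y) x = a * A v x + b * A w x) \<and>
     (\<exists>C. \<forall>v\<in>Linf M. \<forall>c. (AE x in M. \<bar>v x\<bar> \<le> c) \<longrightarrow> (\<integral>x. \<bar>A v x\<bar> \<partial>M) \<le> C * c)"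

definition markov_graphop :: "'a measure \<Rightarrow> (('a \<Rightarrow> real) \<Rightarrow> ('a \<Rightarrow> real)) \<Rightarrow> bool" where
  "markov_graphop M A \<longleftrightarrow> p_operator M A \<and>
     (\<forall>v\<in>Linf M. \<forall>w\<in>Linf M. (\<integral>x. A v x * w x \<partial>M) = (\<integral>x. A w x * v x \<partial>M)) \<and>
     (\<forall>v\<in>Linf M. (AE x in M. v x \<ge> 0) \<longrightarrow> (AE x in M. A v x \<ge> 0)) \<and>
     (AE x in M. A (\<lambda>_. 1) x = 1)"

abbreviation Rm :: "nat \<Rightarrow> (nat \<Rightarrow> real) measure" where
  "Rm m \<equiv> PiM {..<m} (\<lambda>_. borel)"

definition profile :: "'a measure \<Rightarrow> (('a \<Rightarrow> real) \<Rightarrow> ('a \<Rightarrow> real)) \<Rightarrow> nat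
    \<Rightarrow> (nat \<Rightarrow> real) measure set" where
  "profile M A k = {distr M (Rm (2 * k))
       (\<lambda>x. \<lambda>j\<in>{..<2 * k}. if j < k then v j x else A (v (j - k)) x) | v.
     \<forall>j<k. v j \<in> borel_measurable M \<and> (\<forall>x\<in>space M. v j x \<in> {-1..1})}"

definition rdist :: "nat \<Rightarrow> (nat \<Rightarrow> real) \<Rightarrow> (nat \<Rightarrow> real) \<Rightarrow> real" where
  "rdist m x y = sqrt (\<Sum>i<m. (x i - y i)^2)"

definition lp_nbhd :: "nat \<Rightarrow> (nat \<Rightarrow> real) set \<Rightarrow> real \<Rightarrow> (nat \<Rightarrow> real) set" where
  "lp_nbhd m U e = {x \<in> space (Rm m). \<exists>y\<in>U. rdist m x y < e}"

definition levy_prokhorov :: "nat \<Rightarrow> (nat \<Rightarrow> real) measure \<Rightarrow> (nat \<Rightarrow> real) measure \<Rightarrow> real" where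
  "levy_prokhorov m \<mu> \<nu> = Inf {e. e > 0 \<and> (\<forall>U\<in>sets (Rm m).
      measure \<mu> U \<le> measure \<nu> (lp_nbhd m U e) + e \<and>
      measure \<nu> U \<le> measure \<mu> (lp_nbhd m U e) + e)}"

definition hausdorff :: "('b \<Rightarrow> 'b \<Rightarrow> real) \<Rightarrow> 'b set \<Rightarrow> 'b set \<Rightarrow> real" where
  "hausdorff d X Y = max (SUP x\<in>X. INF y\<in>Y. d x y) (SUP y\<in>Y. INF x\<in>X. d x y)"

definition dH :: "nat \<Rightarrow> (nat \<Rightarrow> real) measure set \<Rightarrow> (nat \<Rightarrow> real) measure set \<Rightarrow> real" where
  "dH k X Y = hausdorff (levy_prokhorov (2 * k)) X Y"

definition dM :: "'a measure \<Rightarrow> (('a \<Rightarrow> real) \<Rightarrow> ('a \<Rightarrow> real))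
    \<Rightarrow> 'b measure \<Rightarrow> (('b \<Rightarrow> real) \<Rightarrow> ('b \<Rightarrow> real)) \<Rightarrow> real" where
  "dM M A N B = (\<Sum>k. (1/2) ^ Suc k * dH (Suc k) (profile M A (Suc k)) (profile N B (Suc k)))"

definition action_convergent :: "(nat \<Rightarrow> 'a measure) \<Rightarrow> (nat \<Rightarrow> (('a \<Rightarrow> real) \<Rightarrow> ('a \<Rightarrow> real))) \<Rightarrow> bool" where
  "action_convergent Ms As \<longleftrightarrow> (\<forall>k\<ge>1. \<forall>e>0. \<exists>N. \<forall>i\<ge>N. \<forall>j\<ge>N.
      dH k (profile (Ms i) (As i) k) (profile (Ms j) (As j) k) < e)"

definition rw_convergent :: "(nat \<Rightarrow> graph) \<Rightarrow> bool" where
  "rw_convergent G \<longleftrightarrow> action_convergent (\<lambda>i. nu_meas (G i)) (\<lambda>i. walk_op (G i))"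

end

theory Submission
  imports Defs "HOL-Complex_Analysis.Great_Picard"
begin

text \<open>
  Everything is reduced to events. For each stage take the countable family of events obtained
  from the binary digits of countably many generating functions by closing under intersection and
  under passing from an event \<open>S\<close> to the binary digits of \<open>1\<^sub>S A\<close>. Along a subsequence all joint
  probabilities of these events converge; the limits are realised by nested intervals as events in
  \<open>[0,1)\<close> with Lebesgue measure, and on the generated sigma-algebra the limit operator sends the
  indicator of an event to the function with the prescribed binary digits. It is an \<open>L\<^sup>1\<close>-contraction
  on the dense space of linear combinations of such indicators, hence it extends, and
  self-adjointness passes to the limit. If the generating functions at each stage contain a tuple
  of every occurring colour, for finer and finer finite colourings of the laws on the cube, then the
  limit profiles are the limits of the profiles. Both claims follow by the triangle inequality.
\<close>

subsection \<open>L1 distance and extension of operators\<close>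

text \<open>The operators live on unrelated spaces, so no common function can be tested against all
  of them, and a limit space must be built from numbers alone. Names of events are shared by all
  stages while the events are not; the joint probabilities attached to names are the only data
  compared. Bits reduce convergence in law to countably many numerical sequences. Passing from a
  number to its digits is discontinuous, but this happens only at the stages; in the limit numbers
  are read off bits, a continuous operation. Digits of 1_S A are included so that the operator, on
  combinations of events, is itself a function of the bits; intersections make these combinations
  dense. L^1 is the right norm: a positive self-adjoint operator fixing 1 contracts it, and
  conversely an L^1 contraction that preserves integrals is positive, so positivity survives both
  the limit and the extension. One tuple per colour is enough although a stage has uncountably many,
  and the colour is part of the name of a function so that tuples with one name stay comparable
  along the sequence.\<close>

definition L1_dist :: "'a measure \<Rightarrow> ('a \<Rightarrow> real) \<Rightarrow> ('a \<Rightarrow> real) \<Rightarrow> real" where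
  "L1_dist M u v = (\<integral>x. \<bar>u x - v x\<bar> \<partial>M)"

lemma L1_dist_nonneg [simp]: "0 \<le> L1_dist M u v"
  by (simp add: L1_dist_def)

lemma L1_dist_commute: "L1_dist M u v = L1_dist M v u"
  by (simp add: L1_dist_def abs_minus_commute)

lemma L1_dist_triangle:
  assumes "integrable M u" "integrable M v" "integrable M w"
  shows "L1_dist M u w \<le> L1_dist M u v + L1_dist M v w"
proof -
  have "L1_dist M u w \<le> (\<integral>x. \<bar>u x - v x\<bar> + \<bar>v x - w x\<bar> \<partial>M)"
    unfolding L1_dist_def using assms by (intro integral_mono) auto
  also have "\<dots> = L1_dist M u v + L1_dist M v w"
    unfolding L1_dist_def using assms by (intro Bochner_Integration.integral_add) auto
  finally show ?thesis .
qed

lemma L1_dist_eq_0_iff: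
  assumes "integrable M u" "integrable M v"
  shows "L1_dist M u v = 0 \<longleftrightarrow> (AE x in M. u x = v x)"
  unfolding L1_dist_def using assms by (subst integral_nonneg_eq_0_iff_AE) auto

lemma L1_dist_le_0D:
  assumes "integrable M u" "integrable M v" "\<And>e. e > 0 \<Longrightarrow> L1_dist M u v \<le> e"
  shows "AE x in M. u x = v x"
proof -
  have "L1_dist M u v \<le> 0"
    using assms(3) by (metis field_le_epsilon add_0)
  then show ?thesis
    using L1_dist_eq_0_iff[OF assms(1,2)] L1_dist_nonneg[of M u v] by linarith
qed

lemma integral_diff_le_L1_dist:
  assumes "integrable M u" "integrable M v"
  shows "\<bar>(\<integral>x. u x \<partial>M) - (\<integral>x. v x \<partial>M)\<bar> \<le> L1_dist M u v"
  unfolding L1_dist_def Bochner_Integration.integral_diff[OF assms, symmetric]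
  by (rule integral_abs_bound)

lemma L1_dist_lincomb:
  assumes "integrable M u" "integrable M u'" "integrable M v" "integrable M v'"
  shows "L1_dist M (\<lambda>x. a * u x + b * v x) (\<lambda>x. a * u' x + b * v' x)
         \<le> \<bar>a\<bar> * L1_dist M u u' + \<bar>b\<bar> * L1_dist M v v'"
proof -
  have "L1_dist M (\<lambda>x. a * u x + b * v x) (\<lambda>x. a * u' x + b * v' x)
      \<le> (\<integral>x. \<bar>a\<bar> * \<bar>u x - u' x\<bar> + \<bar>b\<bar> * \<bar>v x - v' x\<bar> \<partial>M)"
    unfolding L1_dist_def
  proof (rule integral_mono)
    fix x
    have "(a * u x + b * v x) - (a * u' x + b * v' x) = a * (u x - u' x) + b * (v x - v' x)"
      by (simp add: algebra_simps)
    then show "\<bar>(a * u x + b * v x) - (a * u' x + b * v' x)\<bar>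
        \<le> \<bar>a\<bar> * \<bar>u x - u' x\<bar> + \<bar>b\<bar> * \<bar>v x - v' x\<bar>"
      by (simp only: abs_mult[symmetric] abs_triangle_ineq)
  qed (use assms in auto)
  also have "\<dots> = \<bar>a\<bar> * L1_dist M u u' + \<bar>b\<bar> * L1_dist M v v'"
    unfolding L1_dist_def using assms by (subst Bochner_Integration.integral_add) auto
  finally show ?thesis .
qed

text \<open>Fatou's lemma in the form needed for almost-everywhere limits of L^1-bounded sequences:
  integrability of the limit is a conclusion.\<close>

lemma fatou_integral_le:
  fixes X :: "nat \<Rightarrow> 'a \<Rightarrow> real"
  assumes int: "\<And>n. integrable M (X n)" and nn: "\<And>n x. 0 \<le> X n x"
    and Y [measurable]: "Y \<in> borel_measurable M"
    and conv: "AE x in M. (\<lambda>n. X n x) \<longlonglongrightarrow> Y x"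
    and le: "\<And>n. (\<integral>x. X n x \<partial>M) \<le> c n" and c: "c \<longlonglongrightarrow> C"
  shows "integrable M Y" "(\<integral>x. Y x \<partial>M) \<le> C"
proof -
  have [measurable]: "X n \<in> borel_measurable M" for n using int by auto
  have Y0: "AE x in M. 0 \<le> Y x"
    using conv by eventually_elim (use nn in \<open>auto intro: LIMSEQ_le_const\<close>)
  have "0 \<le> c n" for n
    using le[of n] Bochner_Integration.integral_nonneg[of M "X n"] nn by (meson order_trans)
  then have C0: "0 \<le> C" using c by (auto intro: LIMSEQ_le_const)
  have "(\<integral>\<^sup>+x. ennreal (Y x) \<partial>M) = (\<integral>\<^sup>+x. liminf (\<lambda>n. ennreal (X n x)) \<partial>M)"
  proof (rule nn_integral_cong_AE)
    show "AE x in M. ennreal (Y x) = liminf (\<lambda>n. ennreal (X n x))"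
      using conv by eventually_elim (metis lim_imp_Liminf sequentially_bot tendsto_ennrealI)
  qed
  also have "\<dots> \<le> liminf (\<lambda>n. \<integral>\<^sup>+x. ennreal (X n x) \<partial>M)"
    by (rule nn_integral_liminf) auto
  also have "\<dots> = liminf (\<lambda>n. ennreal (\<integral>x. X n x \<partial>M))"
    using int nn by (subst nn_integral_eq_integral) auto
  also have "\<dots> \<le> liminf (\<lambda>n. ennreal (c n))"
    using le by (intro Liminf_mono always_eventually allI ennreal_leI)
  also have "\<dots> = ennreal C"
    using c by (intro lim_imp_Liminf) (auto intro: tendsto_ennrealI)
  finally have fin: "(\<integral>\<^sup>+x. ennreal (Y x) \<partial>M) \<le> ennreal C" .
  show "integrable M Y"
    using fin Y0 by (intro integrableI_nonneg) (auto simp: less_top[symmetric] top_unique)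
  then show "(\<integral>x. Y x \<partial>M) \<le> C"
    using fin Y0 C0 by (subst (asm) nn_integral_eq_integral) auto
qed

text \<open>If \<open>E (F n)\<close> tends to \<open>v\<close> in L^1, then \<open>T (F n)\<close>
  is Cauchy, a subsequence converges almost everywhere, and Fatou bounds the distance of its limit
  to every \<open>T f\<close> at once. By density this bound determines \<open>A v\<close> up to
  null sets, so it can serve as the description of the extension; linearity is recovered from it
  later.\<close>

proposition nonexpansive_L1_extension:
  fixes E T :: "'f \<Rightarrow> 'a \<Rightarrow> real"
  assumes E: "\<And>f. integrable M (E f)" and T: "\<And>f. integrable M (T f)"
    and nonexp: "\<And>f g. L1_dist M (T f) (T g) \<le> L1_dist M (E f) (E g)"
    and dense: "\<And>v e. integrable M v \<Longrightarrow> 0 < e \<Longrightarrow> \<exists>f. L1_dist M v (E f) < e"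
  shows "\<exists>A. \<forall>v. integrable M v \<longrightarrow>
    integrable M (A v) \<and> (\<forall>f. L1_dist M (A v) (T f) \<le> L1_dist M v (E f))"
proof -
  have "\<exists>u. integrable M u \<and> (\<forall>f. L1_dist M u (T f) \<le> L1_dist M v (E f))"
    if v: "integrable M v" for v
  proof -
    have "\<exists>f. L1_dist M v (E f) < 1 / Suc n" for n
      by (rule dense[OF v]) simp
    then obtain F where F: "\<And>n. L1_dist M v (E (F n)) < 1 / Suc n" by metis
    have Flim: "(\<lambda>n. L1_dist M v (E (F n))) \<longlonglongrightarrow> 0"
    proof (rule tendsto_sandwich[OF _ _ tendsto_const])
      show "(\<lambda>n. 1 / real (Suc n)) \<longlonglongrightarrow> 0"
        by (rule LIMSEQ_Suc[OF lim_1_over_n])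
    qed (use F in \<open>auto intro!: always_eventually less_imp_le simp del: of_nat_Suc\<close>)
    have cauchy: "\<exists>N. \<forall>i\<ge>N. \<forall>j\<ge>N. (LINT x|M. norm (T (F i) x - T (F j) x)) < e"
      if "e > 0" for e
    proof -
      have "\<forall>\<^sub>F n in sequentially. L1_dist M v (E (F n)) < e / 2"
        using order_tendstoD(2)[OF Flim] that half_gt_zero by blast
      then obtain N where N: "\<And>i. i \<ge> N \<Longrightarrow> L1_dist M v (E (F i)) < e / 2"
        unfolding eventually_sequentially by blast
      have "L1_dist M (T (F i)) (T (F j)) < e" if "i \<ge> N" "j \<ge> N" for i j
      proof -
        have "L1_dist M (T (F i)) (T (F j)) \<le> L1_dist M (E (F i)) (E (F j))" by (rule nonexp)
        also have "\<dots> \<le> L1_dist M (E (F i)) v + L1_dist M v (E (F j))"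
          by (intro L1_dist_triangle E v)
        finally show ?thesis
          using N[OF that(1)] N[OF that(2)] by (simp add: L1_dist_commute)
      qed
      then show ?thesis by (auto simp: L1_dist_def)
    qed
    obtain r where r: "strict_mono r" and rC: "AE x in M. Cauchy (\<lambda>n. T (F (r n)) x)"
      using cauchy_L1_AE_cauchy_subseq[of M "\<lambda>n. T (F n)"] T cauchy by blast
    define u where "u x = lim (\<lambda>n. T (F (r n)) x)" for x
    have [measurable]: "T f \<in> borel_measurable M" "E f \<in> borel_measurable M" for f
      using T E by auto
    have um [measurable]: "u \<in> borel_measurable M"
      unfolding u_def by measurable
    have lim: "AE x in M. (\<lambda>n. T (F (r n)) x) \<longlonglongrightarrow> u x"
      using rC by eventually_elim (simp add: u_def Cauchy_convergent convergent_LIMSEQ_iff[symmetric])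
    have *: "integrable M (\<lambda>x. \<bar>u x - T f x\<bar>)" "L1_dist M u (T f) \<le> L1_dist M v (E f)" for f
    proof -
      let ?X = "\<lambda>n x. \<bar>T (F (r n)) x - T f x\<bar>"
      let ?c = "\<lambda>n. L1_dist M v (E (F (r n))) + L1_dist M v (E f)"
      have X: "integrable M (?X n)" for n using T by auto
      have conv: "AE x in M. (\<lambda>n. ?X n x) \<longlonglongrightarrow> \<bar>u x - T f x\<bar>"
        using lim by eventually_elim (intro tendsto_intros)
      have le: "(\<integral>x. ?X n x \<partial>M) \<le> ?c n" for n
        using nonexp[of "F (r n)" f] L1_dist_triangle[OF E v E, of "F (r n)" f]
        by (simp add: L1_dist_def[symmetric] L1_dist_commute)
      have c: "?c \<longlonglongrightarrow> L1_dist M v (E f)"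
        using tendsto_add[OF LIMSEQ_subseq_LIMSEQ[OF Flim r] tendsto_const] by (simp add: o_def)
      have m: "(\<lambda>x. \<bar>u x - T f x\<bar>) \<in> borel_measurable M" by measurable
      show "integrable M (\<lambda>x. \<bar>u x - T f x\<bar>)" "L1_dist M u (T f) \<le> L1_dist M v (E f)"
        unfolding L1_dist_def[of M u]
        using fatou_integral_le[OF X _ m conv le c] by auto
    qed
    \<comment> \<open>A finite distance to one integrable function makes \<open>u\<close>
      integrable; \<open>F 0\<close> is an arbitrary choice.\<close>
    have "integrable M (\<lambda>x. u x - T (F 0) x)"
      using *(1)[of "F 0"] by (subst (asm) integrable_abs_iff) auto
    then have "integrable M (\<lambda>x. (u x - T (F 0) x) + T (F 0) x)"
      using T by (intro Bochner_Integration.integrable_add) auto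
    then show ?thesis using *(2) by auto
  qed
  then show ?thesis by metis
qed

text \<open>One factor of a pairing can thus be replaced by an L^1 approximation while the other
  stays bounded.\<close>

lemma integral_mult_L1_dist_le:
  assumes u: "integrable M u" "integrable M u'" and [measurable]: "w \<in> borel_measurable M"
    and w: "AE x in M. \<bar>w x\<bar> \<le> c"
  shows "\<bar>(\<integral>x. u x * w x \<partial>M) - (\<integral>x. u' x * w x \<partial>M)\<bar> \<le> c * L1_dist M u u'"
proof -
  have int: "integrable M (\<lambda>x. f x * w x)" if "integrable M f" for f
  proof (rule Bochner_Integration.integrable_bound[of M "\<lambda>x. c * f x"])
    show "AE x in M. norm (f x * w x) \<le> norm (c * f x)"
      using w
    proof eventually_elim
      case (elim x)
      then have "\<bar>f x\<bar> * \<bar>w x\<bar> \<le> \<bar>f x\<bar> * \<bar>c\<bar>" by (intro mult_left_mono) auto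
      then show ?case by (simp add: abs_mult mult.commute)
    qed
  qed (use that in auto)
  have "\<bar>(\<integral>x. u x * w x \<partial>M) - (\<integral>x. u' x * w x \<partial>M)\<bar> \<le> L1_dist M (\<lambda>x. u x * w x) (\<lambda>x. u' x * w x)"
    by (rule integral_diff_le_L1_dist[OF int int]) fact+
  also have "\<dots> \<le> (\<integral>x. c * \<bar>u x - u' x\<bar> \<partial>M)"
    unfolding L1_dist_def
  proof (rule integral_mono_AE)
    show "AE x in M. \<bar>u x * w x - u' x * w x\<bar> \<le> c * \<bar>u x - u' x\<bar>"
      using w
    proof eventually_elim
      case (elim x)
      have "\<bar>u x * w x - u' x * w x\<bar> = \<bar>w x\<bar> * \<bar>u x - u' x\<bar>"
        by (simp add: abs_mult[symmetric] algebra_simps)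
      also have "\<dots> \<le> c * \<bar>u x - u' x\<bar>" using elim by (intro mult_right_mono) auto
      finally show ?case .
    qed
  qed (use int[OF u(1)] int[OF u(2)] u in auto)
  also have "\<dots> = c * L1_dist M u u'" by (simp add: L1_dist_def)
  finally show ?thesis .
qed

section \<open>Essentially bounded functions and Markov operators\<close>

lemma (in prob_space) Linf_integrable:
  assumes "v \<in> Linf M" shows "integrable M v"
proof -
  obtain c where "AE x in M. norm (v x) \<le> c" "v \<in> borel_measurable M"
    using assms by (auto simp: Linf_def)
  then show ?thesis by (rule integrable_const_bound)
qed

lemma Linf_lincomb:
  assumes "v \<in> Linf M" "w \<in> Linf M"
  shows "(\<lambda>x. a * v x + b * w x) \<in> Linf M"
proof -
  obtain c d where c: "AE x in M. \<bar>v x\<bar> \<le> c" and d: "AE x in M. \<bar>w x\<bar> \<le> d"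
    using assms by (auto simp: Linf_def)
  have "AE x in M. \<bar>a * v x + b * w x\<bar> \<le> \<bar>a\<bar> * c + \<bar>b\<bar> * d"
    using c d
  proof eventually_elim
    case (elim x)
    have "\<bar>a * v x + b * w x\<bar> \<le> \<bar>a\<bar> * \<bar>v x\<bar> + \<bar>b\<bar> * \<bar>w x\<bar>"
      by (rule order_trans[OF abs_triangle_ineq]) (simp add: abs_mult)
    also have "\<dots> \<le> \<bar>a\<bar> * c + \<bar>b\<bar> * d" using elim by (intro add_mono mult_left_mono) auto
    finally show ?case .
  qed
  then show ?thesis using assms unfolding Linf_def by auto
qed

lemma const_in_Linf [simp]: "(\<lambda>x. c) \<in> Linf M"
  by (auto simp: Linf_def)

text \<open>Positivity applied to \<open>c + v\<close> and \<open>c - v\<close> traps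
  \<open>A v\<close> between \<open>-c\<close> and \<open>c\<close>. The bound is stated for
  operators not yet known to be self-adjoint, because the proof of self-adjointness of the extension
  uses it.\<close>

lemma p_operator_bound:
  assumes A: "p_operator M A"
    and pos: "\<And>v. v \<in> Linf M \<Longrightarrow> AE x in M. 0 \<le> v x \<Longrightarrow> AE x in M. 0 \<le> A v x"
    and one: "AE x in M. A (\<lambda>_. 1) x = 1"
    and v: "v \<in> borel_measurable M" and c: "AE x in M. \<bar>v x\<bar> \<le> c"
  shows "AE x in M. \<bar>A v x\<bar> \<le> c"
proof -
  have vL: "v \<in> Linf M" using v c by (auto simp: Linf_def)
  have lin: "AE x in M. A (\<lambda>y. a * v y + b * w y) x = a * A v x + b * A w x"
    if "v \<in> Linf M" "w \<in> Linf M" for v w a b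
    using A that by (auto simp: p_operator_def)
  have sign: "AE x in M. 0 \<le> A (\<lambda>y. c * 1 + s * v y) x" if "s \<in> {1, -1}" for s :: real
  proof (rule pos)
    show "(\<lambda>y. c * 1 + s * v y) \<in> Linf M" using vL by (intro Linf_lincomb) auto
    show "AE x in M. 0 \<le> c * 1 + s * v x" using c that by (auto elim!: eventually_mono)
  qed
  have "AE x in M. 0 \<le> A (\<lambda>y. c * 1 + 1 * v y) x" "AE x in M. 0 \<le> A (\<lambda>y. c * 1 + (-1) * v y) x"
    by (rule sign, simp)+
  moreover have "AE x in M. A (\<lambda>y. c * 1 + 1 * v y) x = c * A (\<lambda>_. 1) x + 1 * A v x"
    "AE x in M. A (\<lambda>y. c * 1 + (-1) * v y) x = c * A (\<lambda>_. 1) x + (-1) * A v x"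
    using vL by (intro lin; simp)+
  ultimately show ?thesis using one by eventually_elim auto
qed

lemma markov_graphop_bound:
  assumes "markov_graphop M A" "v \<in> borel_measurable M" "AE x in M. \<bar>v x\<bar> \<le> c"
  shows "AE x in M. \<bar>A v x\<bar> \<le> c"
  using assms unfolding markov_graphop_def by (intro p_operator_bound[of M A v c]) auto

text \<open>\<open>E\<close> lists a dense set of functions and \<open>T\<close> their images.
  Working with indices allows several of them to denote one function; \<open>nonexpansive\<close>
  shows that \<open>T f\<close> depends on \<open>E f\<close> only, up to null sets.\<close>

locale L1_dense_markov = prob_space M for M :: "'a measure" +
  fixes E T :: "'f \<Rightarrow> 'a \<Rightarrow> real"
  assumes E_Linf: "E f \<in> Linf M" and T_Linf: "T f \<in> Linf M"
    and lincomb: "\<exists>h. \<forall>x. E h x = a * E f x + b * E g x \<and> T h x = a * T f x + b * T g x"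
    and contraction: "(\<integral>x. \<bar>T f x\<bar> \<partial>M) \<le> (\<integral>x. \<bar>E f x\<bar> \<partial>M)"
    and sym: "(\<integral>x. T f x * E g x \<partial>M) = (\<integral>x. T g x * E f x \<partial>M)"
    and unit: "\<exists>f. (AE x in M. E f x = 1) \<and> (AE x in M. T f x = 1)"
    and dense: "integrable M v \<Longrightarrow> 0 < e \<Longrightarrow> \<exists>f. L1_dist M v (E f) < e"
begin

lemma E_int: "integrable M (E f)" and T_int: "integrable M (T f)"
  using E_Linf T_Linf Linf_integrable by auto

lemma nonexpansive: "L1_dist M (T f) (T g) \<le> L1_dist M (E f) (E g)"
proof -
  obtain h where "\<forall>x. E h x = 1 * E f x + (-1) * E g x \<and> T h x = 1 * T f x + (-1) * T g x"
    using lincomb by blast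
  then show ?thesis using contraction[of h] by (simp add: L1_dist_def)
qed

text \<open>The order of the steps matters: extend symmetry in one argument, deduce preservation of
  the integral, then positivity, then the uniform bound, and only then symmetry in both
  arguments.\<close>

proposition markov_extension:
  "\<exists>A. markov_graphop M A \<and> (\<forall>v f. integrable M v \<longrightarrow>
     integrable M (A v) \<and> L1_dist M (A v) (T f) \<le> L1_dist M v (E f))"
proof -
  obtain A where A_int: "\<And>v. integrable M v \<Longrightarrow> integrable M (A v)"
    and A_T: "\<And>v f. integrable M v \<Longrightarrow> L1_dist M (A v) (T f) \<le> L1_dist M v (E f)"
    using nonexpansive_L1_extension[of M E T, OF E_int T_int nonexpansive dense] by blast
  have A_dist: "L1_dist M (A v) (A w) \<le> L1_dist M v w"
    if v: "integrable M v" and w: "integrable M w" for v w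
  proof (rule field_le_epsilon)
    fix e :: real assume "0 < e"
    then obtain f where f: "L1_dist M v (E f) < e / 2" using dense[OF v, of "e / 2"] by auto
    have "L1_dist M (A v) (A w) \<le> L1_dist M (A v) (T f) + L1_dist M (A w) (T f)"
      using L1_dist_triangle[OF A_int[OF v] T_int A_int[OF w]] by (simp add: L1_dist_commute)
    also have "\<dots> \<le> L1_dist M v (E f) + L1_dist M w (E f)"
      by (intro add_mono A_T v w)
    also have "L1_dist M w (E f) \<le> L1_dist M v w + L1_dist M v (E f)"
      using L1_dist_triangle[OF w v E_int] by (simp add: L1_dist_commute)
    finally show "L1_dist M (A v) (A w) \<le> L1_dist M v w + e" using f by linarith
  qed
  have A_lin: "AE x in M. A (\<lambda>y. a * v y + b * w y) x = a * A v x + b * A w x"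
    if v: "integrable M v" and w: "integrable M w" for v w a b
  proof (rule L1_dist_le_0D)
    let ?vw = "\<lambda>y. a * v y + b * w y"
    have vw: "integrable M ?vw" using v w by auto
    show "integrable M (A ?vw)" by (rule A_int[OF vw])
    show i2: "integrable M (\<lambda>x. a * A v x + b * A w x)" using A_int[OF v] A_int[OF w] by auto
    fix e :: real assume "0 < e"
    \<comment> \<open>The approximations enter once before and once after the operator, so the error
      is \<open>2 * (\<bar>a\<bar> + \<bar>b\<bar>) * d\<close>; the \<open>+ 1\<close> keeps the
      denominator positive when \<open>a = b = 0\<close>.\<close>
    define d where "d = e / (2 * (\<bar>a\<bar> + \<bar>b\<bar>) + 1)"
    have d: "0 < d" "2 * (\<bar>a\<bar> + \<bar>b\<bar>) * d \<le> e"
      using \<open>0 < e\<close> by (auto simp: d_def field_simps)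
    obtain f g where f: "L1_dist M v (E f) < d" and g: "L1_dist M w (E g) < d"
      using dense[OF v d(1)] dense[OF w d(1)] by auto
    obtain h where "\<forall>x. E h x = a * E f x + b * E g x \<and> T h x = a * T f x + b * T g x"
      using lincomb by blast
    then have h: "E h = (\<lambda>x. a * E f x + b * E g x)" "T h = (\<lambda>x. a * T f x + b * T g x)"
      by auto
    have 1: "L1_dist M ?vw (E h) \<le> \<bar>a\<bar> * d + \<bar>b\<bar> * d"
      unfolding h using f g
      by (intro order_trans[OF L1_dist_lincomb[OF v E_int w E_int]] add_mono mult_left_mono) auto
    have 2: "L1_dist M (T h) (\<lambda>x. a * A v x + b * A w x) \<le> \<bar>a\<bar> * d + \<bar>b\<bar> * d"
      unfolding h using f g A_T[OF v, of f] A_T[OF w, of g]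
      by (intro order_trans[OF L1_dist_lincomb[OF T_int A_int[OF v] T_int A_int[OF w]]] add_mono mult_left_mono)
        (auto simp: L1_dist_commute)
    have "L1_dist M (A ?vw) (\<lambda>x. a * A v x + b * A w x)
        \<le> L1_dist M (A ?vw) (T h) + L1_dist M (T h) (\<lambda>x. a * A v x + b * A w x)"
      by (rule L1_dist_triangle[OF A_int[OF vw] T_int i2])
    also have "\<dots> \<le> (\<bar>a\<bar> * d + \<bar>b\<bar> * d) + (\<bar>a\<bar> * d + \<bar>b\<bar> * d)"
      using A_T[OF vw, of h] 1 2 by linarith
    also have "\<dots> \<le> e" using d(2) by (simp add: algebra_simps)
    finally show "L1_dist M (A ?vw) (\<lambda>x. a * A v x + b * A w x) \<le> e" .
  qed
  \<comment> \<open>Only one argument is extended here: the factors \<open>E g\<close> and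
    \<open>T g\<close> are bounded, so integrability of \<open>A v\<close> suffices.\<close>
  have A_E: "(\<integral>x. A v x * E g x \<partial>M) = (\<integral>x. v x * T g x \<partial>M)" if v: "integrable M v" for v g
  proof -
    obtain c d where c: "AE x in M. \<bar>E g x\<bar> \<le> c" and d: "AE x in M. \<bar>T g x\<bar> \<le> d"
      using E_Linf[of g] T_Linf[of g] by (auto simp: Linf_def)
    have [measurable]: "E g \<in> borel_measurable M" "T g \<in> borel_measurable M"
      using E_int T_int by auto
    have "\<bar>(\<integral>x. A v x * E g x \<partial>M) - (\<integral>x. v x * T g x \<partial>M)\<bar> \<le> 0 + e" if "0 < e" for e
    proof -
      define k where "k = e / (\<bar>c\<bar> + \<bar>d\<bar> + 1)"
      have k: "0 < k" "(\<bar>c\<bar> + \<bar>d\<bar>) * k \<le> e" using \<open>0 < e\<close> by (auto simp: k_def field_simps)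
      obtain f where f: "L1_dist M v (E f) < k" using dense[OF v k(1)] by auto
      have 1: "\<bar>(\<integral>x. A v x * E g x \<partial>M) - (\<integral>x. T f x * E g x \<partial>M)\<bar> \<le> c * L1_dist M (A v) (T f)"
        by (rule integral_mult_L1_dist_le[OF A_int[OF v] T_int _ c]) measurable
      have 2: "\<bar>(\<integral>x. v x * T g x \<partial>M) - (\<integral>x. E f x * T g x \<partial>M)\<bar> \<le> d * L1_dist M v (E f)"
        by (rule integral_mult_L1_dist_le[OF v E_int _ d]) measurable
      have "c * L1_dist M (A v) (T f) \<le> \<bar>c\<bar> * k"
        using A_T[OF v, of f] f by (intro mult_mono) auto
      moreover have "d * L1_dist M v (E f) \<le> \<bar>d\<bar> * k"
        using f by (intro mult_mono) auto
      moreover have "(\<integral>x. T f x * E g x \<partial>M) = (\<integral>x. E f x * T g x \<partial>M)"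
        using sym[of f g] by (simp add: mult.commute)
      ultimately show ?thesis using 1 2 k(2) by (simp add: algebra_simps)
    qed
    then show ?thesis using field_le_epsilon[of "\<bar>(\<integral>x. A v x * E g x \<partial>M) - (\<integral>x. v x * T g x \<partial>M)\<bar>" 0]
      by simp
  qed
  obtain one where one: "AE x in M. E one x = 1" "AE x in M. T one x = 1" using unit by blast
  have [measurable]: "T one \<in> borel_measurable M" "E one \<in> borel_measurable M" using T_int E_int by auto
  have A_integral: "(\<integral>x. A v x \<partial>M) = (\<integral>x. v x \<partial>M)" if v: "integrable M v" for v
  proof -
    have "(\<integral>x. A v x \<partial>M) = (\<integral>x. A v x * E one x \<partial>M)"
      using one(1) A_int[OF v] by (intro integral_cong_AE) auto
    also have "\<dots> = (\<integral>x. v x * T one x \<partial>M)" by (rule A_E[OF v])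
    also have "\<dots> = (\<integral>x. v x \<partial>M)"
      using one(2) v by (intro integral_cong_AE) auto
    finally show ?thesis .
  qed
  have A_zero: "AE x in M. A (\<lambda>_. 0) x = 0"
    using A_lin[of "\<lambda>_. 0" "\<lambda>_. 0" 0 0] by simp
  have A_abs: "(\<integral>x. \<bar>A v x\<bar> \<partial>M) \<le> (\<integral>x. \<bar>v x\<bar> \<partial>M)" if v: "integrable M v" for v
  proof -
    have "(\<integral>x. \<bar>A v x\<bar> \<partial>M) = L1_dist M (A v) (A (\<lambda>_. 0))"
      unfolding L1_dist_def using A_zero A_int[OF v] A_int[of "\<lambda>_. 0"] by (intro integral_cong_AE) auto
    also have "\<dots> \<le> L1_dist M v (\<lambda>_. 0)" using v by (intro A_dist) auto
    finally show ?thesis by (simp add: L1_dist_def)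
  qed
  \<comment> \<open>The integral of \<open>\<bar>A v\<bar>\<close> is at most that of
    \<open>\<bar>v\<bar> = v\<close>, which is the integral of \<open>A v\<close>. Hence
    \<open>A v\<close> agrees with its absolute value almost everywhere.\<close>
  have A_pos: "AE x in M. 0 \<le> A v x" if v: "integrable M v" and v0: "AE x in M. 0 \<le> v x" for v
  proof -
    have "(\<integral>x. \<bar>v x\<bar> \<partial>M) = (\<integral>x. v x \<partial>M)"
      using v0 v by (intro integral_cong_AE) auto
    then have "(\<integral>x. \<bar>A v x\<bar> - A v x \<partial>M) \<le> 0"
      using A_abs[OF v] A_integral[OF v] A_int[OF v] by simp
    moreover have "0 \<le> (\<integral>x. \<bar>A v x\<bar> - A v x \<partial>M)" by (rule Bochner_Integration.integral_nonneg) auto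
    ultimately have "(\<integral>x. \<bar>A v x\<bar> - A v x \<partial>M) = 0" by simp
    then have "AE x in M. \<bar>A v x\<bar> - A v x = 0"
      using A_int[OF v] by (subst (asm) integral_nonneg_eq_0_iff_AE) auto
    then show ?thesis by eventually_elim auto
  qed
  have A_one: "AE x in M. A (\<lambda>_. 1) x = 1"
  proof -
    have "L1_dist M (\<lambda>_. 1) (E one) = 0"
      using one(1) E_int[of one] by (subst L1_dist_eq_0_iff) (auto elim!: eventually_mono)
    then have "L1_dist M (A (\<lambda>_. 1)) (T one) \<le> 0"
      using A_T[of "\<lambda>_. 1" one] by simp
    then have "AE x in M. A (\<lambda>_. 1) x = T one x"
      using L1_dist_eq_0_iff[of M "A (\<lambda>_. 1)" "T one"] A_int[of "\<lambda>_. 1"] T_int[of one] L1_dist_nonneg[of M "A (\<lambda>_. 1)" "T one"]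
      by (auto simp del: L1_dist_nonneg)
    with one(2) show ?thesis by eventually_elim simp
  qed
  have A_p_operator: "p_operator M A"
    unfolding p_operator_def
  proof (intro conjI ballI allI impI)
    show "prob_space M" by (rule prob_space_axioms)
    show "integrable M (A v)" if "v \<in> Linf M" for v using that A_int Linf_integrable by auto
    show "AE x in M. A v x = A w x" if v: "v \<in> Linf M" and w: "w \<in> Linf M" and "AE x in M. v x = w x" for v w
    proof (rule L1_dist_le_0D)
      show "integrable M (A v)" "integrable M (A w)" using v w A_int Linf_integrable by auto
      have "L1_dist M v w = 0" using that v w Linf_integrable by (subst L1_dist_eq_0_iff) auto
      then show "L1_dist M (A v) (A w) \<le> e" if "0 < e" for e
        using A_dist[OF Linf_integrable[OF v] Linf_integrable[OF w]] that by simp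
    qed
    show "AE x in M. A (\<lambda>y. a * v y + b * w y) x = a * A v x + b * A w x"
      if v: "v \<in> Linf M" and w: "w \<in> Linf M" for v w a b
      using v w by (intro A_lin Linf_integrable)
    show "\<exists>C. \<forall>v\<in>Linf M. \<forall>c. (AE x in M. \<bar>v x\<bar> \<le> c) \<longrightarrow> (\<integral>x. \<bar>A v x\<bar> \<partial>M) \<le> C * c"
    proof (intro exI[of _ 1] ballI allI impI)
      fix v c assume v: "v \<in> Linf M" and c: "AE x in M. \<bar>v x\<bar> \<le> c"
      have "(\<integral>x. \<bar>A v x\<bar> \<partial>M) \<le> (\<integral>x. \<bar>v x\<bar> \<partial>M)" by (intro A_abs Linf_integrable v)
      also have "\<dots> \<le> c" using c Linf_integrable[OF v] by (intro integral_le_const) auto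
      finally show "(\<integral>x. \<bar>A v x\<bar> \<partial>M) \<le> 1 * c" by simp
    qed
  qed
  \<comment> \<open>Now \<open>A v\<close> is known to be bounded, so \<open>w\<close> may be
    approximated against it, and \<open>A_E\<close> applies to the approximation
    \<open>E g\<close>.\<close>
  have A_sym: "(\<integral>x. A v x * w x \<partial>M) = (\<integral>x. A w x * v x \<partial>M)" if v: "v \<in> Linf M" and w: "w \<in> Linf M" for v w
  proof -
    obtain c where c: "AE x in M. \<bar>v x\<bar> \<le> c" using v by (auto simp: Linf_def)
    have vi: "integrable M v" and wi: "integrable M w" using v w Linf_integrable by auto
    have Ac: "AE x in M. \<bar>A v x\<bar> \<le> c" using v
      by (intro p_operator_bound[OF A_p_operator A_pos A_one _ c] Linf_integrable) (auto simp: Linf_def)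
    have "\<bar>(\<integral>x. A v x * w x \<partial>M) - (\<integral>x. A w x * v x \<partial>M)\<bar> \<le> 0 + e" if "0 < e" for e
    proof -
      define k where "k = e / (2 * \<bar>c\<bar> + 1)"
      have k: "0 < k" "2 * \<bar>c\<bar> * k \<le> e" using \<open>0 < e\<close> by (auto simp: k_def field_simps)
      obtain g where g: "L1_dist M w (E g) < k" using dense[OF wi k(1)] by auto
      have 1: "\<bar>(\<integral>x. w x * A v x \<partial>M) - (\<integral>x. E g x * A v x \<partial>M)\<bar> \<le> c * L1_dist M w (E g)"
        using A_int[OF vi] by (intro integral_mult_L1_dist_le[OF wi E_int _ Ac]) auto
      have 2: "\<bar>(\<integral>x. A w x * v x \<partial>M) - (\<integral>x. T g x * v x \<partial>M)\<bar> \<le> c * L1_dist M (A w) (T g)"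
        using vi by (intro integral_mult_L1_dist_le[OF A_int[OF wi] T_int _ c]) auto
      have "c * L1_dist M w (E g) \<le> \<bar>c\<bar> * k" using g by (intro mult_mono) auto
      moreover have "c * L1_dist M (A w) (T g) \<le> \<bar>c\<bar> * k"
        using A_T[OF wi, of g] g by (intro mult_mono) auto
      ultimately show ?thesis using 1 2 A_E[OF vi, of g] k(2) by (simp add: algebra_simps)
    qed
    then show ?thesis using field_le_epsilon[of "\<bar>(\<integral>x. A v x * w x \<partial>M) - (\<integral>x. A w x * v x \<partial>M)\<bar>" 0]
      by simp
  qed
  have "markov_graphop M A"
    unfolding markov_graphop_def using A_p_operator A_sym A_pos A_one Linf_integrable by auto
  then show ?thesis using A_int A_T by blast
qed

end

subsection \<open>Levy-Prokhorov and Hausdorff distance\<close>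

lemma rdist_eq_L2_set: "rdist m x y = L2_set (\<lambda>i. x i - y i) {..<m}"
  by (simp add: rdist_def L2_set_def)

lemma rdist_triangle: "rdist m x z \<le> rdist m x y + rdist m y z"
  using L2_set_triangle_ineq[of "\<lambda>i. x i - y i" "\<lambda>i. y i - z i" "{..<m}"]
  by (simp add: rdist_eq_L2_set)

lemma rdist_le_sum: "rdist m x y \<le> (\<Sum>i<m. \<bar>x i - y i\<bar>)"
  by (simp add: rdist_eq_L2_set L2_set_le_sum_abs)

text \<open>For arbitrary \<open>U\<close> the neighbourhood is the trace of a union of open sets in
  the product over all indices; measurability is pulled back along the inclusion of
  \<open>Rm m\<close> into that product.\<close>

lemma lp_nbhd_sets [measurable, simp]: "lp_nbhd m U e \<in> sets (Rm m)"
proof -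
  define V where "V = (\<Union>y\<in>U. {x :: nat \<Rightarrow> real. rdist m x y < e})"
  have "open V"
    unfolding V_def rdist_def
    by (intro open_UN ballI open_Collect_less continuous_intros continuous_on_product_coordinates)
  then have "V \<in> sets (Pi\<^sub>M UNIV (\<lambda>_ :: nat. borel :: real measure))"
    by (simp add: sets_PiM_equal_borel)
  moreover have "(\<lambda>x. x) \<in> measurable (Rm m) (Pi\<^sub>M UNIV (\<lambda>_ :: nat. borel :: real measure))"
  proof (rule measurable_PiM_single')
    fix i :: nat
    show "(\<lambda>x. x i) \<in> borel_measurable (Rm m)"
    proof (cases "i < m")
      \<comment> \<open>Points of \<open>Rm m\<close> are constantly \<open>undefined\<close> in the
        coordinates from \<open>m\<close> on, so these coordinates are measurable too.\<close>
      case False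
      then have "(\<lambda>x. x i) \<in> borel_measurable (Rm m) \<longleftrightarrow> (\<lambda>x. undefined :: real) \<in> borel_measurable (Rm m)"
        by (intro measurable_cong) (auto simp: space_PiM PiE_def extensional_def)
      then show ?thesis by simp
    qed (simp add: measurable_component_singleton)
  qed auto
  ultimately have "(\<lambda>x. x) -` V \<inter> space (Rm m) \<in> sets (Rm m)" by (rule measurable_sets[rotated])
  also have "(\<lambda>x. x) -` V \<inter> space (Rm m) = lp_nbhd m U e"
    by (auto simp: V_def lp_nbhd_def)
  finally show ?thesis .
qed

lemma lp_nbhd_mono: "e \<le> e' \<Longrightarrow> lp_nbhd m U e \<subseteq> lp_nbhd m U e'"
  by (force simp: lp_nbhd_def)

lemma lp_nbhd_nbhd: "lp_nbhd m (lp_nbhd m U a) b \<subseteq> lp_nbhd m U (a + b)"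
proof
  fix x assume "x \<in> lp_nbhd m (lp_nbhd m U a) b"
  then obtain y z where *: "x \<in> space (Rm m)" "rdist m x y < b" "z \<in> U" "rdist m y z < a"
    by (auto simp: lp_nbhd_def)
  then have "rdist m x z < a + b" using rdist_triangle[of m x z y] by linarith
  with * show "x \<in> lp_nbhd m U (a + b)" by (auto simp: lp_nbhd_def)
qed

lemma subset_lp_nbhd:
  assumes "U \<in> sets (Rm m)" "0 < e" shows "U \<subseteq> lp_nbhd m U e"
proof
  fix x assume x: "x \<in> U"
  then have "x \<in> space (Rm m)" using assms sets.sets_into_space by blast
  moreover have "rdist m x x < e" using assms by (simp add: rdist_def)
  ultimately show "x \<in> lp_nbhd m U e" using x by (auto simp: lp_nbhd_def)
qed

text \<open>The condition under the infimum in \<open>levy_prokhorov\<close>. At a fixed precision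
  it is symmetric and adds up along chains, so nearly all estimates avoid the infimum.\<close>

definition lp_close :: "nat \<Rightarrow> real \<Rightarrow> (nat \<Rightarrow> real) measure \<Rightarrow> (nat \<Rightarrow> real) measure \<Rightarrow> bool" where
  "lp_close m e \<mu> \<nu> \<longleftrightarrow> 0 < e \<and> (\<forall>U\<in>sets (Rm m).
      measure \<mu> U \<le> measure \<nu> (lp_nbhd m U e) + e \<and>
      measure \<nu> U \<le> measure \<mu> (lp_nbhd m U e) + e)"

definition vec_prob :: "nat \<Rightarrow> (nat \<Rightarrow> real) measure set" where
  "vec_prob m = {\<mu>. prob_space \<mu> \<and> sets \<mu> = sets (Rm m)}"

lemma vec_prob_mono:
  assumes "\<mu> \<in> vec_prob m" "U \<subseteq> V" "V \<in> sets (Rm m)"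
  shows "measure \<mu> U \<le> measure \<mu> V"
proof -
  interpret prob_space \<mu> using assms by (simp add: vec_prob_def)
  show ?thesis using assms by (intro finite_measure_mono) (auto simp: vec_prob_def)
qed

lemma lp_close_commute: "lp_close m e \<mu> \<nu> \<longleftrightarrow> lp_close m e \<nu> \<mu>"
  by (auto simp: lp_close_def)

lemma lp_close_mono:
  assumes "lp_close m e \<mu> \<nu>" "e \<le> e'" "\<mu> \<in> vec_prob m" "\<nu> \<in> vec_prob m"
  shows "lp_close m e' \<mu> \<nu>"
proof -
  have "measure \<rho> (lp_nbhd m U e) \<le> measure \<rho> (lp_nbhd m U e')" if "\<rho> \<in> {\<mu>, \<nu>}" for U \<rho>
    using assms that by (intro vec_prob_mono[of _ m] lp_nbhd_mono) auto
  then have "measure \<mu> (lp_nbhd m U e) \<le> measure \<mu> (lp_nbhd m U e')"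
    "measure \<nu> (lp_nbhd m U e) \<le> measure \<nu> (lp_nbhd m U e')" for U
    by auto
  note nb = this
  show ?thesis
    unfolding lp_close_def
  proof (intro conjI ballI)
    show "0 < e'" using assms(1,2) by (simp add: lp_close_def)
    fix U assume "U \<in> sets (Rm m)"
    then have "measure \<mu> U \<le> measure \<nu> (lp_nbhd m U e) + e" "measure \<nu> U \<le> measure \<mu> (lp_nbhd m U e) + e"
      using assms(1) by (auto simp: lp_close_def)
    then show "measure \<mu> U \<le> measure \<nu> (lp_nbhd m U e') + e'" "measure \<nu> U \<le> measure \<mu> (lp_nbhd m U e') + e'"
      using nb[of U] assms(2) by linarith+
  qed
qed

lemma lp_close_trans:
  assumes "lp_close m a \<mu> \<nu>" "lp_close m b \<nu> \<rho>" "\<mu> \<in> vec_prob m" "\<rho> \<in> vec_prob m"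
  shows "lp_close m (a + b) \<mu> \<rho>"
  unfolding lp_close_def
proof (intro conjI ballI)
  show "0 < a + b" using assms by (simp add: lp_close_def)
  fix U assume U: "U \<in> sets (Rm m)"
  have 1: "measure \<mu> U \<le> measure \<nu> (lp_nbhd m U a) + a"
    and 2: "measure \<nu> (lp_nbhd m U a) \<le> measure \<rho> (lp_nbhd m (lp_nbhd m U a) b) + b"
    and 3: "measure \<rho> U \<le> measure \<nu> (lp_nbhd m U b) + b"
    and 4: "measure \<nu> (lp_nbhd m U b) \<le> measure \<mu> (lp_nbhd m (lp_nbhd m U b) a) + a"
    using assms(1,2) U by (auto simp: lp_close_def)
  have 5: "measure \<rho> (lp_nbhd m (lp_nbhd m U a) b) \<le> measure \<rho> (lp_nbhd m U (a + b))"
    by (rule vec_prob_mono[OF assms(4) lp_nbhd_nbhd]) simp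
  have 6: "measure \<mu> (lp_nbhd m (lp_nbhd m U b) a) \<le> measure \<mu> (lp_nbhd m U (a + b))"
    using lp_nbhd_nbhd[of m U b a] by (intro vec_prob_mono[OF assms(3)]) (auto simp: add.commute)
  show "measure \<mu> U \<le> measure \<rho> (lp_nbhd m U (a + b)) + (a + b)" using 1 2 5 by linarith
  show "measure \<rho> U \<le> measure \<mu> (lp_nbhd m U (a + b)) + (a + b)" using 3 4 6 by linarith
qed

text \<open>Probabilities are at most 1. This makes the infimum in the Levy-Prokhorov distance one
  of a nonempty set and the suprema in \<open>dH\<close> bounded.\<close>

lemma lp_close_1:
  assumes "\<mu> \<in> vec_prob m" "\<nu> \<in> vec_prob m"
  shows "lp_close m 1 \<mu> \<nu>"
proof -
  interpret \<mu>: prob_space \<mu> using assms by (simp add: vec_prob_def)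
  interpret \<nu>: prob_space \<nu> using assms by (simp add: vec_prob_def)
  show ?thesis unfolding lp_close_def
    using \<mu>.prob_le_1 \<nu>.prob_le_1 by (simp add: add_increasing)
qed

lemma levy_prokhorov_alt: "levy_prokhorov m \<mu> \<nu> = Inf {e. lp_close m e \<mu> \<nu>}"
  by (simp add: levy_prokhorov_def lp_close_def)

lemma lp_close_bdd_below: "bdd_below {e. lp_close m e \<mu> \<nu>}"
  by (intro bdd_belowI[of _ 0]) (auto simp: lp_close_def)

lemma levy_prokhorov_le: "lp_close m e \<mu> \<nu> \<Longrightarrow> levy_prokhorov m \<mu> \<nu> \<le> e"
  unfolding levy_prokhorov_alt by (intro cInf_lower lp_close_bdd_below) auto

lemma levy_prokhorov_nonneg:
  assumes "\<mu> \<in> vec_prob m" "\<nu> \<in> vec_prob m"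
  shows "0 \<le> levy_prokhorov m \<mu> \<nu>"
  unfolding levy_prokhorov_alt
proof (rule cInf_greatest)
  show "{e. lp_close m e \<mu> \<nu>} \<noteq> {}" using lp_close_1[OF assms] by blast
qed (simp add: lp_close_def)

lemma levy_prokhorov_lessD:
  assumes "\<mu> \<in> vec_prob m" "\<nu> \<in> vec_prob m" "levy_prokhorov m \<mu> \<nu> < e"
  shows "lp_close m e \<mu> \<nu>"
proof -
  have "{e. lp_close m e \<mu> \<nu>} \<noteq> {}" using lp_close_1[OF assms(1,2)] by auto
  then obtain e' where "lp_close m e' \<mu> \<nu>" "e' < e"
    using cInf_lessD[of "{e. lp_close m e \<mu> \<nu>}" e] assms(3) by (auto simp: levy_prokhorov_alt)
  then show ?thesis using assms by (intro lp_close_mono[of m e' \<mu> \<nu> e]) auto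
qed

text \<open>Together with \<open>dH_lessD\<close> this translates between \<open>dH\<close> and
  matchings at precision \<open>e\<close>. Nonemptiness and the lower bound 0 give the suprema and
  infima of reals their meaning.\<close>

lemma dH_le:
  assumes X: "X \<subseteq> vec_prob (2 * k)" "X \<noteq> {}" and Y: "Y \<subseteq> vec_prob (2 * k)" "Y \<noteq> {}"
    and XY: "\<And>\<mu>. \<mu> \<in> X \<Longrightarrow> \<exists>\<nu>\<in>Y. lp_close (2 * k) e \<mu> \<nu>"
    and YX: "\<And>\<nu>. \<nu> \<in> Y \<Longrightarrow> \<exists>\<mu>\<in>X. lp_close (2 * k) e \<mu> \<nu>"
  shows "dH k X Y \<le> e"
  unfolding dH_def hausdorff_def
proof (intro max.boundedI cSUP_least X Y)
  fix \<mu> assume \<mu>: "\<mu> \<in> X"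
  then obtain \<nu> where \<nu>: "\<nu> \<in> Y" "lp_close (2 * k) e \<mu> \<nu>" using XY by blast
  have "(INF \<nu>\<in>Y. levy_prokhorov (2 * k) \<mu> \<nu>) \<le> levy_prokhorov (2 * k) \<mu> \<nu>"
    using X Y \<mu> by (intro cINF_lower \<nu> bdd_belowI2[of _ 0] levy_prokhorov_nonneg) auto
  also have "\<dots> \<le> e" by (rule levy_prokhorov_le[OF \<nu>(2)])
  finally show "(INF \<nu>\<in>Y. levy_prokhorov (2 * k) \<mu> \<nu>) \<le> e" .
next
  fix \<nu> assume \<nu>: "\<nu> \<in> Y"
  then obtain \<mu> where \<mu>: "\<mu> \<in> X" "lp_close (2 * k) e \<mu> \<nu>" using YX by blast
  have "(INF \<mu>\<in>X. levy_prokhorov (2 * k) \<mu> \<nu>) \<le> levy_prokhorov (2 * k) \<mu> \<nu>"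
    using X Y \<nu> by (intro cINF_lower \<mu> bdd_belowI2[of _ 0] levy_prokhorov_nonneg) auto
  also have "\<dots> \<le> e" by (rule levy_prokhorov_le[OF \<mu>(2)])
  finally show "(INF \<mu>\<in>X. levy_prokhorov (2 * k) \<mu> \<nu>) \<le> e" .
qed

lemma hausdorff_commute:
  assumes "\<And>x y. d x y = d y x" shows "hausdorff d X Y = hausdorff d Y X"
proof -
  have "(INF y\<in>S. d x y) = (INF y\<in>S. d y x)" for x S by (intro INF_cong refl assms)
  then show ?thesis by (simp add: hausdorff_def max.commute)
qed

lemma dH_commute: "dH k X Y = dH k Y X"
  unfolding dH_def levy_prokhorov_alt
  by (rule hausdorff_commute) (simp add: lp_close_commute)

text \<open>The strict inequality yields a partner although the infimum over \<open>Y\<close> need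
  not be attained.\<close>

lemma dH_lessD:
  assumes X: "X \<subseteq> vec_prob (2 * k)" and Y: "Y \<subseteq> vec_prob (2 * k)" "Y \<noteq> {}"
    and less: "dH k X Y < e" and \<mu>: "\<mu> \<in> X"
  shows "\<exists>\<nu>\<in>Y. lp_close (2 * k) e \<mu> \<nu>"
proof -
  let ?d = "levy_prokhorov (2 * k)"
  have bb: "bdd_below (?d \<mu> ` Y)" if "\<mu> \<in> X" for \<mu>
    using X Y that by (intro bdd_belowI2[of _ 0] levy_prokhorov_nonneg) auto
  have "(INF \<nu>\<in>Y. ?d \<mu> \<nu>) \<le> (SUP \<mu>\<in>X. INF \<nu>\<in>Y. ?d \<mu> \<nu>)"
  proof (rule cSUP_upper[OF \<mu>], rule bdd_aboveI2)
    fix \<mu> assume \<mu>: "\<mu> \<in> X"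
    obtain \<nu> where \<nu>: "\<nu> \<in> Y" using Y by auto
    have "(INF \<nu>\<in>Y. ?d \<mu> \<nu>) \<le> ?d \<mu> \<nu>" by (rule cINF_lower[OF bb[OF \<mu>] \<nu>])
    also have "\<dots> \<le> 1" using X Y \<mu> \<nu> by (intro levy_prokhorov_le lp_close_1) auto
    finally show "(INF \<nu>\<in>Y. ?d \<mu> \<nu>) \<le> 1" .
  qed
  also have "\<dots> < e" using less by (simp add: dH_def hausdorff_def)
  finally obtain \<nu> where "\<nu> \<in> Y" "?d \<mu> \<nu> < e"
    using cINF_less_iff[OF Y(2) bb[OF \<mu>]] by auto
  then show ?thesis using X Y \<mu> by (intro bexI[of _ \<nu>] levy_prokhorov_lessD) auto
qed

text \<open>A negative value would give partners at precision 0, which \<open>lp_close\<close>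
  excludes.\<close>

lemma dH_nonneg:
  assumes X: "X \<subseteq> vec_prob (2 * k)" "X \<noteq> {}" and Y: "Y \<subseteq> vec_prob (2 * k)" "Y \<noteq> {}"
  shows "0 \<le> dH k X Y"
proof (rule ccontr)
  assume "\<not> 0 \<le> dH k X Y"
  moreover obtain \<mu> where "\<mu> \<in> X" using X by auto
  ultimately obtain \<nu> where "lp_close (2 * k) 0 \<mu> \<nu>" using dH_lessD[OF X(1) Y, of 0 \<mu>] by auto
  then show False by (simp add: lp_close_def)
qed

lemma dH_triangle:
  assumes X: "X \<subseteq> vec_prob (2 * k)" "X \<noteq> {}" and Y: "Y \<subseteq> vec_prob (2 * k)" "Y \<noteq> {}"
    and Z: "Z \<subseteq> vec_prob (2 * k)" "Z \<noteq> {}"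
  shows "dH k X Z \<le> dH k X Y + dH k Y Z"
proof (rule field_le_epsilon)
  fix e :: real assume e: "0 < e"
  have close: "\<exists>\<nu>\<in>Z. lp_close (2 * k) (dH k X Y + dH k Y Z + e) \<mu> \<nu>"
    if X: "X \<subseteq> vec_prob (2 * k)" and Z: "Z \<subseteq> vec_prob (2 * k)" "Z \<noteq> {}" and \<mu>: "\<mu> \<in> X" for X Z \<mu>
  proof -
    \<comment> \<open>The halves of \<open>e\<close> create the strict inequalities that
      \<open>dH_lessD\<close> requires.\<close>
    obtain \<rho> where \<rho>: "\<rho> \<in> Y" "lp_close (2 * k) (dH k X Y + e / 2) \<mu> \<rho>"
      using dH_lessD[OF X Y, of "dH k X Y + e / 2" \<mu>] e \<mu> by auto
    obtain \<nu> where \<nu>: "\<nu> \<in> Z" "lp_close (2 * k) (dH k Y Z + e / 2) \<rho> \<nu>"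
      using dH_lessD[OF Y(1) Z, of "dH k Y Z + e / 2" \<rho>] e \<rho> by auto
    have "lp_close (2 * k) ((dH k X Y + e / 2) + (dH k Y Z + e / 2)) \<mu> \<nu>"
      using X Z \<mu> \<nu>(1) by (intro lp_close_trans[OF \<rho>(2) \<nu>(2)]) auto
    then show ?thesis using \<nu> by (intro bexI[of _ \<nu>]) (auto simp: algebra_simps)
  qed
  show "dH k X Z \<le> dH k X Y + dH k Y Z + e"
  proof (rule dH_le[OF X Z])
    show "\<exists>\<nu>\<in>Z. lp_close (2 * k) (dH k X Y + dH k Y Z + e) \<mu> \<nu>" if "\<mu> \<in> X" for \<mu>
      by (rule close[OF X(1) Z that])
    show "\<exists>\<mu>\<in>X. lp_close (2 * k) (dH k X Y + dH k Y Z + e) \<mu> \<nu>" if "\<nu> \<in> Z" for \<nu>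
      using close[OF Z(1) X that] by (simp add: dH_commute lp_close_commute add.commute)
  qed
qed

subsection \<open>Laws of random vectors\<close>

definition law :: "'a measure \<Rightarrow> nat \<Rightarrow> (nat \<Rightarrow> 'a \<Rightarrow> real) \<Rightarrow> (nat \<Rightarrow> real) measure" where
  "law N m X = distr N (Rm m) (\<lambda>x. \<lambda>j\<in>{..<m}. X j x)"

lemma law_measurable:
  assumes "\<And>j. j < m \<Longrightarrow> X j \<in> borel_measurable N"
  shows "(\<lambda>x. \<lambda>j\<in>{..<m}. X j x) \<in> measurable N (Rm m)"
  using assms by (intro measurable_restrict) auto

lemma law_in_vec_prob:
  assumes "prob_space N" "\<And>j. j < m \<Longrightarrow> X j \<in> borel_measurable N"
  shows "law N m X \<in> vec_prob m"
  unfolding vec_prob_def law_def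
  using prob_space.prob_space_distr[OF assms(1) law_measurable[of m X N, OF assms(2)]] by simp

lemma measure_law:
  assumes "\<And>j. j < m \<Longrightarrow> X j \<in> borel_measurable N" "U \<in> sets (Rm m)"
  shows "measure (law N m X) U = measure N {x \<in> space N. (\<lambda>j\<in>{..<m}. X j x) \<in> U}"
  unfolding law_def using law_measurable[of m X N, OF assms(1)] assms(2)
  by (subst measure_distr) (auto intro!: arg_cong[where f = "measure N"])

text \<open>By Markov's inequality the total coordinate difference reaches \<open>e\<close> with
  probability at most \<open>e * e / e\<close>; elsewhere the Euclidean distance is below
  \<open>e\<close>. Hence the square in the hypothesis.\<close>

lemma (in prob_space) law_le_nbhd:
  assumes X: "\<And>j. j < m \<Longrightarrow> integrable M (X j)" and Y: "\<And>j. j < m \<Longrightarrow> integrable M (Y j)"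
    and e: "0 < e" and le: "(\<Sum>j<m. L1_dist M (X j) (Y j)) \<le> e * e" and U: "U \<in> sets (Rm m)"
  shows "measure (law M m X) U \<le> measure (law M m Y) (lp_nbhd m U e) + e"
proof -
  define Z where "Z x = (\<Sum>j<m. \<bar>X j x - Y j x\<bar>)" for x
  have Z: "integrable M Z" unfolding Z_def using X Y by (intro Bochner_Integration.integrable_sum) auto
  have ZI: "(\<integral>x. Z x \<partial>M) = (\<Sum>j<m. L1_dist M (X j) (Y j))"
    unfolding Z_def L1_dist_def using X Y by (intro Bochner_Integration.integral_sum) auto
  define B where "B = {x \<in> space M. Z x \<ge> e}"
  have [measurable]: "Z \<in> borel_measurable M" using Z by auto
  have B: "B \<in> sets M" unfolding B_def by measurable
  have "measure M B \<le> (\<integral>x. Z x \<partial>M) / e"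
    unfolding B_def by (rule integral_Markov_inequality_measure[where A = "{}", OF Z])
      (auto simp: Z_def e sum_nonneg)
  also have "\<dots> \<le> e" using le e by (simp add: ZI divide_le_eq)
  finally have mB: "measure M B \<le> e" .
  have Xm: "\<And>j. j < m \<Longrightarrow> X j \<in> borel_measurable M" and Ym: "\<And>j. j < m \<Longrightarrow> Y j \<in> borel_measurable M"
    using X Y by auto
  let ?P = "\<lambda>X U. {x \<in> space M. (\<lambda>j\<in>{..<m}. X j x) \<in> U}"
  have sets: "?P Y (lp_nbhd m U e) \<in> sets M"
    using measurable_sets[OF law_measurable[of m Y M, OF Ym] lp_nbhd_sets]
    by (simp add: vimage_def Int_def conj_commute)
  have "?P X U \<subseteq> ?P Y (lp_nbhd m U e) \<union> B"
  proof (intro subsetI)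
    fix x assume x: "x \<in> ?P X U"
    let ?X = "\<lambda>j\<in>{..<m}. X j x" and ?Y = "\<lambda>j\<in>{..<m}. Y j x"
    show "x \<in> ?P Y (lp_nbhd m U e) \<union> B"
    proof (cases "x \<in> B")
      case False
      have "rdist m ?Y ?X \<le> (\<Sum>i<m. \<bar>?Y i - ?X i\<bar>)" by (rule rdist_le_sum)
      also have "\<dots> = Z x" unfolding Z_def by (intro sum.cong) (auto simp: abs_minus_commute)
      also have "\<dots> < e" using False x by (auto simp: B_def)
      finally have "?Y \<in> lp_nbhd m U e" using x by (auto simp: lp_nbhd_def space_PiM)
      then show ?thesis using x by auto
    qed simp
  qed
  then have "measure M (?P X U) \<le> measure M (?P Y (lp_nbhd m U e) \<union> B)"
    using sets B by (intro finite_measure_mono) auto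
  also have "\<dots> \<le> measure M (?P Y (lp_nbhd m U e)) + measure M B"
    by (intro measure_Un_le sets B)
  finally show ?thesis using mB measure_law[of m X M, OF Xm U] measure_law[of m Y M, OF Ym lp_nbhd_sets]
    by simp
qed

lemma (in prob_space) lp_close_law:
  assumes X: "\<And>j. j < m \<Longrightarrow> integrable M (X j)" and Y: "\<And>j. j < m \<Longrightarrow> integrable M (Y j)"
    and e: "0 < e" and le: "(\<Sum>j<m. L1_dist M (X j) (Y j)) \<le> e * e"
  shows "lp_close m e (law M m X) (law M m Y)"
  unfolding lp_close_def
proof (intro conjI ballI e)
  fix U assume U: "U \<in> sets (Rm m)"
  show "measure (law M m X) U \<le> measure (law M m Y) (lp_nbhd m U e) + e"
    by (rule law_le_nbhd[OF X Y e le U])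
  have "(\<Sum>j<m. L1_dist M (Y j) (X j)) \<le> e * e"
    using le by (simp add: L1_dist_commute)
  then show "measure (law M m Y) U \<le> measure (law M m X) (lp_nbhd m U e) + e"
    by (intro law_le_nbhd[OF Y X e _ U])
qed

section \<open>Total boundedness of the laws on a cube\<close>

definition cube_prob :: "nat \<Rightarrow> (nat \<Rightarrow> real) measure set" where
  "cube_prob m = {\<mu> \<in> vec_prob m. AE x in \<mu>. \<forall>j<m. \<bar>x j\<bar> \<le> 1}"

lemma law_in_cube_prob:
  assumes N: "prob_space N" and X: "\<And>j. j < m \<Longrightarrow> X j \<in> borel_measurable N"
    and bound: "\<And>j. j < m \<Longrightarrow> AE x in N. \<bar>X j x\<bar> \<le> 1"
  shows "law N m X \<in> cube_prob m"
proof -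
  have "AE x in N. \<forall>j\<in>{..<m}. \<bar>X j x\<bar> \<le> 1"
    using bound by (intro AE_finite_allI) auto
  then have "AE x in law N m X. \<forall>j<m. \<bar>x j\<bar> \<le> 1"
    unfolding law_def
    by (subst AE_distr_iff[OF law_measurable[of m X N, OF X]]) (auto elim!: eventually_mono)
  then show ?thesis using law_in_vec_prob[OF N X] by (simp add: cube_prob_def)
qed

text \<open>The cube is cut into cells of side \<open>1 / N\<close> and the mass of each cell is
  rounded to a multiple of \<open>1 / K\<close>. Laws with the same table of rounded masses are
  close: moving inside a cell costs less than \<open>e\<close> in distance, and the rounding costs
  at most \<open>e\<close> in mass. The conclusion speaks of colours rather than of a net of centres
  because colours later become part of the names of test functions.\<close>

lemma cube_prob_totally_bounded:
  assumes e: "0 < e"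
  shows "\<exists>(col :: (nat \<Rightarrow> real) measure \<Rightarrow> nat) L. (\<forall>\<mu>. col \<mu> < L) \<and>
    (\<forall>\<mu>\<in>cube_prob m. \<forall>\<nu>\<in>cube_prob m. col \<mu> = col \<nu> \<longrightarrow> lp_close m e \<mu> \<nu>)"
proof -
  obtain N :: nat where N: "real m / e < real N" using reals_Archimedean2 by blast
  have N0: "0 < real N" using N e by (metis divide_nonneg_pos le_less_trans of_nat_0_le_iff)
  have N1: "real m / real N < e" using N N0 e by (simp add: field_simps)
  \<comment> \<open>The upper index \<open>N\<close> is attained by coordinates equal to 1.\<close>
  define Z where "Z = PiE {..<m} (\<lambda>_. {- int N..int N})"
  have Zfin: "finite Z" by (simp add: Z_def finite_PiE)
  define cell where "cell z = {x \<in> space (Rm m). \<forall>j<m. \<lfloor>real N * x j\<rfloor> = z j}" for z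
  have cell [measurable]: "cell z \<in> sets (Rm m)" for z unfolding cell_def by measurable
  have disj: "disjoint_family_on cell Z"
    unfolding disjoint_family_on_def
  proof (intro ballI impI)
    fix z z' assume "z \<in> Z" "z' \<in> Z" "z \<noteq> z'"
    then obtain j where "j < m" "z j \<noteq> z' j" by (auto simp: Z_def PiE_def extensional_def fun_eq_iff) metis
    then show "cell z \<inter> cell z' = {}" by (auto simp: cell_def)
  qed
  obtain K :: nat where K: "real (card Z) / e < real K" using reals_Archimedean2 by blast
  have K0: "0 < real K" using K e by (metis divide_nonneg_pos le_less_trans of_nat_0_le_iff)
  have K1: "real (card Z) / real K \<le> e" using K K0 e by (simp add: field_simps)
  \<comment> \<open>The colouring is defined on all measures, and the cap at \<open>K\<close> keeps
    its range finite; probability measures never reach beyond the cap.\<close>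
  define g where "g \<mu> = (\<lambda>z\<in>Z. min K (nat \<lfloor>real K * measure \<mu> (cell z)\<rfloor>))" for \<mu> :: "(nat \<Rightarrow> real) measure"
  define W where "W = PiE Z (\<lambda>_. {..K})"
  have gW: "g \<mu> \<in> W" for \<mu> by (auto simp: g_def W_def)
  have "finite W" by (simp add: W_def finite_PiE Zfin)
  then obtain h where h: "bij_betw h W {0..<card W}" using ex_bij_betw_finite_nat by blast
  have one: "measure \<mu> U \<le> measure \<nu> (lp_nbhd m U e) + e"
    if \<mu>: "\<mu> \<in> cube_prob m" and \<nu>: "\<nu> \<in> cube_prob m" and eq: "g \<mu> = g \<nu>" and U: "U \<in> sets (Rm m)" for \<mu> \<nu> U
  proof -
    interpret \<mu>: prob_space \<mu> using \<mu> by (simp add: cube_prob_def vec_prob_def)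
    interpret \<nu>: prob_space \<nu> using \<nu> by (simp add: cube_prob_def vec_prob_def)
    have [simp, measurable_cong]: "sets \<mu> = sets (Rm m)" "sets \<nu> = sets (Rm m)"
      using \<mu> \<nu> by (auto simp: cube_prob_def vec_prob_def)
    define Z' where "Z' = {z \<in> Z. cell z \<inter> U \<noteq> {}}"
    have Z': "Z' \<subseteq> Z" "finite Z'" using Zfin by (auto simp: Z'_def)
    have disj': "disjoint_family_on cell Z'" using disj Z'(1) by (rule disjoint_family_on_mono[rotated])
    have cell_le: "measure \<mu> (cell z) \<le> measure \<nu> (cell z) + 1 / K" if "z \<in> Z" for z
    proof -
      have flo: "min K (nat \<lfloor>real K * p\<rfloor>) = nat \<lfloor>real K * p\<rfloor>" if "p \<le> 1" for p :: real
      proof -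
        have "real K * p \<le> real K" using that by (simp add: mult_left_le)
        then have "\<lfloor>real K * p\<rfloor> \<le> int K" by linarith
        then show ?thesis by simp
      qed
      have "nat \<lfloor>real K * measure \<mu> (cell z)\<rfloor> = nat \<lfloor>real K * measure \<nu> (cell z)\<rfloor>"
        using fun_cong[OF eq, of z] that by (simp add: g_def flo)
      then have "\<lfloor>real K * measure \<mu> (cell z)\<rfloor> = \<lfloor>real K * measure \<nu> (cell z)\<rfloor>"
        by (simp add: nat_eq_iff2)
      then have "real K * measure \<mu> (cell z) \<le> real K * measure \<nu> (cell z) + 1" by linarith
      then show ?thesis using K0 by (simp add: field_simps)
    qed
    have "AE x in \<mu>. x \<in> U \<longrightarrow> x \<in> (\<Union>z\<in>Z'. cell z)"
    proof -
      have "AE x in \<mu>. \<forall>j<m. \<bar>x j\<bar> \<le> 1" using \<mu> by (simp add: cube_prob_def)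
      then show ?thesis
      proof (eventually_elim, intro impI)
        fix x assume b: "\<forall>j<m. \<bar>x j\<bar> \<le> 1" and x: "x \<in> U"
        let ?z = "\<lambda>j\<in>{..<m}. \<lfloor>real N * x j\<rfloor>"
        have "- int N \<le> \<lfloor>real N * x j\<rfloor> \<and> \<lfloor>real N * x j\<rfloor> \<le> int N" if "j < m" for j
        proof -
          have "\<bar>real N * x j\<bar> \<le> real N" using b that by (simp add: abs_mult mult_left_le)
          then show ?thesis by (simp add: le_floor_iff floor_le_iff abs_le_iff)
        qed
        then have "?z \<in> Z" by (auto simp: Z_def)
        moreover have "x \<in> cell ?z" using x sets.sets_into_space[OF U] by (auto simp: cell_def)
        ultimately show "x \<in> (\<Union>z\<in>Z'. cell z)" using x by (auto simp: Z'_def)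
      qed
    qed
    then have "measure \<mu> U \<le> measure \<mu> (\<Union>z\<in>Z'. cell z)"
      using Z' by (intro \<mu>.finite_measure_mono_AE) auto
    also have "\<dots> = (\<Sum>z\<in>Z'. measure \<mu> (cell z))"
      by (intro \<mu>.finite_measure_finite_Union Z' disj') auto
    also have "\<dots> \<le> (\<Sum>z\<in>Z'. measure \<nu> (cell z) + 1 / K)" using Z' by (intro sum_mono cell_le) auto
    also have "\<dots> = measure \<nu> (\<Union>z\<in>Z'. cell z) + card Z' / K"
      by (subst \<nu>.finite_measure_finite_Union) (auto simp: sum.distrib intro: Z' disj')
    also have "card Z' / K \<le> card Z / K" using Z' Zfin by (intro divide_right_mono) (auto intro: card_mono)
    \<comment> \<open>Each cell of \<open>Z'\<close> contains a point of \<open>U\<close>, and all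
      its points are within \<open>e\<close> of that one.\<close>
    also have "measure \<nu> (\<Union>z\<in>Z'. cell z) \<le> measure \<nu> (lp_nbhd m U e)"
    proof (rule \<nu>.finite_measure_mono)
      show "(\<Union>z\<in>Z'. cell z) \<subseteq> lp_nbhd m U e"
      proof
        fix x assume "x \<in> (\<Union>z\<in>Z'. cell z)"
        then obtain z y where x: "x \<in> cell z" and y: "y \<in> cell z" "y \<in> U" by (auto simp: Z'_def)
        have "\<bar>x j - y j\<bar> \<le> 1 / N" if "j < m" for j
        proof -
          have "\<lfloor>real N * x j\<rfloor> = \<lfloor>real N * y j\<rfloor>" using x y that by (simp add: cell_def)
          then have "\<bar>real N * x j - real N * y j\<bar> \<le> 1" by linarith
          then have "\<bar>real N * (x j - y j)\<bar> \<le> 1" by (simp only: right_diff_distrib)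
          then have "real N * \<bar>x j - y j\<bar> \<le> 1" by (simp only: abs_mult abs_of_nat)
          then show ?thesis using N0 by (simp add: le_divide_eq mult.commute)
        qed
        then have "(\<Sum>j<m. \<bar>x j - y j\<bar>) \<le> (\<Sum>j<m. 1 / N)" by (intro sum_mono) auto
        then have "rdist m x y < e" using rdist_le_sum[of m x y] N1 by simp
        then show "x \<in> lp_nbhd m U e" using x y by (auto simp: lp_nbhd_def cell_def)
      qed
    qed simp
    finally show ?thesis using K1 by linarith
  qed
  show ?thesis
  proof (intro exI[of _ "\<lambda>\<mu>. h (g \<mu>)"] exI[of _ "card W"] conjI allI ballI impI)
    show "h (g \<mu>) < card W" for \<mu> using bij_betwE[OF h] gW[of \<mu>] by auto
    fix \<mu> \<nu> assume \<mu>: "\<mu> \<in> cube_prob m" and \<nu>: "\<nu> \<in> cube_prob m" and "h (g \<mu>) = h (g \<nu>)"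
    then have "g \<mu> = g \<nu>" using h gW by (metis bij_betw_def inj_onD)
    then show "lp_close m e \<mu> \<nu>"
      unfolding lp_close_def using one[OF \<mu> \<nu>] one[OF \<nu> \<mu>] e by auto
  qed
qed

subsection \<open>Continuous functions of bit sequences\<close>

text \<open>The newest bit stands in front, so that lengthening a prefix is a \<open>Cons\<close>.
  The enumeration \<open>from_nat\<close> may list a name more than once; a list that gives one name
  two values is then the prefix of no assignment.\<close>

primrec pref :: "('w::countable \<Rightarrow> bool) \<Rightarrow> nat \<Rightarrow> bool list" where
  "pref b 0 = []"
| "pref b (Suc n) = b (from_nat n) # pref b n"

lemma length_pref [simp]: "length (pref b n) = n"
  by (induction n) auto

lemma pref_eq_iff: "pref b n = pref b' n \<longleftrightarrow> (\<forall>j<n. b (from_nat j) = b' (from_nat j))"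
  by (induction n) (auto simp: less_Suc_eq)

lemma pref_eq_mono: "pref b n = pref b' n \<Longrightarrow> k \<le> n \<Longrightarrow> pref b k = pref b' k"
  by (simp add: pref_eq_iff)

lemma pref_eq_coord: "pref b (Suc (to_nat w)) = pref b' (Suc (to_nat w)) \<Longrightarrow> b w = b' w"
  by simp

text \<open>Continuity on the Cantor space of bit assignments; uniformity is automatic by compactness.\<close>

definition bcont :: "(('w::countable \<Rightarrow> bool) \<Rightarrow> real) \<Rightarrow> bool" where
  "bcont \<phi> \<longleftrightarrow> (\<exists>c. \<forall>b. \<bar>\<phi> b\<bar> \<le> c) \<and>
     (\<forall>e>0. \<exists>n. \<forall>b b'. pref b n = pref b' n \<longrightarrow> \<bar>\<phi> b - \<phi> b'\<bar> < e)"

lemma bcontE: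
  assumes "bcont \<phi>" "0 < e"
  obtains n where "\<And>b b' k. n \<le> k \<Longrightarrow> pref b k = pref b' k \<Longrightarrow> \<bar>\<phi> b - \<phi> b'\<bar> < e"
proof -
  obtain n where "\<forall>b b'. pref b n = pref b' n \<longrightarrow> \<bar>\<phi> b - \<phi> b'\<bar> < e"
    using assms unfolding bcont_def by blast
  then show ?thesis using that pref_eq_mono by blast
qed

lemma bcont_const [simp]: "bcont (\<lambda>b. c)"
  by (auto simp: bcont_def)

lemma bcont_coord [simp]: "bcont (\<lambda>b. of_bool (b w))"
  unfolding bcont_def
proof (intro conjI allI impI)
  show "\<exists>c. \<forall>b :: 'a \<Rightarrow> bool. \<bar>of_bool (b w) :: real\<bar> \<le> c" by (intro exI[of _ 1]) auto
  fix e :: real assume "0 < e"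
  then show "\<exists>n. \<forall>b b' :: 'a \<Rightarrow> bool. pref b n = pref b' n \<longrightarrow> \<bar>of_bool (b w) - of_bool (b' w) :: real\<bar> < e"
    by (intro exI[of _ "Suc (to_nat w)"] allI impI, drule_tac pref_eq_coord) simp
qed

text \<open>The common source of closure under sums, products, absolute values and
  truncation.\<close>

lemma bcont_lipschitz2:
  assumes \<phi>: "bcont \<phi>" and \<psi>: "bcont \<psi>"
    and lip: "\<And>b b'. \<bar>F b - F b'\<bar> \<le> C * \<bar>\<phi> b - \<phi> b'\<bar> + D * \<bar>\<psi> b - \<psi> b'\<bar>"
    and bound: "\<And>b. \<bar>F b\<bar> \<le> K"
  shows "bcont F"
  unfolding bcont_def
proof (intro conjI allI impI)
  show "\<exists>c. \<forall>b. \<bar>F b\<bar> \<le> c" using bound by blast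
  fix e :: real assume e: "0 < e"
  define d where "d = e / (2 * (\<bar>C\<bar> + \<bar>D\<bar> + 1))"
  have d: "0 < d" "(\<bar>C\<bar> + \<bar>D\<bar>) * d < e"
  proof -
    define P where "P = \<bar>C\<bar> + \<bar>D\<bar>"
    have P: "0 \<le> P" by (simp add: P_def)
    then show "0 < d" using e unfolding d_def P_def[symmetric] by auto
    have "0 < P * e + e * 2" using P e by (intro add_nonneg_pos) auto
    then show "(\<bar>C\<bar> + \<bar>D\<bar>) * d < e"
      using P e unfolding d_def P_def[symmetric] by (simp add: divide_less_eq algebra_simps)
  qed
  obtain n1 where n1: "\<And>b b' k. n1 \<le> k \<Longrightarrow> pref b k = pref b' k \<Longrightarrow> \<bar>\<phi> b - \<phi> b'\<bar> < d"
    using bcontE[OF \<phi> d(1)] by blast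
  obtain n2 where n2: "\<And>b b' k. n2 \<le> k \<Longrightarrow> pref b k = pref b' k \<Longrightarrow> \<bar>\<psi> b - \<psi> b'\<bar> < d"
    using bcontE[OF \<psi> d(1)] by blast
  show "\<exists>n. \<forall>b b'. pref b n = pref b' n \<longrightarrow> \<bar>F b - F b'\<bar> < e"
  proof (intro exI[of _ "max n1 n2"] allI impI)
    fix b b' :: "'a \<Rightarrow> bool" assume eq: "pref b (max n1 n2) = pref b' (max n1 n2)"
    have "C * \<bar>\<phi> b - \<phi> b'\<bar> \<le> \<bar>C\<bar> * d"
      using n1[OF _ eq] by (intro mult_mono) auto
    moreover have "D * \<bar>\<psi> b - \<psi> b'\<bar> \<le> \<bar>D\<bar> * d"
      using n2[OF _ eq] by (intro mult_mono) auto
    ultimately show "\<bar>F b - F b'\<bar> < e" using lip[of b b'] d(2) by (simp add: algebra_simps)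
  qed
qed

lemma bcont_bounded: "bcont \<phi> \<Longrightarrow> \<exists>c. \<forall>b. \<bar>\<phi> b\<bar> \<le> c"
  by (simp add: bcont_def)

lemma bcont_add:
  assumes "bcont \<phi>" "bcont \<psi>" shows "bcont (\<lambda>b. \<phi> b + \<psi> b)"
proof -
  obtain c d where "\<And>b. \<bar>\<phi> b\<bar> \<le> c" "\<And>b. \<bar>\<psi> b\<bar> \<le> d" using bcont_bounded assms by metis
  then have "\<bar>\<phi> b + \<psi> b\<bar> \<le> c + d" for b by (intro order_trans[OF abs_triangle_ineq] add_mono)
  then show ?thesis by (intro bcont_lipschitz2[OF assms, where C = 1 and D = 1]) auto
qed

lemma bcont_mult:
  assumes "bcont \<phi>" "bcont \<psi>" shows "bcont (\<lambda>b. \<phi> b * \<psi> b)"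
proof -
  obtain c d where c: "\<And>b. \<bar>\<phi> b\<bar> \<le> c" and d: "\<And>b. \<bar>\<psi> b\<bar> \<le> d" using bcont_bounded assms by metis
  show ?thesis
  proof (rule bcont_lipschitz2[OF assms, where C = d and D = c and K = "c * d"])
    fix b b'
    have "\<phi> b * \<psi> b - \<phi> b' * \<psi> b' = (\<phi> b - \<phi> b') * \<psi> b + \<phi> b' * (\<psi> b - \<psi> b')"
      by (simp add: algebra_simps)
    also have "\<bar>\<dots>\<bar> \<le> \<bar>\<phi> b - \<phi> b'\<bar> * \<bar>\<psi> b\<bar> + \<bar>\<phi> b'\<bar> * \<bar>\<psi> b - \<psi> b'\<bar>"
      by (rule order_trans[OF abs_triangle_ineq]) (simp add: abs_mult)
    also have "\<dots> \<le> \<bar>\<phi> b - \<phi> b'\<bar> * d + c * \<bar>\<psi> b - \<psi> b'\<bar>"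
      using c d by (intro add_mono mult_left_mono mult_right_mono) auto
    finally show "\<bar>\<phi> b * \<psi> b - \<phi> b' * \<psi> b'\<bar> \<le> d * \<bar>\<phi> b - \<phi> b'\<bar> + c * \<bar>\<psi> b - \<psi> b'\<bar>"
      by (simp add: mult.commute)
    have "0 \<le> c" using c[of b] by linarith
    then show "\<bar>\<phi> b * \<psi> b\<bar> \<le> c * d"
      using c[of b] d[of b] by (simp add: abs_mult mult_mono)
  qed
qed

lemma bcont_diff:
  assumes "bcont \<phi>" "bcont \<psi>" shows "bcont (\<lambda>b. \<phi> b - \<psi> b)"
  using bcont_add[OF assms(1) bcont_mult[OF bcont_const[of "-1"] assms(2)]] by simp

lemma bcont_abs:
  assumes "bcont \<phi>" shows "bcont (\<lambda>b. \<bar>\<phi> b\<bar>)"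
proof -
  obtain c where "\<And>b. \<bar>\<phi> b\<bar> \<le> c" using bcont_bounded assms by metis
  then show ?thesis by (intro bcont_lipschitz2[OF assms assms, where C = 1 and D = 0 and K = c]) auto
qed

definition clip :: "real \<Rightarrow> real" where
  "clip x = max (-1) (min 1 x)"

lemma clip_bound: "\<bar>clip x\<bar> \<le> 1" and clip_eq: "\<bar>x\<bar> \<le> 1 \<Longrightarrow> clip x = x"
  and clip_lipschitz: "\<bar>clip x - clip y\<bar> \<le> \<bar>x - y\<bar>"
  by (auto simp: clip_def)

lemma clip_measurable [measurable]: "clip \<in> borel_measurable borel"
  unfolding clip_def[abs_def] by measurable

lemma bcont_clip:
  assumes "bcont \<phi>" shows "bcont (\<lambda>b. clip (\<phi> b))"
  using clip_lipschitz clip_bound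
  by (intro bcont_lipschitz2[OF assms assms, where C = 1 and D = 0 and K = 1]) auto

lemma bcont_sum_list:
  assumes "\<And>x. x \<in> set xs \<Longrightarrow> bcont (\<phi> x)" shows "bcont (\<lambda>b. \<Sum>x\<leftarrow>xs. \<phi> x b)"
  using assms
proof (induction xs)
  case (Cons x xs)
  then have "bcont (\<lambda>b. \<phi> x b + (\<Sum>x\<leftarrow>xs. \<phi> x b))" by (intro bcont_add) simp_all
  then show ?case by simp
qed simp

lemma bcont_sum:
  assumes "\<And>x. x \<in> A \<Longrightarrow> bcont (\<phi> x)" shows "bcont (\<lambda>b. \<Sum>x\<in>A. \<phi> x b)"
  using assms
proof (induction A rule: infinite_finite_induct)
  case (insert x A)
  then have "bcont (\<lambda>b. \<phi> x b + (\<Sum>x\<in>A. \<phi> x b))" by (intro bcont_add) simp_all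
  then show ?case using insert.hyps by simp
qed simp_all

lemma bcont_uniform_limit:
  assumes "\<And>e. 0 < e \<Longrightarrow> \<exists>\<psi>. bcont \<psi> \<and> (\<forall>b. \<bar>\<phi> b - \<psi> b\<bar> \<le> e)"
  shows "bcont \<phi>"
  unfolding bcont_def
proof (intro conjI allI impI)
  obtain \<psi> where \<psi>: "bcont \<psi>" "\<forall>b. \<bar>\<phi> b - \<psi> b\<bar> \<le> 1"
    using assms[OF zero_less_one] by (elim exE conjE)
  obtain c where c: "\<And>b. \<bar>\<psi> b\<bar> \<le> c" using bcont_bounded \<psi> by metis
  have "\<bar>\<phi> b\<bar> \<le> c + 1" for b using \<psi>(2)[rule_format, of b] c[of b] by linarith
  then show "\<exists>c. \<forall>b. \<bar>\<phi> b\<bar> \<le> c" by blast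
next
  fix e :: real assume e: "0 < e"
  obtain \<psi> where \<psi>: "bcont \<psi>" "\<And>b. \<bar>\<phi> b - \<psi> b\<bar> \<le> e / 3" using assms[of "e / 3"] e by auto
  obtain n where n: "\<And>b b' k. n \<le> k \<Longrightarrow> pref b k = pref b' k \<Longrightarrow> \<bar>\<psi> b - \<psi> b'\<bar> < e / 3"
    using bcontE[OF \<psi>(1), of "e / 3"] e by auto
  have "\<bar>\<phi> b - \<phi> b'\<bar> < e" if "pref b n = pref b' n" for b b'
    using \<psi>(2)[of b] \<psi>(2)[of b'] n[OF order_refl that] by linarith
  then show "\<exists>n. \<forall>b b'. pref b n = pref b' n \<longrightarrow> \<bar>\<phi> b - \<phi> b'\<bar> < e" by blast
qed

section \<open>Binary expansions\<close>

definition bin :: "(nat \<Rightarrow> bool) \<Rightarrow> real" where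
  "bin d = (\<Sum>m. (1 / 2) ^ Suc m * of_bool (d m))"

lemma bin_summable: "summable (\<lambda>m. (1 / 2 :: real) ^ Suc m * of_bool (d m))"
proof (rule summable_comparison_test)
  show "summable (\<lambda>m. (1 / 2 :: real) ^ Suc m)" by (rule sums_summable[OF power_half_series])
qed (auto intro!: exI[of _ 0])

lemma bin_nonneg: "0 \<le> bin d"
  unfolding bin_def by (intro suminf_nonneg bin_summable) auto

lemma bin_le_1: "bin d \<le> 1"
proof -
  have "bin d \<le> (\<Sum>m. (1 / 2 :: real) ^ Suc m)"
    unfolding bin_def
    by (intro suminf_le bin_summable sums_summable[OF power_half_series]) auto
  then show ?thesis using sums_unique[OF power_half_series] by simp
qed

lemma bin_Suc: "bin d = (of_bool (d 0) + bin (\<lambda>m. d (Suc m))) / 2"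
proof -
  have "bin d = (1 / 2) * of_bool (d 0) + (\<Sum>m. (1 / 2) ^ Suc (Suc m) * of_bool (d (Suc m)))"
    unfolding bin_def using suminf_split_head[OF bin_summable[of d]] by simp
  also have "(\<Sum>m. (1 / 2) ^ Suc (Suc m) * of_bool (d (Suc m))) = (1 / 2) * bin (\<lambda>m. d (Suc m))"
    unfolding bin_def using suminf_mult[OF bin_summable[of "\<lambda>m. d (Suc m)"], of "1 / 2"]
    by (simp add: mult.assoc)
  finally show ?thesis by simp
qed

text \<open>The remainder after \<open>n\<close> digits is \<open>(1 / 2) ^ n\<close> times the
  number written by the shifted sequence.\<close>

lemma bin_partial:
  "0 \<le> bin d - (\<Sum>m<n. (1 / 2) ^ Suc m * of_bool (d m))"
  "bin d - (\<Sum>m<n. (1 / 2) ^ Suc m * of_bool (d m)) \<le> (1 / 2) ^ n"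
proof -
  have "bin d - (\<Sum>m<n. (1 / 2) ^ Suc m * of_bool (d m)) = (1 / 2) ^ n * bin (\<lambda>m. d (m + n))"
  proof (induction n)
    case (Suc n)
    then show ?case using bin_Suc[of "\<lambda>m. d (m + n)"] by (simp add: algebra_simps)
  qed simp
  then show "0 \<le> bin d - (\<Sum>m<n. (1 / 2) ^ Suc m * of_bool (d m))"
    "bin d - (\<Sum>m<n. (1 / 2) ^ Suc m * of_bool (d m)) \<le> (1 / 2) ^ n"
    using bin_nonneg[of "\<lambda>m. d (m + n)"] bin_le_1[of "\<lambda>m. d (m + n)"] by (auto intro: mult_left_le)
qed

text \<open>Only expansions of \<open>y < 1\<close> are recovered by \<open>bin\<close>; hence the rescaling of \<open>[0,1]\<close> by \<open>1/2\<close> and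
  of \<open>[-1,1]\<close> to \<open>[0,1/2]\<close> below.\<close>

definition digit :: "nat \<Rightarrow> real \<Rightarrow> bool" where
  "digit m y \<longleftrightarrow> odd \<lfloor>2 ^ Suc m * y\<rfloor>"

text \<open>The first \<open>n\<close> digits add up to
  \<open>\<lfloor>2 ^ n * y\<rfloor> / 2 ^ n\<close>: doubling a real turns its floor
  \<open>f\<close> into \<open>2 * f\<close> or \<open>2 * f + 1\<close>, and the digit is the
  parity of the result.\<close>

lemma bin_digit:
  assumes "0 \<le> y" "y < 1" shows "bin (\<lambda>m. digit m y) = y"
proof -
  have part: "(\<Sum>m<n. (1 / 2) ^ Suc m * of_bool (digit m y)) = \<lfloor>2 ^ n * y\<rfloor> / 2 ^ n" for n
  proof (induction n)
    case 0
    have "\<lfloor>y\<rfloor> = 0" using assms by linarith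
    then show ?case by simp
  next
    case (Suc n)
    have "\<lfloor>2 ^ Suc n * y\<rfloor> = 2 * \<lfloor>2 ^ n * y\<rfloor> + of_bool (digit n y)"
    proof -
      have *: "2 ^ Suc n * y = 2 * (2 ^ n * y)" by simp
      have "\<lfloor>2 * (2 ^ n * y)\<rfloor> = 2 * \<lfloor>2 ^ n * y\<rfloor> \<or> \<lfloor>2 * (2 ^ n * y)\<rfloor> = 2 * \<lfloor>2 ^ n * y\<rfloor> + 1"
        by linarith
      then show ?thesis unfolding digit_def * by auto
    qed
    then have "real_of_int \<lfloor>2 ^ Suc n * y\<rfloor> = 2 * \<lfloor>2 ^ n * y\<rfloor> + of_bool (digit n y)" by simp
    then show ?case unfolding sum.lessThan_Suc Suc.IH by (simp add: field_simps power_divide)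
  qed
  have "\<bar>bin (\<lambda>m. digit m y) - y\<bar> \<le> 2 * (1 / 2) ^ n" for n
  proof -
    have "\<bar>\<lfloor>2 ^ n * y\<rfloor> - 2 ^ n * y\<bar> \<le> 1" by linarith
    moreover have "\<lfloor>2 ^ n * y\<rfloor> / 2 ^ n - y = (\<lfloor>2 ^ n * y\<rfloor> - 2 ^ n * y) / 2 ^ n"
      by (simp add: diff_divide_distrib)
    ultimately have "\<bar>\<lfloor>2 ^ n * y\<rfloor> / 2 ^ n - y\<bar> \<le> (1 / 2) ^ n"
      by (simp add: power_one_over divide_right_mono)
    then show ?thesis using bin_partial[of "\<lambda>m. digit m y" n] unfolding part by linarith
  qed
  moreover have "(\<lambda>n. 2 * (1 / 2 :: real) ^ n) \<longlonglongrightarrow> 2 * 0" by (intro tendsto_intros LIMSEQ_power_zero) auto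
  ultimately have "\<bar>bin (\<lambda>m. digit m y) - y\<bar> \<le> 0"
    by (intro LIMSEQ_le_const[of "\<lambda>n. 2 * (1 / 2 :: real) ^ n"]) auto
  then show ?thesis by simp
qed

text \<open>Finite sums of digits are continuous and the tails are uniformly small. In the limit the
  bits need not be those that \<open>digit\<close> would produce; only the number they add up to
  matters.\<close>

lemma bcont_bin: "bcont (\<lambda>b. bin (\<lambda>m. b (f m)))"
proof (rule bcont_uniform_limit)
  fix e :: real assume "0 < e"
  then obtain n where "(1 / 2 :: real) ^ n < e" using real_arch_pow_inv[of e "1 / 2"] by auto
  then have "\<bar>bin (\<lambda>m. b (f m)) - (\<Sum>m<n. (1 / 2) ^ Suc m * of_bool (b (f m)))\<bar> \<le> e" for b
    using bin_partial[of "\<lambda>m. b (f m)" n] by linarith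
  moreover have "bcont (\<lambda>b. \<Sum>m<n. (1 / 2) ^ Suc m * of_bool (b (f m)))"
    by (intro bcont_sum bcont_mult) auto
  ultimately show "\<exists>\<psi>. bcont \<psi> \<and> (\<forall>b. \<bar>bin (\<lambda>m. b (f m)) - \<psi> b\<bar> \<le> e)" by blast
qed

subsection \<open>Convergence of bit distributions\<close>

text \<open>Composition with it turns a continuous function of all bits into a function of finitely
  many. On lists that are no prefix its value is arbitrary, but such lists have probability
  zero.\<close>

definition pref_rep :: "bool list \<Rightarrow> 'w::countable \<Rightarrow> bool" where
  "pref_rep s = (SOME b. pref b (length s) = s)"

lemma pref_pref_rep: "pref (pref_rep (pref b n) :: 'w \<Rightarrow> bool) n = pref b n" for b :: "'w::countable \<Rightarrow> bool"
  unfolding pref_rep_def length_pref by (rule someI[of "\<lambda>b'. pref b' n = pref b n" b]) simp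

definition pref_prob :: "'a measure \<Rightarrow> ('a \<Rightarrow> 'w::countable \<Rightarrow> bool) \<Rightarrow> bool list \<Rightarrow> real" where
  "pref_prob N \<beta> s = measure N {x \<in> space N. pref (\<beta> x) (length s) = s}"

locale bit_space = prob_space N for N :: "'a measure" +
  fixes \<beta> :: "'a \<Rightarrow> 'w::countable \<Rightarrow> bool"
  assumes bit_sets [measurable]: "{x \<in> space N. \<beta> x w} \<in> sets N"
begin

lemma pref_eq_sets [measurable]: "{x \<in> space N. pref (\<beta> x) n = s} \<in> sets N"
proof (induction n arbitrary: s)
  case (Suc n)
  show ?case
  proof (cases s)
    case (Cons c s')
    have "{x \<in> space N. \<beta> x (from_nat n) = c} \<in> sets N"
    proof (cases c)
      case False
      have "space N - {x \<in> space N. \<beta> x (from_nat n)} \<in> sets N" by measurable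
      also have "space N - {x \<in> space N. \<beta> x (from_nat n)} = {x \<in> space N. \<beta> x (from_nat n) = c}"
        using False by auto
      finally show ?thesis .
    qed simp
    then have "{x \<in> space N. \<beta> x (from_nat n) = c} \<inter> {x \<in> space N. pref (\<beta> x) n = s'} \<in> sets N"
      using Suc[of s'] by blast
    also have "{x \<in> space N. \<beta> x (from_nat n) = c} \<inter> {x \<in> space N. pref (\<beta> x) n = s'}
        = {x \<in> space N. pref (\<beta> x) (Suc n) = s}" by (auto simp: Cons)
    finally show ?thesis .
  qed simp
qed simp

lemma pref_measurable [measurable]: "(\<lambda>x. pref (\<beta> x) n) \<in> measurable N (count_space UNIV)"
proof -
  have "(\<lambda>x. pref (\<beta> x) n) -` {s} \<inter> space N \<in> sets N" for s
    using pref_eq_sets[of n s] by (simp add: vimage_def Int_def conj_commute)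
  then show ?thesis by (simp add: measurable_count_space_eq_countable)
qed

text \<open>Continuity exhibits the function as a pointwise limit of functions of finite
  prefixes.\<close>

lemma bcont_measurable:
  assumes "bcont \<phi>" shows "(\<lambda>x. \<phi> (\<beta> x)) \<in> borel_measurable N"
proof (rule borel_measurable_LIMSEQ_real)
  show "(\<lambda>x. \<phi> (pref_rep (pref (\<beta> x) n))) \<in> borel_measurable N" for n by measurable
  fix x
  show "(\<lambda>n. \<phi> (pref_rep (pref (\<beta> x) n))) \<longlonglongrightarrow> \<phi> (\<beta> x)"
  proof (rule LIMSEQ_I)
    fix e :: real assume "0 < e"
    then obtain n where "\<And>b b' k. n \<le> k \<Longrightarrow> pref b k = pref b' k \<Longrightarrow> \<bar>\<phi> b - \<phi> b'\<bar> < e"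
      using bcontE[OF assms] by blast
    then show "\<exists>n. \<forall>k\<ge>n. norm (\<phi> (pref_rep (pref (\<beta> x) k)) - \<phi> (\<beta> x)) < e"
      using pref_pref_rep by (metis real_norm_def)
  qed
qed

lemma bcont_integrable:
  assumes "bcont \<phi>" shows "integrable N (\<lambda>x. \<phi> (\<beta> x))"
proof -
  obtain c where "\<And>b. \<bar>\<phi> b\<bar> \<le> c" using bcont_bounded[OF assms] by auto
  then show ?thesis using bcont_measurable[OF assms] by (intro integrable_const_bound[where B = c]) auto
qed

lemma pref_function_measurable: "(\<lambda>x. (h :: _ \<Rightarrow> real) (pref (\<beta> x) n)) \<in> borel_measurable N"
  by (rule measurable_compose[OF pref_measurable]) simp

lemma finite_lists_length: "finite {s :: bool list. length s = n}"
  using finite_lists_length_eq[of "UNIV :: bool set" n] by simp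

lemma pref_function_eq_sum:
  "x \<in> space N \<Longrightarrow> h (pref (\<beta> x) n) =
     (\<Sum>s | length s = n. h s * indicator {x \<in> space N. pref (\<beta> x) n = s} x)" for h :: "_ \<Rightarrow> real"
  by (subst sum.cong[OF refl, where h = "\<lambda>s. if s = pref (\<beta> x) n then h s else 0"])
    (auto simp: indicator_def finite_lists_length)

lemma integral_pref:
  fixes h :: "bool list \<Rightarrow> real"
  shows "integrable N (\<lambda>x. h (pref (\<beta> x) n))"
    and "(\<integral>x. h (pref (\<beta> x) n) \<partial>N) = (\<Sum>s | length s = n. h s * pref_prob N \<beta> s)"
proof -
  have *: "integrable N (\<lambda>x. \<Sum>s | length s = n. h s * indicator {x \<in> space N. pref (\<beta> x) n = s} x)"
    by (intro Bochner_Integration.integrable_sum integrable_mult_right integrable_real_indicator)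
      (auto simp: emeasure_eq_measure)
  show "integrable N (\<lambda>x. h (pref (\<beta> x) n))"
    by (subst Bochner_Integration.integrable_cong[OF refl pref_function_eq_sum]) (use * in auto)
  have "(\<integral>x. h (pref (\<beta> x) n) \<partial>N)
      = (\<integral>x. (\<Sum>s | length s = n. h s * indicator {x \<in> space N. pref (\<beta> x) n = s} x) \<partial>N)"
    by (intro Bochner_Integration.integral_cong refl pref_function_eq_sum)
  also have "\<dots> = (\<Sum>s | length s = n. \<integral>x. h s * indicator {x \<in> space N. pref (\<beta> x) n = s} x \<partial>N)"
    by (intro Bochner_Integration.integral_sum integrable_mult_right integrable_real_indicator)
      (auto simp: emeasure_eq_measure)
  also have "\<dots> = (\<Sum>s | length s = n. h s * pref_prob N \<beta> s)"
  proof (intro sum.cong refl)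
    fix s :: "bool list" assume s: "s \<in> {s. length s = n}"
    have "{x \<in> space N. pref (\<beta> x) n = s} \<inter> space N = {x \<in> space N. pref (\<beta> x) n = s}" by auto
    then show "(\<integral>x. h s * indicator {x \<in> space N. pref (\<beta> x) n = s} x \<partial>N) = h s * pref_prob N \<beta> s"
      using s by (simp add: pref_prob_def)
  qed
  finally show "(\<integral>x. h (pref (\<beta> x) n) \<partial>N) = (\<Sum>s | length s = n. h s * pref_prob N \<beta> s)" .
qed

lemma measure_pref:
  "measure N {x \<in> space N. Q (pref (\<beta> x) n)} = (\<Sum>s | length s = n. of_bool (Q s) * pref_prob N \<beta> s)"
proof -
  have [measurable]: "Measurable.pred (count_space UNIV) Q" by simp
  let ?S = "{x \<in> space N. Q (pref (\<beta> x) n)}"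
  have "?S \<inter> space N = ?S" by auto
  then have "measure N ?S = (\<integral>x. indicator ?S x \<partial>N)"
    using Bochner_Integration.integral_indicator[of N ?S] by simp
  also have "\<dots> = (\<integral>x. of_bool (Q (pref (\<beta> x) n)) \<partial>N)"
    by (intro Bochner_Integration.integral_cong) (auto simp: indicator_def)
  finally show ?thesis using integral_pref(2)[where h = "\<lambda>s. of_bool (Q s)" and n = n] by simp
qed

lemma L1_dist_pref_approx:
  assumes "bcont \<phi>" and "\<And>b b'. pref b n = pref b' n \<Longrightarrow> \<bar>\<phi> b - \<phi> b'\<bar> \<le> e"
  shows "L1_dist N (\<lambda>x. \<phi> (\<beta> x)) (\<lambda>x. \<phi> (pref_rep (pref (\<beta> x) n))) \<le> e"
  unfolding L1_dist_def
proof (rule integral_le_const)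
  show "integrable N (\<lambda>x. \<bar>\<phi> (\<beta> x) - \<phi> (pref_rep (pref (\<beta> x) n))\<bar>)"
    using bcont_integrable[OF assms(1)] integral_pref(1)[of "\<lambda>s. \<phi> (pref_rep s)"] by auto
  show "AE x in N. \<bar>\<phi> (\<beta> x) - \<phi> (pref_rep (pref (\<beta> x) n))\<bar> \<le> e"
    using assms(2) pref_pref_rep by (metis (mono_tags, lifting) AE_I2)
qed

end

text \<open>Weak convergence in Cantor space, expressed by cylinder probabilities, for bits that
  live on varying probability spaces.\<close>

locale bits_converge = bit_space N \<beta> for N :: "'b measure" and \<beta> :: "'b \<Rightarrow> 'w::countable \<Rightarrow> bool" +
  fixes Ni :: "nat \<Rightarrow> 'a measure" and \<beta>i :: "nat \<Rightarrow> 'a \<Rightarrow> 'w \<Rightarrow> bool"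
  assumes stage: "bit_space (Ni i) (\<beta>i i)"
    and pref_prob_tendsto: "(\<lambda>i. pref_prob (Ni i) (\<beta>i i) s) \<longlonglongrightarrow> pref_prob N \<beta> s"
begin

sublocale stage: bit_space "Ni i" "\<beta>i i" for i
  by (rule stage)

text \<open>Up to \<open>e / 3\<close> on either side the integrand depends on \<open>n\<close>
  bits, and then the integral is a finite combination of cylinder probabilities.\<close>

lemma integral_tendsto:
  assumes "bcont \<phi>"
  shows "(\<lambda>i. \<integral>x. \<phi> (\<beta>i i x) \<partial>Ni i) \<longlonglongrightarrow> (\<integral>x. \<phi> (\<beta> x) \<partial>N)"
proof (rule LIMSEQ_I)
  fix e :: real assume "0 < e"
  then have e: "0 < e / 3" by simp
  obtain n where n: "\<And>b b'. pref b n = pref b' n \<Longrightarrow> \<bar>\<phi> b - \<phi> b'\<bar> \<le> e / 3"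
    using bcontE[OF assms e] by (metis less_imp_le order_refl)
  let ?h = "\<lambda>s. \<phi> (pref_rep s)"
  have "(\<lambda>i. \<integral>x. ?h (pref (\<beta>i i x) n) \<partial>Ni i) \<longlonglongrightarrow> (\<integral>x. ?h (pref (\<beta> x) n) \<partial>N)"
    unfolding stage.integral_pref(2)[where h = ?h and n = n] integral_pref(2)[where h = ?h and n = n]
    by (intro tendsto_intros pref_prob_tendsto)
  from LIMSEQ_D[OF this e] obtain i0 where i0:
    "\<And>i. i \<ge> i0 \<Longrightarrow> \<bar>(\<integral>x. ?h (pref (\<beta>i i x) n) \<partial>Ni i) - (\<integral>x. ?h (pref (\<beta> x) n) \<partial>N)\<bar> < e / 3"
    by auto
  have "\<bar>(\<integral>x. \<phi> (\<beta>i i x) \<partial>Ni i) - (\<integral>x. \<phi> (\<beta> x) \<partial>N)\<bar> < e" if "i \<ge> i0" for i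
  proof -
    have 1: "\<bar>(\<integral>x. \<phi> (\<beta>i i x) \<partial>Ni i) - (\<integral>x. ?h (pref (\<beta>i i x) n) \<partial>Ni i)\<bar> \<le> e / 3"
      using integral_diff_le_L1_dist[OF stage.bcont_integrable[OF assms] stage.integral_pref(1)[of _ ?h n]]
        stage.L1_dist_pref_approx[OF assms n] by (meson order_trans)
    have 2: "\<bar>(\<integral>x. \<phi> (\<beta> x) \<partial>N) - (\<integral>x. ?h (pref (\<beta> x) n) \<partial>N)\<bar> \<le> e / 3"
      using integral_diff_le_L1_dist[OF bcont_integrable[OF assms] integral_pref(1)[of ?h n]]
        L1_dist_pref_approx[OF assms n] by (meson order_trans)
    show ?thesis using 1 2 i0[OF that] by linarith
  qed
  then show "\<exists>i0. \<forall>i\<ge>i0. norm ((\<integral>x. \<phi> (\<beta>i i x) \<partial>Ni i) - (\<integral>x. \<phi> (\<beta> x) \<partial>N)) < e" by auto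
qed

lemma L1_dist_tendsto:
  assumes "bcont \<phi>" "bcont \<psi>"
  shows "(\<lambda>i. L1_dist (Ni i) (\<lambda>x. \<phi> (\<beta>i i x)) (\<lambda>x. \<psi> (\<beta>i i x))) \<longlonglongrightarrow> L1_dist N (\<lambda>x. \<phi> (\<beta> x)) (\<lambda>x. \<psi> (\<beta> x))"
  unfolding L1_dist_def by (intro integral_tendsto[of "\<lambda>b. \<bar>\<phi> b - \<psi> b\<bar>"] bcont_abs bcont_diff assms)

text \<open>Both laws are images of the prefix distributions under the same map, so the l^1 distance
  of these distributions bounds the difference on every event, uniformly in
  \<open>h\<close>.\<close>

lemma pref_law_close:
  assumes e: "0 < e"
  shows "\<forall>\<^sub>F i in sequentially. \<forall>h :: nat \<Rightarrow> bool list \<Rightarrow> real.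
    lp_close m e (law (Ni i) m (\<lambda>j x. h j (pref (\<beta>i i x) n))) (law N m (\<lambda>j x. h j (pref (\<beta> x) n)))"
proof -
  have "(\<lambda>i. \<Sum>s | length s = n. \<bar>pref_prob (Ni i) (\<beta>i i) s - pref_prob N \<beta> s\<bar>)
      \<longlonglongrightarrow> (\<Sum>s | length s = n. \<bar>pref_prob N \<beta> s - pref_prob N \<beta> s\<bar>)"
    by (intro tendsto_intros pref_prob_tendsto)
  then have "\<forall>\<^sub>F i in sequentially. (\<Sum>s | length s = n. \<bar>pref_prob (Ni i) (\<beta>i i) s - pref_prob N \<beta> s\<bar>) < e"
    using e by (intro order_tendstoD(2)) auto
  then show ?thesis
  proof (eventually_elim, intro allI)
    fix i and h :: "nat \<Rightarrow> bool list \<Rightarrow> real"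
    assume small: "(\<Sum>s | length s = n. \<bar>pref_prob (Ni i) (\<beta>i i) s - pref_prob N \<beta> s\<bar>) < e"
    let ?\<mu> = "law (Ni i) m (\<lambda>j x. h j (pref (\<beta>i i x) n))" and ?\<nu> = "law N m (\<lambda>j x. h j (pref (\<beta> x) n))"
    have vp: "?\<mu> \<in> vec_prob m" "?\<nu> \<in> vec_prob m"
      by (intro law_in_vec_prob stage.pref_function_measurable stage.prob_space_axioms
          pref_function_measurable prob_space_axioms)+
    have diff: "\<bar>measure ?\<mu> U - measure ?\<nu> U\<bar> \<le> e" if U: "U \<in> sets (Rm m)" for U
    proof -
      let ?Q = "\<lambda>s. (\<lambda>j\<in>{..<m}. h j s) \<in> U"
      have "measure ?\<mu> U - measure ?\<nu> U
          = (\<Sum>s | length s = n. of_bool (?Q s) * (pref_prob (Ni i) (\<beta>i i) s - pref_prob N \<beta> s))"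
        using measure_law[of m "\<lambda>j x. h j (pref (\<beta>i i x) n)" "Ni i" U, OF stage.pref_function_measurable U]
          measure_law[of m "\<lambda>j x. h j (pref (\<beta> x) n)" N U, OF pref_function_measurable U]
        by (simp add: stage.measure_pref[of i ?Q n] measure_pref[of ?Q n] sum_subtractf right_diff_distrib)
      also have "\<bar>\<dots>\<bar> \<le> (\<Sum>s | length s = n. \<bar>of_bool (?Q s) * (pref_prob (Ni i) (\<beta>i i) s - pref_prob N \<beta> s)\<bar>)"
        by (rule sum_abs)
      also have "\<dots> \<le> (\<Sum>s | length s = n. \<bar>pref_prob (Ni i) (\<beta>i i) s - pref_prob N \<beta> s\<bar>)"
        by (intro sum_mono) auto
      finally show ?thesis using small by linarith
    qed
    show "lp_close m e ?\<mu> ?\<nu>"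
      unfolding lp_close_def
    proof (intro conjI ballI e)
      fix U assume U: "U \<in> sets (Rm m)"
      have "measure ?\<mu> U \<le> measure ?\<mu> (lp_nbhd m U e)" "measure ?\<nu> U \<le> measure ?\<nu> (lp_nbhd m U e)"
        by (intro vec_prob_mono[OF vp(1)] vec_prob_mono[OF vp(2)] subset_lp_nbhd U e lp_nbhd_sets)+
      then show "measure ?\<mu> U \<le> measure ?\<nu> (lp_nbhd m U e) + e" "measure ?\<nu> U \<le> measure ?\<mu> (lp_nbhd m U e) + e"
        using diff[OF U] by linarith+
    qed
  qed
qed

lemma law_close:
  assumes \<Phi>: "\<And>j. j < m \<Longrightarrow> bcont (\<Phi> j)" and e: "0 < e"
  shows "\<forall>\<^sub>F i in sequentially.
    lp_close m e (law (Ni i) m (\<lambda>j x. \<Phi> j (\<beta>i i x))) (law N m (\<lambda>j x. \<Phi> j (\<beta> x)))"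
proof -
  \<comment> \<open>At precision \<open>e / 3\<close>, \<open>lp_close_law\<close> asks for a total
    L^1 error of at most \<open>(e / 3) * (e / 3)\<close> over \<open>m\<close> coordinates; the
    \<open>+ 1\<close> covers \<open>m = 0\<close>.\<close>
  define d where "d = (e / 3) * (e / 3) / (real m + 1)"
  have "0 \<le> real m * ((e / 3) * (e / 3))" by simp
  then have d: "0 < d" "real m * d \<le> (e / 3) * (e / 3)"
    using e by (auto simp: d_def divide_le_eq algebra_simps)
  have "\<exists>n. \<forall>b b' k. n \<le> k \<longrightarrow> pref b k = pref b' k \<longrightarrow> \<bar>\<Phi> j b - \<Phi> j b'\<bar> \<le> d" if "j < m" for j
    using bcontE[OF \<Phi>[OF that] d(1)] by (metis less_imp_le)
  then obtain n where n: "\<And>j b b' k. j < m \<Longrightarrow> n j \<le> k \<Longrightarrow> pref b k = pref b' k \<Longrightarrow> \<bar>\<Phi> j b - \<Phi> j b'\<bar> \<le> d"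
    by metis
  define k where "k = Max (n ` {..<m})"
  have k: "\<bar>\<Phi> j b - \<Phi> j b'\<bar> \<le> d" if "j < m" "pref b k = pref b' k" for j b b'
    using n[OF that(1) _ that(2)] that(1) by (simp add: k_def)
  let ?h = "\<lambda>j s. \<Phi> j (pref_rep s)"
  have approx: "lp_close m (e / 3) (law N' m (\<lambda>j x. \<Phi> j (\<beta>' x))) (law N' m (\<lambda>j x. ?h j (pref (\<beta>' x) k)))"
    if "bit_space N' \<beta>'" for N' :: "'c measure" and \<beta>'
  proof -
    interpret N': bit_space N' \<beta>' by fact
    have "(\<Sum>j<m. L1_dist N' (\<lambda>x. \<Phi> j (\<beta>' x)) (\<lambda>x. ?h j (pref (\<beta>' x) k))) \<le> (\<Sum>j<m. d)"
      by (intro sum_mono N'.L1_dist_pref_approx \<Phi> k) auto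
    then show ?thesis using d e \<Phi>
      by (intro N'.lp_close_law N'.bcont_integrable N'.integral_pref(1)[of "?h _"]) auto
  qed
  have vp: "law N' m (\<lambda>j x. \<Phi> j (\<beta>' x)) \<in> vec_prob m" "law N' m (\<lambda>j x. ?h j (pref (\<beta>' x) k)) \<in> vec_prob m"
    if "bit_space N' \<beta>'" for N' :: "'c measure" and \<beta>'
  proof -
    interpret N': bit_space N' \<beta>' by fact
    show "law N' m (\<lambda>j x. \<Phi> j (\<beta>' x)) \<in> vec_prob m" "law N' m (\<lambda>j x. ?h j (pref (\<beta>' x) k)) \<in> vec_prob m"
      by (intro law_in_vec_prob N'.prob_space_axioms N'.bcont_measurable \<Phi>
          N'.pref_function_measurable[of "?h _"]; assumption)+
  qed
  have "0 < e / 3" using e by simp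
  from pref_law_close[OF this, of m k] show ?thesis
  proof eventually_elim
    case (elim i)
    have bs: "bit_space (Ni i) (\<beta>i i)" "bit_space N \<beta>" by (rule stage) (rule bit_space_axioms)
    note 1 = approx[OF bs(1)] and 3 = approx[OF bs(2)]
    note 2 = elim[rule_format, of ?h]
    have "lp_close m (e / 3 + e / 3) (law (Ni i) m (\<lambda>j x. \<Phi> j (\<beta>i i x))) (law N m (\<lambda>j x. ?h j (pref (\<beta> x) k)))"
      by (rule lp_close_trans[OF 1 2 vp(1)[OF bs(1)] vp(2)[OF bs(2)]])
    then have "lp_close m ((e / 3 + e / 3) + e / 3) (law (Ni i) m (\<lambda>j x. \<Phi> j (\<beta>i i x))) (law N m (\<lambda>j x. \<Phi> j (\<beta> x)))"
      by (rule lp_close_trans[OF _ 3[unfolded lp_close_commute[of m "e / 3" "law N m (\<lambda>j x. \<Phi> j (\<beta> x))"]]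
            vp(1)[OF bs(1)] vp(1)[OF bs(2)]])
    then show ?case by simp
  qed
qed

end

subsection \<open>Realising the limit by intervals\<close>

context
  fixes p :: "bool list \<Rightarrow> real"
begin

text \<open>The interval of \<open>s\<close> is \<open>[left_end s, left_end s + p s)\<close>; its
  left part, of length \<open>p (False # s)\<close>, goes to \<open>False\<close>. Below,
  \<open>nest x n\<close> is the address of \<open>x\<close> among the intervals of depth
  \<open>n\<close>.\<close>

primrec left_end :: "bool list \<Rightarrow> real" where
  "left_end [] = 0"
| "left_end (c # s) = left_end s + (if c then p (False # s) else 0)"

primrec nest :: "real \<Rightarrow> nat \<Rightarrow> bool list" where
  "nest x 0 = []"
| "nest x (Suc n) = (left_end (nest x n) + p (False # nest x n) \<le> x) # nest x n"

lemma length_nest: "length (nest x n) = n"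
  by (induction n) auto

lemma nest_eq_pref_mono: "nest x n = pref b n \<Longrightarrow> k \<le> n \<Longrightarrow> nest x k = pref b k"
  by (induction n) (auto simp: le_Suc_eq)

context
  assumes p_Nil: "p [] = 1" and p_nonneg: "\<And>s. 0 \<le> p s"
    and p_split: "\<And>s. p (True # s) + p (False # s) = p s"
begin

text \<open>Half-open intervals make the two children an exact partition of their parent, with lists
  of mass zero receiving the empty interval.\<close>

lemma nest_interval: "{x \<in> {0..<1}. nest x (length s) = s} = {left_end s..<left_end s + p s}"
proof (induction s)
  case (Cons c s)
  have "{x \<in> {0..<1}. nest x (length (c # s)) = c # s}
      = {x \<in> {x \<in> {0..<1}. nest x (length s) = s}. (left_end s + p (False # s) \<le> x) = c}"
    by auto
  also have "\<dots> = {x \<in> {left_end s..<left_end s + p s}. (left_end s + p (False # s) \<le> x) = c}"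
    by (simp only: Cons.IH)
  also have "\<dots> = {left_end (c # s)..<left_end (c # s) + p (c # s)}"
    using p_split[of s] p_nonneg[of "True # s"] p_nonneg[of "False # s"] by (cases c) auto
  finally show ?case .
qed (use p_Nil in auto)

text \<open>The half-open interval with address \<open>nest x n\<close> contains \<open>x\<close>,
  so it has positive length. This holds at every point, not just at almost every one, and is the
  source of the pointwise property \<open>adherent\<close>.\<close>

lemma nest_pos:
  assumes "x \<in> {0..<1}" shows "0 < p (nest x n)"
proof -
  have "x \<in> {x \<in> {0..<1}. nest x (length (nest x n)) = nest x n}"
    using assms by (simp add: length_nest)
  then have "x \<in> {left_end (nest x n)..<left_end (nest x n) + p (nest x n)}"
    using nest_interval[of "nest x n"] by blast
  then show ?thesis by auto
qed

text \<open>The interval lengths realise the prescribed prefix probabilities. The sigma-algebra is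
  cut down to the one generated by the bits, because on the full Borel sigma-algebra combinations of
  bits need not be dense in L^1.\<close>

lemma bit_measure_exists:
  assumes realizable: "\<And>s. 0 < p s \<Longrightarrow> \<exists>b :: 'w::countable \<Rightarrow> bool. pref b (length s) = s"
  shows "\<exists>(\<Omega> :: real measure) (\<beta> :: real \<Rightarrow> 'w \<Rightarrow> bool). bit_space \<Omega> \<beta> \<and>
    (\<forall>s. pref_prob \<Omega> \<beta> s = p s) \<and>
    sets \<Omega> = sigma_sets (space \<Omega>) (range (\<lambda>w. {x \<in> space \<Omega>. \<beta> x w})) \<and>
    (\<forall>x\<in>space \<Omega>. \<forall>n. 0 < p (pref (\<beta> x) n))"
proof -
  \<comment> \<open>The newest bit is in front, so this \<open>hd\<close> is the bit at position
    \<open>to_nat w\<close>.\<close>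
  define \<beta> :: "real \<Rightarrow> 'w \<Rightarrow> bool" where "\<beta> x w = hd (nest x (Suc (to_nat w)))" for x w
  have pref_\<beta>: "pref (\<beta> x) n = nest x n" if x: "x \<in> {0..<1}" for x n
  proof -
    \<comment> \<open>\<open>f j\<close> is the canonical position of the name listed at position
      \<open>j\<close>. A prefix of \<open>x\<close> that includes both positions has positive mass,
      so by \<open>realizable\<close> the two bits agree.\<close>
    define f where "f j = to_nat (from_nat j :: 'w)" for j
    define k where "k = Suc (Max (insert n (f ` {..<n})))"
    have k: "n \<le> k" "\<And>j. j < n \<Longrightarrow> f j < k"
      unfolding k_def by (auto simp: less_Suc_eq_le Max_ge_iff le_SucI)
    obtain b :: "'w \<Rightarrow> bool" where "pref b (length (nest x k)) = nest x k"
      using realizable[OF nest_pos[OF x]] by blast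
    then have b: "nest x j = pref b j" if "j \<le> k" for j
      using nest_eq_pref_mono[of x k b j] that by (simp add: length_nest)
    have "\<beta> x (from_nat j) = b (from_nat j)" if "j < n" for j
      using b[of "Suc (f j)"] k(2)[OF that] by (simp add: \<beta>_def f_def Suc_le_eq del: nest.simps)
    then have "pref (\<beta> x) n = pref b n" by (simp add: pref_eq_iff)
    also have "\<dots> = nest x n" using b[OF k(1)] by simp
    finally show ?thesis .
  qed
  let ?B = "range (\<lambda>w. {x \<in> {0..<1}. \<beta> x w})"
  define P where "P = restrict_space lborel {0..<1 :: real}"
  \<comment> \<open>The image under the identity coarsens the sigma-algebra and keeps the values of
    the measure.\<close>
  define \<Omega> where "\<Omega> = distr P (sigma {0..<1} ?B) (\<lambda>x. x)"
  have space_P: "space P = {0..<1}" by (simp add: P_def space_restrict_space)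
  have P: "prob_space P"
    by (rule prob_spaceI) (simp add: P_def space_restrict_space emeasure_restrict_space)
  have Bsets: "{x \<in> {0..<1}. \<beta> x w} \<in> sets P" for w
  proof -
    have "{x \<in> {0..<1}. \<beta> x w} = (\<Union>s\<in>{s. length s = to_nat w}. {left_end (True # s)..<left_end (True # s) + p (True # s)})"
      unfolding nest_interval[symmetric] \<beta>_def by (auto simp: length_nest)
    also have "\<dots> \<in> sets borel"
      using finite_lists_length_eq[of "UNIV :: bool set" "to_nat w"] by (intro sets.finite_UN) auto
    finally show ?thesis by (auto simp: P_def sets_restrict_space_iff)
  qed
  have space_\<Omega>: "space \<Omega> = {0..<1}"
    unfolding \<Omega>_def space_distr by (rule space_measure_of) auto
  have sets_\<Omega>: "sets \<Omega> = sigma_sets {0..<1} ?B"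
    unfolding \<Omega>_def sets_distr by (rule sets_measure_of) auto
  have id: "(\<lambda>x. x) \<in> measurable P (sigma {0..<1} ?B)"
  proof (rule measurable_measure_of)
    fix y assume "y \<in> ?B"
    then obtain w where y: "y = {x \<in> {0..<1}. \<beta> x w}" by blast
    have "(\<lambda>x. x) -` y \<inter> space P = y" unfolding y space_P by auto
    then show "(\<lambda>x. x) -` y \<inter> space P \<in> sets P" using Bsets y by simp
  qed (auto simp: space_P)
  have bits: "bit_space \<Omega> \<beta>"
  proof (intro bit_space.intro bit_space_axioms.intro)
    show "prob_space \<Omega>" unfolding \<Omega>_def by (rule prob_space.prob_space_distr[OF P id])
    show "{x \<in> space \<Omega>. \<beta> x w} \<in> sets \<Omega>" for w unfolding space_\<Omega> sets_\<Omega> by (intro sigma_sets.Basic) auto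
  qed
  have "pref_prob \<Omega> \<beta> s = p s" for s
  proof -
    interpret bit_space \<Omega> \<beta> by fact
    have eq: "{x \<in> space \<Omega>. pref (\<beta> x) (length s) = s} = {left_end s..<left_end s + p s}"
      unfolding nest_interval[symmetric] space_\<Omega> using pref_\<beta> by auto
    have sub: "{left_end s..<left_end s + p s} \<subseteq> {0..<1}"
      unfolding nest_interval[symmetric] by auto
    have "{left_end s..<left_end s + p s} \<in> sets \<Omega>"
      unfolding eq[symmetric] by (rule pref_eq_sets)
    then have "pref_prob \<Omega> \<beta> s = measure P ({left_end s..<left_end s + p s} \<inter> space P)"
      unfolding pref_prob_def eq unfolding \<Omega>_def
      by (subst measure_distr[OF id]) (auto simp: Int_def intro!: arg_cong[where f = "measure P"])
    also have "\<dots> = measure lborel {left_end s..<left_end s + p s}"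
    proof -
      have "{left_end s..<left_end s + p s} \<inter> space P = {left_end s..<left_end s + p s}"
        using sub space_P by blast
      then show ?thesis unfolding P_def using sub by (simp only:) (intro measure_restrict_space; simp)
    qed
    also have "\<dots> = p s" using p_nonneg[of s] by (simp add: measure_def)
    finally show ?thesis .
  qed
  moreover have "0 < p (pref (\<beta> x) n)" if "x \<in> space \<Omega>" for x n
    using nest_pos pref_\<beta> that by (simp add: space_\<Omega>)
  ultimately show ?thesis
    using bits sets_\<Omega> unfolding space_\<Omega>[symmetric] by blast
qed

end

end

text \<open>Formal combinations, kept as lists, so that the same index also names the image under
  the operator, \<open>comb_op\<close>.\<close>

definition bit_comb :: "(real \<times> 'w) list \<Rightarrow> ('w \<Rightarrow> bool) \<Rightarrow> real" where
  "bit_comb F b = (\<Sum>(c, w)\<leftarrow>F. c * of_bool (b w))"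

lemma bit_comb_Nil [simp]: "bit_comb [] b = 0"
  and bit_comb_Cons [simp]: "bit_comb ((c, w) # F) b = c * of_bool (b w) + bit_comb F b"
  by (simp_all add: bit_comb_def)

definition scale_comb :: "real \<Rightarrow> (real \<times> 'w) list \<Rightarrow> (real \<times> 'w) list" where
  "scale_comb a F = map (\<lambda>(c, w). (a * c, w)) F"

lemma bit_comb_lincomb:
  "bit_comb (scale_comb a F @ scale_comb a' G) b = a * bit_comb F b + a' * bit_comb G b"
proof -
  have scale: "bit_comb (scale_comb a F) b = a * bit_comb F b" for a F
    by (induction F) (auto simp: scale_comb_def algebra_simps)
  have "bit_comb (F @ G) b = bit_comb F b + bit_comb G b" for F G
    by (simp add: bit_comb_def)
  then show ?thesis by (simp add: scale)
qed

lemma bcont_bit_comb: "bcont (bit_comb F)"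
proof -
  have "bit_comb F = (\<lambda>b. \<Sum>x\<leftarrow>F. fst x * of_bool (b (snd x)))"
    by (simp add: bit_comb_def fun_eq_iff case_prod_unfold)
  then show ?thesis by (simp only:) (intro bcont_sum_list bcont_mult bcont_const bcont_coord)
qed

section \<open>Density of combinations of bits in L^1\<close>

context bit_space
begin

definition approximable :: "('a \<Rightarrow> real) \<Rightarrow> bool" where
  "approximable v \<longleftrightarrow> integrable N v \<and> (\<forall>e>0. \<exists>F. L1_dist N v (\<lambda>x. bit_comb F (\<beta> x)) < e)"

lemma bit_comb_integrable: "integrable N (\<lambda>x. bit_comb F (\<beta> x))"
  by (rule bcont_integrable[OF bcont_bit_comb])

lemma approximable_lincomb:
  assumes u: "approximable u" and v: "approximable v"
  shows "approximable (\<lambda>x. a * u x + b * v x)"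
  unfolding approximable_def
proof (intro conjI allI impI)
  have ui: "integrable N u" and vi: "integrable N v" using u v by (auto simp: approximable_def)
  show "integrable N (\<lambda>x. a * u x + b * v x)" using ui vi by auto
  fix e :: real assume e: "0 < e"
  define d where "d = e / (2 * (\<bar>a\<bar> + \<bar>b\<bar> + 1))"
  have d: "0 < d" using e by (auto simp: d_def)
  have "(\<bar>a\<bar> + \<bar>b\<bar> + 1) * (2 * d) = e"
  proof -
    define P where "P = \<bar>a\<bar> + \<bar>b\<bar> + 1"
    have "0 < P" unfolding P_def by (intro add_nonneg_pos) auto
    then show ?thesis unfolding d_def P_def[symmetric] by simp
  qed
  then have "2 * (\<bar>a\<bar> * d + \<bar>b\<bar> * d) + 2 * d = e" by (simp add: algebra_simps)
  moreover have "0 \<le> \<bar>a\<bar> * d + \<bar>b\<bar> * d" using d by simp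
  moreover have "q < e" if "2 * q + 2 * d = e" "0 \<le> q" for q using that d by linarith
  ultimately have d2: "\<bar>a\<bar> * d + \<bar>b\<bar> * d < e" by blast
  have "\<exists>F. L1_dist N u (\<lambda>x. bit_comb F (\<beta> x)) < d" "\<exists>F. L1_dist N v (\<lambda>x. bit_comb F (\<beta> x)) < d"
    using u v d by (auto simp: approximable_def)
  then obtain F G where F: "L1_dist N u (\<lambda>x. bit_comb F (\<beta> x)) < d" and G: "L1_dist N v (\<lambda>x. bit_comb G (\<beta> x)) < d"
    by blast
  have "L1_dist N (\<lambda>x. a * u x + b * v x) (\<lambda>x. bit_comb (scale_comb a F @ scale_comb b G) (\<beta> x))
      \<le> \<bar>a\<bar> * L1_dist N u (\<lambda>x. bit_comb F (\<beta> x)) + \<bar>b\<bar> * L1_dist N v (\<lambda>x. bit_comb G (\<beta> x))"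
    unfolding bit_comb_lincomb by (rule L1_dist_lincomb[OF ui bit_comb_integrable vi bit_comb_integrable])
  also have "\<dots> \<le> \<bar>a\<bar> * d + \<bar>b\<bar> * d" using F G by (intro add_mono mult_left_mono) auto
  finally show "\<exists>H. L1_dist N (\<lambda>x. a * u x + b * v x) (\<lambda>x. bit_comb H (\<beta> x)) < e"
    using d2 by (intro exI[of _ "scale_comb a F @ scale_comb b G"]) simp
qed

lemma approximable_limit:
  assumes v: "integrable N v" and lim: "(\<lambda>n. L1_dist N v (u n)) \<longlonglongrightarrow> 0" and u: "\<And>n. approximable (u n)"
  shows "approximable v"
  unfolding approximable_def
proof (intro conjI allI impI v)
  fix e :: real assume e: "0 < e"
  then have "\<forall>\<^sub>F n in sequentially. L1_dist N v (u n) < e / 2" by (intro order_tendstoD(2)[OF lim]) auto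
  then obtain n where n: "L1_dist N v (u n) < e / 2" by (auto simp: eventually_sequentially)
  have "\<exists>F. L1_dist N (u n) (\<lambda>x. bit_comb F (\<beta> x)) < e / 2"
    using u[of n] half_gt_zero[OF e] unfolding approximable_def by blast
  then obtain F where F: "L1_dist N (u n) (\<lambda>x. bit_comb F (\<beta> x)) < e / 2" by blast
  have "L1_dist N v (\<lambda>x. bit_comb F (\<beta> x)) \<le> L1_dist N v (u n) + L1_dist N (u n) (\<lambda>x. bit_comb F (\<beta> x))"
    using u[of n] by (intro L1_dist_triangle v bit_comb_integrable) (auto simp: approximable_def)
  then show "\<exists>F. L1_dist N v (\<lambda>x. bit_comb F (\<beta> x)) < e" using n F by (intro exI[of _ F]) auto
qed

lemma approximable_cong: "approximable u \<Longrightarrow> (\<And>x. x \<in> space N \<Longrightarrow> u x = v x) \<Longrightarrow> approximable v"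
proof -
  assume u: "approximable u" and eq: "\<And>x. x \<in> space N \<Longrightarrow> u x = v x"
  have "L1_dist N v w = L1_dist N u w" for w
    unfolding L1_dist_def using eq by (intro Bochner_Integration.integral_cong) auto
  moreover have "integrable N v \<longleftrightarrow> integrable N u"
    using eq by (intro Bochner_Integration.integrable_cong) auto
  ultimately show ?thesis using u by (simp add: approximable_def)
qed

lemma approximable_zero: "approximable (\<lambda>x. 0)"
  unfolding approximable_def
proof (intro conjI allI impI)
  show "\<exists>F. L1_dist N (\<lambda>x. 0) (\<lambda>x. bit_comb F (\<beta> x)) < e" if "0 < e" for e
    using that by (intro exI[of _ "[]"]) (simp add: L1_dist_def)
qed simp

lemma approximable_bit: "approximable (indicator {x \<in> space N. \<beta> x w})"
proof (rule approximable_cong)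
  show "approximable (\<lambda>x. bit_comb [(1, w)] (\<beta> x))"
    unfolding approximable_def
  proof (intro conjI allI impI bit_comb_integrable)
    show "\<exists>F. L1_dist N (\<lambda>x. bit_comb [(1, w)] (\<beta> x)) (\<lambda>x. bit_comb F (\<beta> x)) < e" if "0 < e" for e
      using that by (intro exI[of _ "[(1, w)]"]) (simp add: L1_dist_def)
  qed
qed (auto simp: indicator_def)

text \<open>The events with approximable indicators form a Dynkin system containing the
  intersection-stable generator, so they exhaust the sigma-algebra; simple functions and L^1 limits
  follow. A name for the whole space supplies the constant 1 for complements.\<close>

proposition bit_comb_dense:
  assumes gen: "sets N = sigma_sets (space N) (range (\<lambda>w. {x \<in> space N. \<beta> x w}))"
    and Int: "\<And>u v. \<exists>w. \<forall>x\<in>space N. \<beta> x w \<longleftrightarrow> \<beta> x u \<and> \<beta> x v"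
    and top: "\<exists>w. \<forall>x\<in>space N. \<beta> x w"
    and v: "integrable N v" and e: "0 < e"
  shows "\<exists>F. L1_dist N v (\<lambda>x. bit_comb F (\<beta> x)) < e"
proof -
  let ?G = "range (\<lambda>w. {x \<in> space N. \<beta> x w})"
  have "Int_stable ?G"
  proof (rule Int_stableI_image)
    fix u v
    obtain w where "\<forall>x\<in>space N. \<beta> x w \<longleftrightarrow> \<beta> x u \<and> \<beta> x v" using Int by blast
    then show "\<exists>w\<in>UNIV. {x \<in> space N. \<beta> x u} \<inter> {x \<in> space N. \<beta> x v} = {x \<in> space N. \<beta> x w}" by blast
  qed
  moreover have "?G \<subseteq> Pow (space N)" by auto
  moreover obtain t where t: "\<forall>x\<in>space N. \<beta> x t" using top by blast
  have one: "approximable (\<lambda>x. 1)"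
    by (rule approximable_cong[OF approximable_bit[of t]]) (use t in auto)
  have ind: "approximable (indicator S :: 'a \<Rightarrow> real)" if "S \<in> sets N" for S
    using \<open>Int_stable ?G\<close> \<open>?G \<subseteq> Pow (space N)\<close> that[unfolded gen]
  proof (induct rule: sigma_sets_induct_disjoint)
    case (basic A)
    then show ?case using approximable_bit by auto
  next
    case empty
    then show ?case using approximable_zero by simp
  next
    case (compl A)
    show ?case
      by (rule approximable_cong[OF approximable_lincomb[OF one compl(2), of 1 "-1"]])
        (auto simp: indicator_def)
  next
    case (union A)
    have A [measurable]: "A i \<in> sets N" for i using union(2) gen by auto
    have partial: "approximable (\<lambda>x. \<Sum>i<n. indicator (A i) x)" for n
    proof (induction n)
      case (Suc n)
      show ?case
        using approximable_lincomb[OF Suc.IH union(3)[of n], of 1 1] by simp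
    qed (simp add: approximable_zero)
    have sumeq: "(\<Sum>i<n. indicator (A i) x) = (indicator (\<Union>i<n. A i) x :: real)" for n x
      using disjoint_family_on_mono[OF _ union(1), of "{..<n}"] by (intro indicator_UN_disjoint[symmetric]) auto
    show ?case
    proof (rule approximable_limit[OF _ _ partial])
      show "integrable N (indicator (\<Union>i. A i) :: 'a \<Rightarrow> real)"
        by (intro integrable_real_indicator) (auto simp: emeasure_eq_measure)
      \<comment> \<open>The distance to a partial union is the measure of the remainder, which tends
        to zero by countable additivity.\<close>
      have "L1_dist N (indicator (\<Union>i. A i)) (\<lambda>x. \<Sum>i<n. indicator (A i) x)
          = measure N (\<Union>i. A i) - (\<Sum>i<n. measure N (A i))" for n
      proof -
        have "L1_dist N (indicator (\<Union>i. A i)) (\<lambda>x. \<Sum>i<n. indicator (A i) x)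
            = (\<integral>x. indicator (\<Union>i. A i) x - (\<Sum>i<n. indicator (A i) x) \<partial>N)"
          unfolding L1_dist_def sumeq
          by (intro Bochner_Integration.integral_cong) (auto simp: indicator_def)
        also have "\<dots> = measure N ((\<Union>i. A i) \<inter> space N) - (\<Sum>i<n. measure N (A i \<inter> space N))"
          by (subst Bochner_Integration.integral_diff) (auto simp: emeasure_eq_measure)
        finally show ?thesis using sets.sets_into_space[OF A] by (simp add: Int_absorb2 UN_least)
      qed
      moreover have "(\<lambda>n. \<Sum>i<n. measure N (A i)) \<longlonglongrightarrow> measure N (\<Union>i. A i)"
      proof -
        have "range A \<subseteq> sets N" using A by auto
        from finite_measure_UNION[OF this union(1)] show ?thesis by (simp add: sums_def)
      qed
      then have "(\<lambda>n. measure N (\<Union>i. A i) - (\<Sum>i<n. measure N (A i))) \<longlonglongrightarrow> measure N (\<Union>i. A i) - measure N (\<Union>i. A i)"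
        by (intro tendsto_intros)
      ultimately show "(\<lambda>n. L1_dist N (indicator (\<Union>i. A i)) (\<lambda>x. \<Sum>i<n. indicator (A i) x)) \<longlonglongrightarrow> 0"
        by simp
    qed
  qed
  from v have "approximable v"
  proof (induct rule: integrable_induct)
    case (base A c)
    then show ?case using approximable_lincomb[OF ind[OF base(1)] approximable_zero, of c 0] by (simp add: mult.commute)
  next
    case (add f g)
    then show ?case using approximable_lincomb[OF add(2,4), of 1 1] by simp
  next
    case (lim f s)
    have [measurable]: "f \<in> borel_measurable N" "\<And>i. s i \<in> borel_measurable N" using lim by auto
    have "(\<lambda>i. \<integral>x. \<bar>f x - s i x\<bar> \<partial>N) \<longlonglongrightarrow> (\<integral>x. 0 \<partial>N)"
    \<comment> \<open>\<open>integrable_induct\<close> supplies simple functions bounded by twice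
      \<open>\<bar>f\<bar>\<close>, whence the factor 3.\<close>
    proof (rule integral_dominated_convergence[where w = "\<lambda>x. 3 * \<bar>f x\<bar>"])
      show "AE x in N. (\<lambda>i. \<bar>f x - s i x\<bar>) \<longlonglongrightarrow> 0"
      proof (intro AE_I2)
        fix x assume "x \<in> space N"
        then have "(\<lambda>i. \<bar>f x - s i x\<bar>) \<longlonglongrightarrow> \<bar>f x - f x\<bar>" using lim by (intro tendsto_intros) auto
        then show "(\<lambda>i. \<bar>f x - s i x\<bar>) \<longlonglongrightarrow> 0" by simp
      qed
      show "AE x in N. norm \<bar>f x - s i x\<bar> \<le> 3 * \<bar>f x\<bar>" for i
      proof (intro AE_I2)
        fix x assume "x \<in> space N"
        then have "\<bar>s i x\<bar> \<le> 2 * \<bar>f x\<bar>" using lim(4)[of x i] by simp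
        then show "norm \<bar>f x - s i x\<bar> \<le> 3 * \<bar>f x\<bar>" by simp
      qed
    qed (use lim in auto)
    then show ?case using lim by (intro approximable_limit[of f s]) (auto simp: L1_dist_def)
  qed
  then show ?thesis using e by (simp add: approximable_def)
qed

end

subsection \<open>Events generated by an operator\<close>

text \<open>Names for the events: \<open>Gen g m\<close> is the \<open>m\<close>-th digit of the generating function \<open>g\<close>, and
  \<open>Dig m w\<close> the \<open>m\<close>-th digit of the image of the indicator of \<open>w\<close>.\<close>

datatype 'g bword = Gen 'g nat | Top | Meet "'g bword" "'g bword" | Dig nat "'g bword"

instance bword :: (countable) countable
  by countable_datatype

text \<open>The factor 2 undoes the halving in the \<open>Dig\<close> clause of
  \<open>word_set\<close>.\<close>

definition word_op :: "'g bword \<Rightarrow> ('g bword \<Rightarrow> bool) \<Rightarrow> real" where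
  "word_op w b = 2 * bin (\<lambda>m. b (Dig m w))"

definition comb_op :: "(real \<times> 'g bword) list \<Rightarrow> ('g bword \<Rightarrow> bool) \<Rightarrow> real" where
  "comb_op F b = (\<Sum>(c, w)\<leftarrow>F. c * word_op w b)"

text \<open>\<open>4 * y - 1\<close> inverts \<open>(u + 1) / 4\<close>; truncation makes the value
  admissible in a profile for every assignment of bits, including those that occur in the limit
  only.\<close>

definition gen_val :: "'g \<Rightarrow> ('g bword \<Rightarrow> bool) \<Rightarrow> real" where
  "gen_val g b = clip (4 * bin (\<lambda>m. b (Gen g m)) - 1)"

lemma comb_op_Nil [simp]: "comb_op [] b = 0"
  and comb_op_Cons [simp]: "comb_op ((c, w) # F) b = c * word_op w b + comb_op F b"
  by (simp_all add: comb_op_def)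

lemma comb_op_lincomb:
  "comb_op (scale_comb a F @ scale_comb a' G) b = a * comb_op F b + a' * comb_op G b"
proof -
  have scale: "comb_op (scale_comb a F) b = a * comb_op F b" for a F
    by (induction F) (auto simp: scale_comb_def algebra_simps)
  have "comb_op (F @ G) b = comb_op F b + comb_op G b" for F G
    by (simp add: comb_op_def)
  then show ?thesis by (simp add: scale)
qed

lemma bcont_word_op: "bcont (word_op w)" for w :: "'g::countable bword"
  unfolding word_op_def[abs_def] by (intro bcont_mult bcont_const bcont_bin)

lemma bcont_comb_op: "bcont (comb_op F)" for F :: "(real \<times> 'g::countable bword) list"
proof -
  have "comb_op F = (\<lambda>b. \<Sum>x\<leftarrow>F. fst x * word_op (snd x) b)"
    by (simp add: comb_op_def fun_eq_iff case_prod_unfold)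
  then show ?thesis by (simp only:) (intro bcont_sum_list bcont_mult bcont_const bcont_word_op)
qed

lemma bcont_gen_val: "bcont (gen_val g)" for g :: "'g::countable"
  unfolding gen_val_def[abs_def] by (intro bcont_clip bcont_diff bcont_mult bcont_const bcont_bin)

lemma gen_bin_approx:
  assumes e: "0 < e"
  shows "\<exists>F. \<forall>b :: 'g bword \<Rightarrow> bool. b Top \<longrightarrow> \<bar>4 * bin (\<lambda>m. b (Gen g m)) - 1 - bit_comb F b\<bar> \<le> e"
proof -
  obtain n where n: "(1 / 2 :: real) ^ n < e / 4" using real_arch_pow_inv[of "e / 4" "1 / 2"] e by auto
  \<comment> \<open>The constant \<open>-1\<close> is carried by \<open>Top\<close>, and the
    reversed list puts the last digit first, which suits induction on \<open>n\<close>.\<close>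
  define F :: "nat \<Rightarrow> (real \<times> 'g bword) list" where "F n = (- 1, Top) # map (\<lambda>m. (4 * (1 / 2) ^ Suc m, Gen g m)) (rev [0..<n])" for n
  have F: "bit_comb (F n) b = 4 * (\<Sum>m<n. (1 / 2) ^ Suc m * of_bool (b (Gen g m))) - 1" if "b Top" for n b
    using that by (induction n) (auto simp: F_def algebra_simps)
  show ?thesis
  proof (intro exI[of _ "F n"] allI impI)
    fix b :: "'g bword \<Rightarrow> bool" assume "b Top"
    then show "\<bar>4 * bin (\<lambda>m. b (Gen g m)) - 1 - bit_comb (F n) b\<bar> \<le> e"
      using bin_partial[of "\<lambda>m. b (Gen g m)" n] n using F[where b = b and n = n] \<open>b Top\<close> by (simp add: abs_le_iff)
  qed
qed

section \<open>Profiles and operators on discrete spaces\<close>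

definition prof_vec :: "(('a \<Rightarrow> real) \<Rightarrow> 'a \<Rightarrow> real) \<Rightarrow> nat \<Rightarrow> (nat \<Rightarrow> 'a \<Rightarrow> real) \<Rightarrow> nat \<Rightarrow> 'a \<Rightarrow> real" where
  "prof_vec A k v j x = (if j < k then v j x else A (v (j - k)) x)"

lemma profile_alt:
  "profile M A k = {law M (2 * k) (prof_vec A k v) | v.
     \<forall>j<k. v j \<in> borel_measurable M \<and> (\<forall>x\<in>space M. v j x \<in> {-1..1})}"
  by (simp add: profile_def law_def prof_vec_def)

lemma prof_vec_simps: "j < k \<Longrightarrow> prof_vec A k v j = v j" "\<not> j < k \<Longrightarrow> prof_vec A k v j = A (v (j - k))"
  by (auto simp: prof_vec_def)

lemma law_cong: "(\<And>j. j < m \<Longrightarrow> X j = Y j) \<Longrightarrow> law M m X = law M m Y"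
  unfolding law_def by (intro arg_cong[where f = "distr M (Rm m)"] ext) (auto simp: restrict_def)

text \<open>All sets are measurable, so the laws can be required at every point. Only
  \<open>unital\<close> holds almost everywhere, as the walk operator vanishes off the support of
  the measure; \<open>bounded\<close> is an assumption of its own because positivity and
  \<open>unital\<close> give no bound at null points.\<close>

locale discrete_markov_sequence =
  fixes M :: "nat \<Rightarrow> 'a measure" and A :: "nat \<Rightarrow> ('a \<Rightarrow> real) \<Rightarrow> 'a \<Rightarrow> real"
  assumes prob_space_M: "prob_space (M i)" and sets_M: "sets (M i) = UNIV"
    and linear: "A i (\<lambda>x. a * v x + b * w x) y = a * A i v y + b * A i w y"
    and bounded: "(\<And>x. \<bar>v x\<bar> \<le> c) \<Longrightarrow> \<bar>A i v y\<bar> \<le> c"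
    and positive: "(\<And>x. 0 \<le> v x) \<Longrightarrow> 0 \<le> A i v y"
    and symmetric: "(\<And>x. \<bar>v x\<bar> \<le> c) \<Longrightarrow> (\<And>x. \<bar>w x\<bar> \<le> d) \<Longrightarrow>
      (\<integral>x. A i v x * w x \<partial>M i) = (\<integral>x. A i w x * v x \<partial>M i)"
    and unital: "AE x in M i. A i (\<lambda>_. 1) x = 1"
begin

lemma space_M: "space (M i) = UNIV"
  using sets.sets_into_space[of UNIV "M i"] sets_M[of i] by auto

lemma measurable_M: "f \<in> borel_measurable (M i)"
  by (rule measurableI) (auto simp: sets_M)

lemma integrable_M:
  assumes "\<And>x. \<bar>f x\<bar> \<le> (c :: real)" shows "integrable (M i) f"
proof -
  interpret prob_space "M i" by (rule prob_space_M)
  show ?thesis using assms measurable_M by (intro integrable_const_bound[where B = c]) auto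
qed

text \<open>Positivity applied to \<open>\<bar>v\<bar> + v\<close> and
  \<open>\<bar>v\<bar> - v\<close> bounds \<open>\<bar>A v\<bar>\<close> by the image of
  \<open>\<bar>v\<bar>\<close>, and symmetry against the constant 1 shows that this image has the
  same integral as \<open>\<bar>v\<bar>\<close>.\<close>

lemma L1_contraction:
  assumes v: "\<And>x. \<bar>v x\<bar> \<le> c"
  shows "(\<integral>x. \<bar>A i v x\<bar> \<partial>M i) \<le> (\<integral>x. \<bar>v x\<bar> \<partial>M i)"
proof -
  have pw: "\<bar>A i v x\<bar> \<le> A i (\<lambda>y. \<bar>v y\<bar>) x" for x
  proof -
    have "0 \<le> A i (\<lambda>y. 1 * \<bar>v y\<bar> + s * v y) x" if "s \<in> {1, -1}" for s
      using that by (intro positive) auto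
    then have "0 \<le> A i (\<lambda>y. \<bar>v y\<bar>) x + A i v x" "0 \<le> A i (\<lambda>y. \<bar>v y\<bar>) x - A i v x"
      unfolding linear by force+
    then show ?thesis by linarith
  qed
  have "(\<integral>x. \<bar>A i v x\<bar> \<partial>M i) \<le> (\<integral>x. A i (\<lambda>y. \<bar>v y\<bar>) x \<partial>M i)"
    using v by (intro integral_mono pw integrable_M[of _ c]) (auto intro: bounded)
  also have "\<dots> = (\<integral>x. A i (\<lambda>y. \<bar>v y\<bar>) x * 1 \<partial>M i)" by simp
  also have "\<dots> = (\<integral>x. A i (\<lambda>_. 1) x * \<bar>v x\<bar> \<partial>M i)"
    by (rule symmetric[of _ c _ 1]) (use v in auto)
  also have "\<dots> = (\<integral>x. \<bar>v x\<bar> \<partial>M i)"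
    using unital[of i] by (intro integral_cong_AE measurable_M) (auto elim!: eventually_mono)
  finally show ?thesis .
qed

lemma A_diff: "A i v x - A i w x = A i (\<lambda>y. v y - w y) x"
  using linear[of i 1 v "-1" w x] by simp

lemma L1_dist_A_le:
  assumes v: "\<And>x. \<bar>v x\<bar> \<le> c" and w: "\<And>x. \<bar>w x\<bar> \<le> d"
  shows "L1_dist (M i) (A i v) (A i w) \<le> L1_dist (M i) v w"
proof -
  have "\<bar>v x - w x\<bar> \<le> c + d" for x using v[of x] w[of x] by linarith
  from L1_contraction[of "\<lambda>x. v x - w x", OF this] show ?thesis by (simp add: L1_dist_def A_diff)
qed

end

locale generated_bits = discrete_markov_sequence M A
  for M :: "nat \<Rightarrow> 'a measure" and A +
  fixes u :: "nat \<Rightarrow> 'g::countable \<Rightarrow> 'a \<Rightarrow> real"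
  assumes u_bound: "\<bar>u i g x\<bar> \<le> 1"
begin

primrec word_set :: "nat \<Rightarrow> 'g bword \<Rightarrow> 'a set" where
  "word_set i (Gen g m) = {x. digit m ((u i g x + 1) / 4)}"
| "word_set i Top = UNIV"
| "word_set i (Meet v w) = word_set i v \<inter> word_set i w"
| "word_set i (Dig m w) = {x. digit m (A i (indicator (word_set i w)) x / 2)}"

definition bits :: "nat \<Rightarrow> 'a \<Rightarrow> 'g bword \<Rightarrow> bool" where
  "bits i x w \<longleftrightarrow> x \<in> word_set i w"

lemma bits_simps [simp]: "bits i x Top" "bits i x (Meet v w) \<longleftrightarrow> bits i x v \<and> bits i x w"
  by (auto simp: bits_def)

lemma bit_space_bits: "bit_space (M i) (bits i)"
  by (intro bit_space.intro bit_space_axioms.intro prob_space_M) (simp add: sets_M)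

lemma word_op_bits: "word_op w (bits i x) = A i (indicator (word_set i w)) x"
proof -
  let ?y = "A i (indicator (word_set i w)) x"
  have "0 \<le> ?y" by (rule positive) auto
  moreover have "\<bar>?y\<bar> \<le> 1" by (rule bounded) (auto simp: indicator_def)
  ultimately have "bin (\<lambda>m. digit m (?y / 2)) = ?y / 2" by (intro bin_digit) auto
  then show ?thesis by (simp add: word_op_def bits_def)
qed

text \<open>At every stage the operator acts on combinations of events by the same continuous
  function of the bits. Through this identity properties of \<open>A i\<close> become relations
  between integrals that survive the limit.\<close>

lemma comb_op_bits: "comb_op F (bits i x) = A i (\<lambda>y. bit_comb F (bits i y)) x"
proof (induction F)
  case Nil
  show ?case using bounded[of "\<lambda>_. 0" 0 i x] by simp
next
  case (Cons cw F)
  obtain c w where cw: "cw = (c, w)" by force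
  have "(\<lambda>y. bit_comb (cw # F) (bits i y)) = (\<lambda>y. c * indicator (word_set i w) y + 1 * bit_comb F (bits i y))"
    by (auto simp: cw bits_def indicator_def)
  then have "A i (\<lambda>y. bit_comb (cw # F) (bits i y)) x
      = c * A i (indicator (word_set i w)) x + 1 * A i (\<lambda>y. bit_comb F (bits i y)) x"
    by (simp only: linear)
  then show ?case using Cons by (simp add: cw word_op_bits)
qed

lemma bin_gen_bits: "4 * bin (\<lambda>m. bits i x (Gen g m)) - 1 = u i g x"
proof -
  have "bin (\<lambda>m. digit m ((u i g x + 1) / 4)) = (u i g x + 1) / 4"
    using u_bound[of i g x] by (intro bin_digit) auto
  then show ?thesis by (simp add: bits_def)
qed

lemma gen_val_bits: "gen_val g (bits i x) = u i g x"
  unfolding gen_val_def bin_gen_bits by (rule clip_eq[OF u_bound])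

text \<open>One list \<open>F\<close> serves all stages, and by convergence of L^1 distances also
  the limit.\<close>

lemma gen_val_approx:
  assumes "0 < e"
  shows "\<exists>F. \<forall>i x. \<bar>gen_val g (bits i x) - bit_comb F (bits i x)\<bar> \<le> e"
proof -
  obtain F where "\<And>b. b Top \<Longrightarrow> \<bar>4 * bin (\<lambda>m. b (Gen g m)) - 1 - bit_comb F b\<bar> \<le> e"
    using gen_bin_approx[OF assms, of g] by blast
  then have "\<bar>gen_val g (bits i x) - bit_comb F (bits i x)\<bar> \<le> e" for i x
    using bin_gen_bits[of i x g] gen_val_bits[of g i x] by (metis bits_simps(1))
  then show ?thesis by blast
qed

text \<open>Prefix probabilities form a countable family with values in [0,1], so a diagonal
  subsequence converges for all prefixes. The limits stay additive, and a positive limit forces the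
  prefix to occur at some stage; the interval construction then applies.\<close>

lemma bits_limit_exists:
  "\<exists>r (\<Omega> :: real measure) \<beta>. strict_mono r \<and> bits_converge \<Omega> \<beta> (\<lambda>i. M (r i)) (\<lambda>i. bits (r i)) \<and>
     sets \<Omega> = sigma_sets (space \<Omega>) (range (\<lambda>w. {x \<in> space \<Omega>. \<beta> x w})) \<and>
     (\<forall>y\<in>space \<Omega>. \<forall>n. \<exists>i x. pref (\<beta> y) n = pref (bits i x) n)"
proof -
  let ?p = "\<lambda>i s. pref_prob (M i) (bits i) s"
  interpret stage: bit_space "M i" "bits i" for i by (rule bit_space_bits)
  have bound: "norm (?p i s) \<le> 1" for i s by (simp add: pref_prob_def)
  obtain r where r: "strict_mono r" and "\<And>s. \<exists>l. (\<lambda>i. ?p (r i) s) \<longlonglongrightarrow> l"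
    using function_convergent_subsequence[of UNIV ?p 1] bound by auto
  then obtain p where p: "\<And>s. (\<lambda>i. ?p (r i) s) \<longlonglongrightarrow> p s" by metis
  have real: "\<exists>i x. pref (bits i x) (length s) = s" if "0 < p s" for s
  proof -
    have "\<forall>\<^sub>F i in sequentially. 0 < ?p (r i) s" using order_tendstoD(1)[OF p that] .
    then obtain i where "0 < ?p (r i) s" by (auto simp: eventually_sequentially)
    then have "{x \<in> space (M (r i)). pref (bits (r i) x) (length s) = s} \<noteq> {}"
      unfolding pref_prob_def by (metis measure_empty less_irrefl)
    then show ?thesis by blast
  qed
  have "p [] = 1"
  proof -
    have "?p i [] = 1" for i by (simp add: pref_prob_def stage.prob_space)
    then show ?thesis using p[of "[]"] by (simp add: LIMSEQ_const_iff)
  qed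
  moreover have "0 \<le> p s" for s
    using p[of s] by (rule LIMSEQ_le_const) (auto simp: pref_prob_def)
  moreover have "p (True # s) + p (False # s) = p s" for s
  proof -
    have "?p i (True # s) + ?p i (False # s) = ?p i s" for i
    proof -
      let ?S = "\<lambda>c. {x \<in> space (M i). pref (bits i x) (length (c # s)) = c # s}"
      have "{x \<in> space (M i). pref (bits i x) (length s) = s} = ?S True \<union> ?S False" by auto
      moreover have "measure (M i) (?S True \<union> ?S False) = measure (M i) (?S True) + measure (M i) (?S False)"
        by (intro stage.finite_measure_Union stage.pref_eq_sets) auto
      ultimately show ?thesis by (simp only: pref_prob_def)
    qed
    then have "(\<lambda>i. ?p (r i) s) \<longlonglongrightarrow> p (True # s) + p (False # s)"
      using tendsto_add[OF p[of "True # s"] p[of "False # s"]] by simp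
    then show ?thesis using p[of s] LIMSEQ_unique by blast
  qed
  moreover have "\<exists>b :: 'g bword \<Rightarrow> bool. pref b (length s) = s" if "0 < p s" for s using real[OF that] by blast
  ultimately obtain \<Omega> :: "real measure" and \<beta> :: "real \<Rightarrow> 'g bword \<Rightarrow> bool" where
    \<Omega>: "bit_space \<Omega> \<beta>" "\<And>s. pref_prob \<Omega> \<beta> s = p s"
    "sets \<Omega> = sigma_sets (space \<Omega>) (range (\<lambda>w. {x \<in> space \<Omega>. \<beta> x w}))"
    "\<And>x n. x \<in> space \<Omega> \<Longrightarrow> 0 < p (pref (\<beta> x) n)"
    using bit_measure_exists[of p, where ?'w = "'g bword"] by blast
  have "bits_converge \<Omega> \<beta> (\<lambda>i. M (r i)) (\<lambda>i. bits (r i))"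
    using p by (intro bits_converge.intro bits_converge_axioms.intro \<Omega>(1) bit_space_bits) (simp add: \<Omega>(2))
  moreover have "\<exists>i x. pref (\<beta> y) n = pref (bits i x) n" if "y \<in> space \<Omega>" for y n
    using real[OF \<Omega>(4)[OF that, of n]] by (metis length_pref)
  ultimately show ?thesis using r \<Omega>(3) by blast
qed

end

text \<open>\<open>adherent\<close> makes every pointwise relation between finitely many bits at the stages hold in the limit.\<close>

locale generated_bits_limit = generated_bits M A u +
  bits_converge \<Omega> \<beta> "\<lambda>i. M (r i)" "\<lambda>i. generated_bits.bits A u (r i)"
  for M :: "nat \<Rightarrow> 'a measure" and A and u :: "nat \<Rightarrow> 'g::countable \<Rightarrow> 'a \<Rightarrow> real"
    and \<Omega> :: "'b measure" and \<beta> r +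
  assumes generated: "sets \<Omega> = sigma_sets (space \<Omega>) (range (\<lambda>w. {x \<in> space \<Omega>. \<beta> x w}))"
    and adherent: "y \<in> space \<Omega> \<Longrightarrow> \<exists>i x. pref (\<beta> y) n = pref (bits i x) n"
begin

lemma \<beta>_Top: "y \<in> space \<Omega> \<Longrightarrow> \<beta> y Top"
  using adherent[of y "Suc (to_nat (Top :: 'g bword))"] by (metis pref_eq_coord bits_simps(1))

lemma \<beta>_Meet: "y \<in> space \<Omega> \<Longrightarrow> \<beta> y (Meet v w) \<longleftrightarrow> \<beta> y v \<and> \<beta> y w"
proof -
  assume y: "y \<in> space \<Omega>"
  \<comment> \<open>One prefix long enough to contain all three names.\<close>
  define n where "n = Max (to_nat ` {v, w, Meet v w})"
  obtain i x where eq: "pref (\<beta> y) (Suc n) = pref (bits i x) (Suc n)" using adherent[OF y] by blast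
  have "\<beta> y w' = bits i x w'" if "w' \<in> {v, w, Meet v w}" for w'
  proof -
    have "to_nat w' \<le> n" unfolding n_def using that by (intro Max_ge) auto
    then show ?thesis using pref_eq_mono[OF eq, of "Suc (to_nat w')"] pref_eq_coord by blast
  qed
  then show ?thesis by simp
qed

section \<open>The limit operator\<close>

lemma stage_bcont_bounded:
  assumes "bcont \<phi>" shows "\<exists>c. \<forall>x. \<bar>\<phi> (bits i x)\<bar> \<le> c"
  using bcont_bounded[OF assms] by blast

lemma comb_op_sym:
  "(\<integral>x. comb_op F (\<beta> x) * bit_comb G (\<beta> x) \<partial>\<Omega>) = (\<integral>x. comb_op G (\<beta> x) * bit_comb F (\<beta> x) \<partial>\<Omega>)"
proof -
  have eq: "(\<integral>x. comb_op F (bits i x) * bit_comb G (bits i x) \<partial>M i)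
      = (\<integral>x. comb_op G (bits i x) * bit_comb F (bits i x) \<partial>M i)" for i
  proof -
    obtain c d where "\<And>x. \<bar>bit_comb F (bits i x)\<bar> \<le> c" "\<And>x. \<bar>bit_comb G (bits i x)\<bar> \<le> d"
      using stage_bcont_bounded[OF bcont_bit_comb] by metis
    then show ?thesis unfolding comb_op_bits by (rule symmetric)
  qed
  have "(\<lambda>i. \<integral>x. comb_op F (bits (r i) x) * bit_comb G (bits (r i) x) \<partial>M (r i))
      \<longlonglongrightarrow> (\<integral>x. comb_op F (\<beta> x) * bit_comb G (\<beta> x) \<partial>\<Omega>)" for F G
    by (rule integral_tendsto[OF bcont_mult[OF bcont_comb_op bcont_bit_comb]])
  from this[of F G] this[of G F] show ?thesis unfolding eq by (rule LIMSEQ_unique)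
qed

lemma comb_op_contraction: "(\<integral>x. \<bar>comb_op F (\<beta> x)\<bar> \<partial>\<Omega>) \<le> (\<integral>x. \<bar>bit_comb F (\<beta> x)\<bar> \<partial>\<Omega>)"
proof (rule LIMSEQ_le)
  show "(\<lambda>i. \<integral>x. \<bar>comb_op F (bits (r i) x)\<bar> \<partial>M (r i)) \<longlonglongrightarrow> (\<integral>x. \<bar>comb_op F (\<beta> x)\<bar> \<partial>\<Omega>)"
    by (rule integral_tendsto[OF bcont_abs[OF bcont_comb_op]])
  show "(\<lambda>i. \<integral>x. \<bar>bit_comb F (bits (r i) x)\<bar> \<partial>M (r i)) \<longlonglongrightarrow> (\<integral>x. \<bar>bit_comb F (\<beta> x)\<bar> \<partial>\<Omega>)"
    by (rule integral_tendsto[OF bcont_abs[OF bcont_bit_comb]])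
  have "(\<integral>x. \<bar>comb_op F (bits i x)\<bar> \<partial>M i) \<le> (\<integral>x. \<bar>bit_comb F (bits i x)\<bar> \<partial>M i)" for i
  proof -
    obtain c where "\<And>x. \<bar>bit_comb F (bits i x)\<bar> \<le> c" using stage_bcont_bounded[OF bcont_bit_comb] by metis
    then show ?thesis unfolding comb_op_bits by (rule L1_contraction)
  qed
  then show "\<exists>n0. \<forall>n\<ge>n0. (\<integral>x. \<bar>comb_op F (bits (r n) x)\<bar> \<partial>M (r n)) \<le> (\<integral>x. \<bar>bit_comb F (bits (r n) x)\<bar> \<partial>M (r n))"
    by blast
qed

lemma bcont_Linf:
  assumes "bcont \<phi>" shows "(\<lambda>x. \<phi> (\<beta> x)) \<in> Linf \<Omega>"
  unfolding Linf_def using bcont_measurable[OF assms] bcont_bounded[OF assms] by auto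

text \<open>At the stages this is an almost-everywhere identity, which \<open>adherent\<close>
  cannot carry over; it is recast as a vanishing L^1 distance, and the limit of these distances
  vanishes too.\<close>

lemma comb_op_unit: "AE x in \<Omega>. comb_op [(1, Top)] (\<beta> x) = 1"
proof -
  have "L1_dist (M i) (\<lambda>x. comb_op [(1, Top)] (bits i x)) (\<lambda>x. 1) = 0" for i
  proof -
    have "(\<lambda>y. bit_comb [(1, Top)] (bits i y)) = (\<lambda>y. 1)" by auto
    then have eq: "(\<lambda>x. comb_op [(1, Top)] (bits i x)) = A i (\<lambda>_. 1)" by (simp only: comb_op_bits)
    have "integrable (M i) (A i (\<lambda>_. 1))" by (rule integrable_M[of _ 1]) (rule bounded, simp)
    then show ?thesis unfolding eq using unital[of i] by (subst L1_dist_eq_0_iff) (auto intro: integrable_M[of _ 1])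
  qed
  then have "L1_dist \<Omega> (\<lambda>x. comb_op [(1, Top)] (\<beta> x)) (\<lambda>x. 1) = 0"
    using L1_dist_tendsto[OF bcont_comb_op bcont_const[of 1], of "[(1, Top)]"] by (simp add: LIMSEQ_const_iff)
  then show ?thesis
    by (rule iffD1[OF L1_dist_eq_0_iff[OF bcont_integrable[OF bcont_comb_op] bcont_integrable[OF bcont_const[of 1]]]])
qed

proposition limit_operator_exists:
  "\<exists>B. markov_graphop \<Omega> B \<and> (\<forall>v F. integrable \<Omega> v \<longrightarrow>
     integrable \<Omega> (B v) \<and> L1_dist \<Omega> (B v) (\<lambda>x. comb_op F (\<beta> x)) \<le> L1_dist \<Omega> v (\<lambda>x. bit_comb F (\<beta> x)))"
proof -
  interpret L1_dense_markov \<Omega> "\<lambda>F x. bit_comb F (\<beta> x)" "\<lambda>F x. comb_op F (\<beta> x)"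
  proof (unfold_locales)
    show "(\<lambda>x. bit_comb F (\<beta> x)) \<in> Linf \<Omega>" "(\<lambda>x. comb_op F (\<beta> x)) \<in> Linf \<Omega>" for F
      by (intro bcont_Linf bcont_bit_comb bcont_comb_op)+
    show "\<exists>h. \<forall>x. bit_comb h (\<beta> x) = a * bit_comb f (\<beta> x) + b * bit_comb g (\<beta> x) \<and>
        comb_op h (\<beta> x) = a * comb_op f (\<beta> x) + b * comb_op g (\<beta> x)" for a b f g
      using bit_comb_lincomb comb_op_lincomb by blast
    show "\<exists>f. (AE x in \<Omega>. bit_comb f (\<beta> x) = 1) \<and> (AE x in \<Omega>. comb_op f (\<beta> x) = 1)"
      using comb_op_unit \<beta>_Top by (intro exI[of _ "[(1, Top)]"]) auto
    show "\<exists>f. L1_dist \<Omega> v (\<lambda>x. bit_comb f (\<beta> x)) < e" if "integrable \<Omega> v" "0 < e" for v e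
      using \<beta>_Top \<beta>_Meet that by (intro bit_comb_dense generated) blast+
  qed (rule comb_op_contraction comb_op_sym)+
  show ?thesis by (rule markov_extension)
qed

end

subsection \<open>Convergence of profiles\<close>

lemma bounded_profile_in_cube_prob:
  assumes N: "prob_space N"
    and A: "\<And>v. v \<in> borel_measurable N \<Longrightarrow> (\<And>x. x \<in> space N \<Longrightarrow> \<bar>v x\<bar> \<le> 1) \<Longrightarrow>
      A v \<in> borel_measurable N \<and> (AE x in N. \<bar>A v x\<bar> \<le> 1)"
  shows "profile N A k \<subseteq> cube_prob (2 * k)"
proof
  fix \<mu> assume "\<mu> \<in> profile N A k"
  then obtain v where \<mu>: "\<mu> = law N (2 * k) (prof_vec A k v)"
    and v: "\<And>j. j < k \<Longrightarrow> v j \<in> borel_measurable N" "\<And>j x. j < k \<Longrightarrow> x \<in> space N \<Longrightarrow> \<bar>v j x\<bar> \<le> 1"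
    unfolding profile_alt by (auto simp: abs_le_iff)
  have "prof_vec A k v j \<in> borel_measurable N \<and> (AE x in N. \<bar>prof_vec A k v j x\<bar> \<le> 1)" if "j < 2 * k" for j
  proof (cases "j < k")
    case True
    then show ?thesis using v by (auto simp: prof_vec_simps)
  next
    case False
    then have "j - k < k" using that by simp
    then show ?thesis using A[of "v (j - k)"] v False by (simp add: prof_vec_simps)
  qed
  then show "\<mu> \<in> cube_prob (2 * k)" unfolding \<mu> by (intro law_in_cube_prob N) auto
qed

lemma profile_nonempty: "profile M A k \<noteq> {}"
proof -
  have "law M (2 * k) (prof_vec A k (\<lambda>_ _. 0)) \<in> profile M A k"
    unfolding profile_alt by (intro CollectI exI[of _ "\<lambda>_ _. 0"]) auto
  then show ?thesis by blast
qed

lemma markov_profile_in_cube_prob: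
  assumes B: "markov_graphop N B" shows "profile N B k \<subseteq> cube_prob (2 * k)"
proof (rule bounded_profile_in_cube_prob)
  show N: "prob_space N" using B by (simp add: markov_graphop_def p_operator_def)
  fix v :: "_ \<Rightarrow> real" assume v: "v \<in> borel_measurable N" "\<And>x. x \<in> space N \<Longrightarrow> \<bar>v x\<bar> \<le> 1"
  then have v1: "AE x in N. \<bar>v x\<bar> \<le> 1" by auto
  then have "v \<in> Linf N" using v(1) by (auto simp: Linf_def)
  then have "integrable N (B v)" using B by (simp add: markov_graphop_def p_operator_def)
  then show "B v \<in> borel_measurable N \<and> (AE x in N. \<bar>B v x\<bar> \<le> 1)"
    using markov_graphop_bound[OF B v(1) v1] by auto
qed

lemma (in discrete_markov_sequence) profile_in_cube_prob: "profile (M i) (A i) k \<subseteq> cube_prob (2 * k)"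
  by (rule bounded_profile_in_cube_prob[OF prob_space_M]) (auto simp: measurable_M space_M intro!: bounded)

lemma cube_prob_subset: "cube_prob m \<subseteq> vec_prob m"
  by (auto simp: cube_prob_def)

context generated_bits_limit
begin

text \<open>A stage tuple and a limit tuple are compared through the same combinations
  \<open>F j\<close>. Both operators are controlled in L^1, so approximating the inputs also covers
  the outputs. The three parts of \<open>3 * e\<close> lead from the stage tuple to the stage bits,
  from there to the limit bits, and on to the limit tuple. How late \<open>i\<close> must be depends
  on \<open>F\<close> but not on the tuples.\<close>

lemma profile_law_close:
  assumes B: "\<forall>v F. integrable \<Omega> v \<longrightarrow>
     integrable \<Omega> (B v) \<and> L1_dist \<Omega> (B v) (\<lambda>x. comb_op F (\<beta> x)) \<le> L1_dist \<Omega> v (\<lambda>x. bit_comb F (\<beta> x))"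
    and e: "0 < e" and d: "real (2 * k) * d \<le> e * e"
  shows "\<forall>\<^sub>F i in sequentially. \<forall>vi v.
     (\<forall>j<k. (\<forall>x. \<bar>vi j x\<bar> \<le> 1) \<and> L1_dist (M (r i)) (vi j) (\<lambda>x. bit_comb (F j) (bits (r i) x)) \<le> d) \<longrightarrow>
     (\<forall>j<k. integrable \<Omega> (v j) \<and> L1_dist \<Omega> (v j) (\<lambda>x. bit_comb (F j) (\<beta> x)) \<le> d) \<longrightarrow>
     lp_close (2 * k) (3 * e) (law (M (r i)) (2 * k) (prof_vec (A (r i)) k vi)) (law \<Omega> (2 * k) (prof_vec B k v))"
proof -
  define \<Phi> where "\<Phi> j = (if j < k then bit_comb (F j) else comb_op (F (j - k)))" for j
  have \<Phi>: "bcont (\<Phi> j)" for j by (simp add: \<Phi>_def bcont_bit_comb bcont_comb_op)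
  have sum_le: "(\<Sum>j<2 * k. f j) \<le> e * e" if "\<And>j. j < 2 * k \<Longrightarrow> f j \<le> d" for f
  proof -
    have "(\<Sum>j<2 * k. f j) \<le> (\<Sum>j<2 * k. d)" using that by (intro sum_mono) auto
    also have "\<dots> = real (2 * k) * d" by simp
    finally show ?thesis using d by linarith
  qed
  from law_close[of "2 * k" \<Phi>, OF \<Phi> e] show ?thesis
  proof (eventually_elim, intro allI impI)
    fix i vi v
    assume close: "lp_close (2 * k) e (law (M (r i)) (2 * k) (\<lambda>j x. \<Phi> j (bits (r i) x))) (law \<Omega> (2 * k) (\<lambda>j x. \<Phi> j (\<beta> x)))"
      and vi: "\<forall>j<k. (\<forall>x. \<bar>vi j x\<bar> \<le> 1) \<and> L1_dist (M (r i)) (vi j) (\<lambda>x. bit_comb (F j) (bits (r i) x)) \<le> d"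
      and v: "\<forall>j<k. integrable \<Omega> (v j) \<and> L1_dist \<Omega> (v j) (\<lambda>x. bit_comb (F j) (\<beta> x)) \<le> d"
    have stage_j: "integrable (M (r i)) (prof_vec (A (r i)) k vi j) \<and>
        L1_dist (M (r i)) (prof_vec (A (r i)) k vi j) (\<lambda>x. \<Phi> j (bits (r i) x)) \<le> d" if "j < 2 * k" for j
    proof (cases "j < k")
      case True
      then show ?thesis using vi by (auto simp: prof_vec_simps \<Phi>_def intro: integrable_M)
    next
      case False
      then have j: "j - k < k" using that by simp
      obtain c where c: "\<And>x. \<bar>bit_comb (F (j - k)) (bits (r i) x)\<bar> \<le> c"
        using stage_bcont_bounded[OF bcont_bit_comb] by metis
      have b: "\<And>x. \<bar>vi (j - k) x\<bar> \<le> 1" using vi j by blast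
      have "integrable (M (r i)) (A (r i) (vi (j - k)))" by (intro integrable_M[of _ 1] bounded b)
      moreover have "L1_dist (M (r i)) (A (r i) (vi (j - k))) (\<lambda>x. comb_op (F (j - k)) (bits (r i) x)) \<le> d"
      proof -
        have "L1_dist (M (r i)) (A (r i) (vi (j - k))) (A (r i) (\<lambda>x. bit_comb (F (j - k)) (bits (r i) x)))
            \<le> L1_dist (M (r i)) (vi (j - k)) (\<lambda>x. bit_comb (F (j - k)) (bits (r i) x))"
          by (rule L1_dist_A_le[OF b c])
        also have "\<dots> \<le> d" using vi j by blast
        finally show ?thesis by (simp add: comb_op_bits)
      qed
      ultimately show ?thesis using False by (simp add: prof_vec_simps \<Phi>_def)
    qed
    have lim_j: "integrable \<Omega> (prof_vec B k v j) \<and> L1_dist \<Omega> (prof_vec B k v j) (\<lambda>x. \<Phi> j (\<beta> x)) \<le> d"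
      if "j < 2 * k" for j
    proof (cases "j < k")
      case True
      then show ?thesis using v by (simp add: prof_vec_simps \<Phi>_def)
    next
      case False
      then have j: "j - k < k" using that by simp
      then have "integrable \<Omega> (v (j - k))" "L1_dist \<Omega> (v (j - k)) (\<lambda>x. bit_comb (F (j - k)) (\<beta> x)) \<le> d"
        using v by auto
      then show ?thesis using B[rule_format, of "v (j - k)" "F (j - k)"] False by (simp add: prof_vec_simps \<Phi>_def)
    qed
    let ?l1 = "law (M (r i)) (2 * k) (prof_vec (A (r i)) k vi)" and ?l2 = "law (M (r i)) (2 * k) (\<lambda>j x. \<Phi> j (bits (r i) x))"
    let ?l3 = "law \<Omega> (2 * k) (\<lambda>j x. \<Phi> j (\<beta> x))" and ?l4 = "law \<Omega> (2 * k) (prof_vec B k v)"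
    have 12: "lp_close (2 * k) e ?l1 ?l2"
      using stage_j by (intro stage.lp_close_law stage.bcont_integrable \<Phi> e sum_le) auto
    have 43: "lp_close (2 * k) e ?l4 ?l3"
      using lim_j by (intro lp_close_law bcont_integrable \<Phi> e sum_le) auto
    have l1: "?l1 \<in> vec_prob (2 * k)" using stage_j by (intro law_in_vec_prob prob_space_M) auto
    have l3: "?l3 \<in> vec_prob (2 * k)" by (intro law_in_vec_prob prob_space_axioms bcont_measurable \<Phi>)
    have l4: "?l4 \<in> vec_prob (2 * k)" using lim_j by (intro law_in_vec_prob prob_space_axioms) auto
    have "lp_close (2 * k) (e + e) ?l1 ?l3" by (rule lp_close_trans[OF 12 close l1 l3])
    then have "lp_close (2 * k) ((e + e) + e) ?l1 ?l4"
      using 43 by (intro lp_close_trans[OF _ _ l1 l4, of _ ?l3]) (auto simp: lp_close_commute)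
    then show "lp_close (2 * k) (3 * e) ?l1 ?l4" by (simp add: algebra_simps)
  qed
qed

text \<open>The limit functions are approximated by combinations of bits, and the same combinations,
  truncated to admissible values, are evaluated at the stages.\<close>

lemma profile_element_approx:
  assumes B: "\<forall>v F. integrable \<Omega> v \<longrightarrow>
     integrable \<Omega> (B v) \<and> L1_dist \<Omega> (B v) (\<lambda>x. comb_op F (\<beta> x)) \<le> L1_dist \<Omega> v (\<lambda>x. bit_comb F (\<beta> x))"
    and e: "0 < e" and \<nu>: "\<nu> \<in> profile \<Omega> B k"
  shows "\<forall>\<^sub>F i in sequentially. \<exists>\<mu>\<in>profile (M (r i)) (A (r i)) k. lp_close (2 * k) (3 * e) \<mu> \<nu>"
proof -
  \<comment> \<open>The denominator \<open>2 * k + 1\<close> instead of \<open>2 * k\<close> allows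
    \<open>k = 0\<close>.\<close>
  define d where "d = e * e / real (2 * k + 1)"
  have d: "0 < d" "real (2 * k) * d \<le> e * e" using e by (auto simp: d_def divide_le_eq algebra_simps)
  obtain v where \<nu>: "\<nu> = law \<Omega> (2 * k) (prof_vec B k v)"
    and v: "\<And>j. j < k \<Longrightarrow> v j \<in> borel_measurable \<Omega>" "\<And>j x. j < k \<Longrightarrow> x \<in> space \<Omega> \<Longrightarrow> \<bar>v j x\<bar> \<le> 1"
    using \<nu> unfolding profile_alt by (auto simp: abs_le_iff)
  have vi: "integrable \<Omega> (v j)" if "j < k" for j
    using v that by (intro integrable_const_bound[where B = 1]) auto
  have "\<exists>F. j < k \<longrightarrow> L1_dist \<Omega> (v j) (\<lambda>x. bit_comb F (\<beta> x)) < d" for j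
    using bit_comb_dense[OF generated _ _ vi d(1)] \<beta>_Top \<beta>_Meet by blast
  then obtain F where F: "\<And>j. j < k \<Longrightarrow> L1_dist \<Omega> (v j) (\<lambda>x. bit_comb (F j) (\<beta> x)) < d" by metis
  have "\<forall>\<^sub>F i in sequentially. \<forall>j\<in>{..<k}.
    L1_dist (M (r i)) (\<lambda>x. clip (bit_comb (F j) (bits (r i) x))) (\<lambda>x. bit_comb (F j) (bits (r i) x)) < d"
  proof (intro eventually_ball_finite ballI)
    fix j assume "j \<in> {..<k}"
    then have j: "j < k" by simp
    \<comment> \<open>Truncation moves a value to the nearest point of [-1,1], hence no further than
      to \<open>v j x\<close>.\<close>
    have "L1_dist \<Omega> (\<lambda>x. clip (bit_comb (F j) (\<beta> x))) (\<lambda>x. bit_comb (F j) (\<beta> x)) \<le> L1_dist \<Omega> (v j) (\<lambda>x. bit_comb (F j) (\<beta> x))"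
      unfolding L1_dist_def
    proof (rule integral_mono)
      fix x assume "x \<in> space \<Omega>"
      then have "\<bar>v j x\<bar> \<le> 1" using v(2)[OF j] by simp
      then show "\<bar>clip (bit_comb (F j) (\<beta> x)) - bit_comb (F j) (\<beta> x)\<bar> \<le> \<bar>v j x - bit_comb (F j) (\<beta> x)\<bar>"
        unfolding clip_def by linarith
    next
      show "integrable \<Omega> (\<lambda>x. \<bar>clip (bit_comb (F j) (\<beta> x)) - bit_comb (F j) (\<beta> x)\<bar>)"
        by (intro bcont_integrable[of "\<lambda>b. \<bar>clip (bit_comb (F j) b) - bit_comb (F j) b\<bar>"]
            bcont_abs bcont_diff bcont_clip bcont_bit_comb)
      show "integrable \<Omega> (\<lambda>x. \<bar>v j x - bit_comb (F j) (\<beta> x)\<bar>)"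
        using vi[OF j] bit_comb_integrable by auto
    qed
    also have "\<dots> < d" by (rule F[OF j])
    finally show "\<forall>\<^sub>F i in sequentially. L1_dist (M (r i)) (\<lambda>x. clip (bit_comb (F j) (bits (r i) x))) (\<lambda>x. bit_comb (F j) (bits (r i) x)) < d"
      by (rule order_tendstoD(2)[OF L1_dist_tendsto[OF bcont_clip[OF bcont_bit_comb] bcont_bit_comb]])
  qed simp
  with profile_law_close[where B = B and F = F, OF B e d(2)] show ?thesis
  proof eventually_elim
    case (elim i)
    let ?vi = "\<lambda>j x. clip (bit_comb (F j) (bits (r i) x))"
    have "lp_close (2 * k) (3 * e) (law (M (r i)) (2 * k) (prof_vec (A (r i)) k ?vi)) \<nu>"
      unfolding \<nu> using elim(2) F vi
      by (intro elim(1)[rule_format, of ?vi v]) (auto simp: clip_bound intro: less_imp_le)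
    moreover have "law (M (r i)) (2 * k) (prof_vec (A (r i)) k ?vi) \<in> profile (M (r i)) (A (r i)) k"
      unfolding profile_alt using clip_bound
      by (intro CollectI exI[of _ ?vi]) (auto simp: measurable_M abs_le_iff minus_le_iff)
    ultimately show ?case by blast
  qed
qed

end

context discrete_markov_sequence
begin

text \<open>Each direction of the Hausdorff estimate is reduced to finitely many tracked laws: on
  the stage side the tuples built into \<open>u\<close>, one for each colour; on the limit side one
  law for each colour that occurs there. This makes the threshold for \<open>i\<close> uniform over
  the profile.\<close>

theorem markov_graphop_subsequence_limit:
  "\<exists>r (\<Omega> :: real measure) B. strict_mono r \<and> markov_graphop \<Omega> B \<and>
    (\<forall>k. (\<lambda>i. dH k (profile (M (r i)) (A (r i)) k) (profile \<Omega> B k)) \<longlonglongrightarrow> 0)"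
proof -
  define colouring where "colouring k n C \<longleftrightarrow> (\<forall>\<mu>. fst C \<mu> < snd C) \<and>
    (\<forall>\<mu>\<in>cube_prob (2 * k). \<forall>\<nu>\<in>cube_prob (2 * k). fst C \<mu> = fst C \<nu> \<longrightarrow> lp_close (2 * k) (1 / Suc n) \<mu> \<nu>)"
    for k n and C :: "((nat \<Rightarrow> real) measure \<Rightarrow> nat) \<times> nat"
  have "\<exists>C. colouring k n C" for k n
    using cube_prob_totally_bounded[of "1 / Suc n" "2 * k"] by (simp add: colouring_def)
  then obtain C where C: "\<And>k n. colouring k n (C k n)" by metis
  define col where "col k n = fst (C k n)" for k n
  define L where "L k n = snd (C k n)" for k n
  have col_less: "col k n \<mu> < L k n" for k n \<mu>
    using C[of k n] by (simp add: colouring_def col_def L_def)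
  have col_close: "lp_close (2 * k) (1 / Suc n) \<mu> \<nu>"
    if "\<mu> \<in> cube_prob (2 * k)" "\<nu> \<in> cube_prob (2 * k)" "col k n \<mu> = col k n \<nu>" for k n \<mu> \<nu>
    using C[of k n] that by (simp add: colouring_def col_def)
  define good where "good i k n c v \<longleftrightarrow> (\<forall>j<k. \<forall>x. \<bar>v j x\<bar> \<le> 1) \<and>
    col k n (law (M i) (2 * k) (prof_vec (A i) k v)) = c" for i k n c and v :: "nat \<Rightarrow> 'a \<Rightarrow> real"
  \<comment> \<open>A generating function is named by dimension, precision, colour and coordinate.
    If no tuple has the colour, \<open>SOME\<close> is arbitrary, and truncation still ensures the
    bound.\<close>
  define u where "u i = (\<lambda>(k, n, c, j) x. clip ((SOME v. good i k n c v) j x))"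
    for i :: nat
  interpret generated_bits M A u
    by unfold_locales (simp add: u_def case_prod_unfold clip_bound)
  obtain r and \<Omega> :: "real measure" and \<beta> where r: "strict_mono r"
    and *: "bits_converge \<Omega> \<beta> (\<lambda>i. M (r i)) (\<lambda>i. bits (r i))"
      "sets \<Omega> = sigma_sets (space \<Omega>) (range (\<lambda>w. {x \<in> space \<Omega>. \<beta> x w}))"
      "\<forall>y\<in>space \<Omega>. \<forall>n. \<exists>i x. pref (\<beta> y) n = pref (bits i x) n"
    using bits_limit_exists by (elim exE conjE) (rule that)
  interpret generated_bits_limit M A u \<Omega> \<beta> r
    by (intro generated_bits_limit.intro generated_bits_limit_axioms.intro generated_bits_axioms *(1,2)
        *(3)[rule_format])
  obtain B where B: "markov_graphop \<Omega> B"
    and B_approx: "\<forall>v F. integrable \<Omega> v \<longrightarrow>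
     integrable \<Omega> (B v) \<and> L1_dist \<Omega> (B v) (\<lambda>x. comb_op F (\<beta> x)) \<le> L1_dist \<Omega> v (\<lambda>x. bit_comb F (\<beta> x))"
    using limit_operator_exists by (elim exE conjE) (rule that)
  let ?P = "\<lambda>i k. profile (M (r i)) (A (r i)) k" and ?Q = "\<lambda>k. profile \<Omega> B k"
  have PQ_cube: "?P i k \<subseteq> cube_prob (2 * k)" "?Q k \<subseteq> cube_prob (2 * k)" for i k
    by (intro profile_in_cube_prob markov_profile_in_cube_prob B)+
  have PQ_vec: "?P i k \<subseteq> vec_prob (2 * k)" "?Q k \<subseteq> vec_prob (2 * k)" for i k
    using PQ_cube cube_prob_subset by blast+
  \<comment> \<open>Exchanging a law for one of the same colour costs \<open>e\<close>, following a
    tracked law to the other side costs \<open>3 * e\<close>.\<close>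
  have close: "\<forall>\<^sub>F i in sequentially. dH k (?P i k) (?Q k) \<le> 4 * e" if e: "0 < e" for k e
  proof -
    obtain n where "inverse (real (Suc n)) < e" using reals_Archimedean[OF e] ..
    then have n: "1 / real (Suc n) < e" by (simp only: inverse_eq_divide)
    have same_col: "lp_close (2 * k) e \<mu> \<nu>"
      if "\<mu> \<in> cube_prob (2 * k)" "\<nu> \<in> cube_prob (2 * k)" "col k n \<mu> = col k n \<nu>" for \<mu> \<nu>
      by (rule lp_close_mono[OF col_close[OF that] less_imp_le[OF n]
            subsetD[OF cube_prob_subset that(1)] subsetD[OF cube_prob_subset that(2)]])
    define d where "d = e * e / real (2 * k + 1)"
    have d: "0 < d" "real (2 * k) * d \<le> e * e" using e by (auto simp: d_def divide_le_eq algebra_simps)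
    \<comment> \<open>For each colour the stage tuple named by it is followed to the limit; finitely
      many colours have a common threshold.\<close>
    have "\<forall>\<^sub>F i in sequentially. \<forall>c\<in>{..<L k n}.
      lp_close (2 * k) (3 * e) (law (M (r i)) (2 * k) (prof_vec (A (r i)) k (\<lambda>j. u (r i) (k, n, c, j))))
        (law \<Omega> (2 * k) (prof_vec B k (\<lambda>j x. gen_val (k, n, c, j) (\<beta> x))))"
    proof (intro eventually_ball_finite ballI)
      fix c
      have "\<forall>j. \<exists>F. \<forall>i x. \<bar>gen_val (k, n, c, j) (bits i x) - bit_comb F (bits i x)\<bar> \<le> d"
        by (intro allI gen_val_approx[OF d(1)])
      from choice[OF this] obtain F
        where F: "\<forall>j i x. \<bar>gen_val (k, n, c, j) (bits i x) - bit_comb (F j) (bits i x)\<bar> \<le> d" ..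
      have stage_le: "L1_dist (M i) (\<lambda>x. gen_val (k, n, c, j) (bits i x)) (\<lambda>x. bit_comb (F j) (bits i x)) \<le> d" for i j
      proof -
        interpret P: prob_space "M i" by (rule prob_space_M)
        have "integrable (M i) (\<lambda>x. \<bar>gen_val (k, n, c, j) (bits i x) - bit_comb (F j) (bits i x)\<bar>)"
          by (rule integrable_M[of _ d]) (simp add: F)
        then show ?thesis unfolding L1_dist_def by (rule P.integral_le_const) (simp add: F)
      qed
      have lim_le: "L1_dist \<Omega> (\<lambda>x. gen_val (k, n, c, j) (\<beta> x)) (\<lambda>x. bit_comb (F j) (\<beta> x)) \<le> d" for j
        by (rule LIMSEQ_le_const2[OF L1_dist_tendsto[OF bcont_gen_val bcont_bit_comb]]) (simp add: stage_le)
      from profile_law_close[where B = B and F = F, OF B_approx e d(2)]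
      show "\<forall>\<^sub>F i in sequentially.
        lp_close (2 * k) (3 * e) (law (M (r i)) (2 * k) (prof_vec (A (r i)) k (\<lambda>j. u (r i) (k, n, c, j))))
          (law \<Omega> (2 * k) (prof_vec B k (\<lambda>j x. gen_val (k, n, c, j) (\<beta> x))))"
      proof eventually_elim
        case (elim i)
        let ?U = "\<lambda>j. u (r i) (k, n, c, j)" and ?V = "\<lambda>j x. gen_val (k, n, c, j) (\<beta> x)"
        have "\<forall>j<k. (\<forall>x. \<bar>?U j x\<bar> \<le> 1) \<and> L1_dist (M (r i)) (?U j) (\<lambda>x. bit_comb (F j) (bits (r i) x)) \<le> d"
          using stage_le[of "r i"] u_bound by (simp add: gen_val_bits)
        moreover have "\<forall>j<k. integrable \<Omega> (?V j) \<and> L1_dist \<Omega> (?V j) (\<lambda>x. bit_comb (F j) (\<beta> x)) \<le> d"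
          using lim_le bcont_integrable[OF bcont_gen_val] by simp
        ultimately show ?case
          using elim[THEN spec[of _ ?U], THEN spec[of _ ?V]] by (rule mp[OF mp, rotated 1])
      qed
    qed simp
    \<comment> \<open>The representative of a colour in the limit profile is fixed before
      \<open>i\<close>, so \<open>profile_element_approx\<close> is applied only finitely
      often.\<close>
    moreover have "\<forall>\<^sub>F i in sequentially. \<forall>c\<in>{..<L k n}. (\<exists>\<nu>\<in>?Q k. col k n \<nu> = c) \<longrightarrow>
      (\<exists>\<nu>\<in>?Q k. col k n \<nu> = c \<and> (\<exists>\<mu>\<in>?P i k. lp_close (2 * k) (3 * e) \<mu> \<nu>))"
    proof (intro eventually_ball_finite ballI)
      fix c
      show "\<forall>\<^sub>F i in sequentially. (\<exists>\<nu>\<in>?Q k. col k n \<nu> = c) \<longrightarrow>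
        (\<exists>\<nu>\<in>?Q k. col k n \<nu> = c \<and> (\<exists>\<mu>\<in>?P i k. lp_close (2 * k) (3 * e) \<mu> \<nu>))"
      proof (cases "\<exists>\<nu>\<in>?Q k. col k n \<nu> = c")
        case True
        then obtain \<nu> where \<nu>: "\<nu> \<in> ?Q k" "col k n \<nu> = c" by blast
        from profile_element_approx[OF B_approx e \<nu>(1)] show ?thesis
          by eventually_elim (use \<nu> in blast)
      qed simp
    qed simp
    ultimately show ?thesis
    proof eventually_elim
      case (elim i)
      have four: "lp_close (2 * k) (4 * e) \<mu> \<nu>"
        if "lp_close (2 * k) a \<mu> \<rho>" "lp_close (2 * k) b \<rho> \<nu>" "\<mu> \<in> vec_prob (2 * k)" "\<nu> \<in> vec_prob (2 * k)" "a + b = 4 * e"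
        for \<mu> \<nu> \<rho> a b
        using lp_close_trans[OF that(1-4)] that(5) by simp
      show ?case
      proof (rule dH_le[OF PQ_vec(1) profile_nonempty PQ_vec(2) profile_nonempty])
        fix \<mu> assume \<mu>: "\<mu> \<in> ?P i k"
        then obtain v where v: "\<mu> = law (M (r i)) (2 * k) (prof_vec (A (r i)) k v)" "\<And>j x. j < k \<Longrightarrow> \<bar>v j x\<bar> \<le> 1"
          unfolding profile_alt by (auto simp: abs_le_iff space_M)
        define c where "c = col k n \<mu>"
        define V where "V = (SOME v. good (r i) k n c v)"
        have "good (r i) k n c v" using v by (simp add: good_def c_def)
        then have V: "good (r i) k n c V" unfolding V_def by (rule someI[of "good (r i) k n c"])
        have uV: "u (r i) (k, n, c, j) = V j" if "j < k" for j
        proof -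
          have "u (r i) (k, n, c, j) = (\<lambda>x. clip (V j x))" by (simp add: u_def V_def)
          also have "\<dots> = V j" using V that unfolding good_def by (auto simp: clip_eq)
          finally show ?thesis .
        qed
        let ?U = "\<lambda>j. u (r i) (k, n, c, j)"
        let ?\<rho> = "law (M (r i)) (2 * k) (prof_vec (A (r i)) k ?U)"
        have "?\<rho> = law (M (r i)) (2 * k) (prof_vec (A (r i)) k V)"
        proof (rule law_cong)
          fix j assume "j < 2 * k"
          then show "prof_vec (A (r i)) k ?U j = prof_vec (A (r i)) k V j"
            using uV[of j] uV[of "j - k"] by (cases "j < k") (simp_all add: prof_vec_simps)
        qed
        then have \<rho>c: "col k n ?\<rho> = c" using V by (simp add: good_def)
        have \<rho>: "?\<rho> \<in> ?P i k"
          unfolding profile_alt using u_bound by (intro CollectI exI[of _ ?U]) (auto simp: measurable_M abs_le_iff minus_le_iff)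
        let ?\<nu> = "law \<Omega> (2 * k) (prof_vec B k (\<lambda>j x. gen_val (k, n, c, j) (\<beta> x)))"
        have \<nu>: "?\<nu> \<in> ?Q k"
          unfolding profile_alt using bcont_measurable[OF bcont_gen_val] clip_bound
          by (intro CollectI exI[of _ "\<lambda>j x. gen_val (k, n, c, j) (\<beta> x)"]) (auto simp: gen_val_def abs_le_iff minus_le_iff)
        have c1: "lp_close (2 * k) e \<mu> ?\<rho>"
          by (rule same_col[OF subsetD[OF PQ_cube(1) \<mu>] subsetD[OF PQ_cube(1) \<rho>]]) (rule trans[OF c_def[symmetric] \<rho>c[symmetric]])
        have c2: "lp_close (2 * k) (3 * e) ?\<rho> ?\<nu>"
          using elim(1) col_less[of k n \<mu>] by (simp add: c_def)
        show "\<exists>\<nu>\<in>?Q k. lp_close (2 * k) (4 * e) \<mu> \<nu>"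
          by (rule bexI[OF _ \<nu>], rule four[OF c1 c2 subsetD[OF PQ_vec(1) \<mu>] subsetD[OF PQ_vec(2) \<nu>]]) simp
      next
        fix \<nu> assume \<nu>: "\<nu> \<in> ?Q k"
        obtain \<nu>' \<mu> where \<nu>': "\<nu>' \<in> ?Q k" "col k n \<nu>' = col k n \<nu>" and \<mu>: "\<mu> \<in> ?P i k" "lp_close (2 * k) (3 * e) \<mu> \<nu>'"
          using elim(2) \<nu> col_less[of k n \<nu>] by blast
        have c: "lp_close (2 * k) e \<nu>' \<nu>"
          by (rule same_col[OF subsetD[OF PQ_cube(2) \<nu>'(1)] subsetD[OF PQ_cube(2) \<nu>] \<nu>'(2)])
        show "\<exists>\<mu>\<in>?P i k. lp_close (2 * k) (4 * e) \<mu> \<nu>"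
          by (rule bexI[OF _ \<mu>(1)], rule four[OF \<mu>(2) c subsetD[OF PQ_vec(1) \<mu>(1)] subsetD[OF PQ_vec(2) \<nu>]]) simp
      qed
    qed
  qed
  have "(\<lambda>i. dH k (?P i k) (?Q k)) \<longlonglongrightarrow> 0" for k
  proof (rule LIMSEQ_I)
    fix e :: real assume "0 < e"
    \<comment> \<open>\<open>4 * (e / 8)\<close> is \<open>e / 2\<close>, which leaves room for the
      strict inequality.\<close>
    then have "\<forall>\<^sub>F i in sequentially. dH k (?P i k) (?Q k) \<le> 4 * (e / 8)" by (intro close) simp
    then obtain i0 where "\<And>i. i \<ge> i0 \<Longrightarrow> dH k (?P i k) (?Q k) \<le> e / 2" by (auto simp: eventually_sequentially)
    moreover have "0 \<le> dH k (?P i k) (?Q k)" for i by (intro dH_nonneg PQ_vec profile_nonempty)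
    ultimately show "\<exists>i0. \<forall>i\<ge>i0. norm (dH k (?P i k) (?Q k) - 0) < e"
      using \<open>0 < e\<close> by (intro exI[of _ i0]) force
  qed
  then show ?thesis using r B by blast
qed

end

subsection \<open>Random walks on graphs\<close>

locale nonempty_graph =
  fixes G :: graph
  assumes graph: "graph_on G" and nonempty: "edges G \<noteq> {}"
begin

abbreviation nbrs :: "nat \<Rightarrow> nat set" where
  "nbrs i \<equiv> {j. (i, j) \<in> edges G}"

lemma finite_edges: "finite (edges G)"
  using graph by (auto simp: graph_on_def intro: finite_subset)

lemma finite_nbrs: "finite (nbrs i)"
  using finite_imageI[OF finite_edges, of snd] by (rule finite_subset[rotated]) force

lemma nbrs_outside: "i \<notin> {1..fst G} \<Longrightarrow> nbrs i = {}"
  using graph by (auto simp: graph_on_def)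

lemma edges_eq_Sigma: "edges G = Sigma {1..fst G} nbrs"
  using graph by (auto simp: graph_on_def)

lemma sum_edges: "(\<Sum>i\<in>{1..fst G}. \<Sum>j\<in>nbrs i. f i j) = (\<Sum>(i, j)\<in>edges G. f i j)"
  by (subst edges_eq_Sigma, subst sum.Sigma) (auto simp: finite_nbrs)

lemma sum_deg: "(\<Sum>i\<in>{1..fst G}. deg G i) = card (edges G)"
  using sum_edges[of "\<lambda>_ _. 1 :: nat"] by (simp add: deg_def)

lemma edge_swap: "(i, j) \<in> edges G \<longleftrightarrow> (j, i) \<in> edges G"
  using graph by (auto simp: graph_on_def sym_def)

text \<open>Reversal pairs the increasing ordered edges with the decreasing ones, and there are no
  loops, so \<open>div 2\<close> is exact.\<close>

lemma double_num_edges: "2 * num_edges G = card (edges G)"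
proof -
  let ?L = "{e \<in> edges G. fst e < snd e}" and ?R = "{e \<in> edges G. snd e < fst e}"
  have irr: "fst e \<noteq> snd e" if "e \<in> edges G" for e
    using graph that by (cases e) (auto simp: graph_on_def irrefl_def)
  have "bij_betw prod.swap ?L ?R"
    by (rule bij_betw_byWitness[where f' = prod.swap]) (auto simp: edge_swap)
  then have "card ?L = card ?R" by (rule bij_betw_same_card)
  moreover have "card (edges G) = card ?L + card ?R"
  proof -
    have "edges G = ?L \<union> ?R" using irr by (auto simp: neq_iff)
    then have "card (edges G) = card (?L \<union> ?R)" by (rule arg_cong)
    also have "\<dots> = card ?L + card ?R"
      using finite_edges by (intro card_Un_disjoint) auto
    finally show ?thesis .
  qed
  ultimately show ?thesis by (simp add: num_edges_def)
qed

lemma num_edges_pos: "0 < num_edges G"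
  using double_num_edges finite_edges nonempty by (metis card_gt_0_iff mult_0_right not_gr_zero)

lemma nu_nonneg: "0 \<le> nu G i"
  by (simp add: nu_def)

lemma nu_pos_iff: "0 < nu G i \<longleftrightarrow> nbrs i \<noteq> {}"
  using num_edges_pos finite_nbrs[of i] by (auto simp: nu_def deg_def zero_less_divide_iff card_gt_0_iff)

lemma nu_outside: "i \<notin> {1..fst G} \<Longrightarrow> nu G i = 0"
  using nbrs_outside nu_pos_iff[of i] nu_nonneg[of i] by auto

lemma nu_support: "nu G i \<noteq> 0 \<Longrightarrow> i \<in> {1..fst G}"
  using nu_outside by blast

lemma sum_nu: "(\<Sum>i\<in>{1..fst G}. nu G i) = 1"
proof -
  have "(\<Sum>i\<in>{1..fst G}. nu G i) = real (\<Sum>i\<in>{1..fst G}. deg G i) / (2 * real (num_edges G))"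
    by (simp add: nu_def sum_divide_distrib)
  also have "real (\<Sum>i\<in>{1..fst G}. deg G i) = 2 * real (num_edges G)"
    unfolding sum_deg double_num_edges[symmetric] by simp
  finally show ?thesis using num_edges_pos by simp
qed

lemma sets_nu_meas: "sets (nu_meas G) = UNIV"
  by (simp add: nu_meas_def sets_point_measure)

lemma prob_space_nu_meas: "prob_space (nu_meas G)"
proof (rule prob_spaceI)
  have sub: "{i \<in> UNIV. 0 < ennreal (nu G i)} \<subseteq> {1..fst G}"
    by (intro subsetI, rule nu_support) auto
  have "emeasure (nu_meas G) UNIV = (\<Sum>i | i \<in> UNIV \<and> 0 < ennreal (nu G i). ennreal (nu G i))"
    unfolding nu_meas_def by (rule emeasure_point_measure[OF finite_subset[OF sub]]) simp_all
  also have "\<dots> = (\<Sum>i\<in>{1..fst G}. ennreal (nu G i))"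
    using sub by (intro sum.mono_neutral_left) (simp_all add: not_less ennreal_eq_0_iff)
  also have "\<dots> = ennreal (\<Sum>i\<in>{1..fst G}. nu G i)" by (intro sum_ennreal nu_nonneg)
  finally have "emeasure (nu_meas G) UNIV = ennreal 1" unfolding sum_nu .
  then show "emeasure (nu_meas G) (space (nu_meas G)) = 1"
    by (simp add: nu_meas_def space_point_measure)
qed

lemma integral_nu_meas: "(\<integral>x. f x \<partial>nu_meas G) = (\<Sum>i\<in>{1..fst G}. nu G i * f i)"
proof -
  have sub: "{i \<in> UNIV. nu G i * f i \<noteq> 0} \<subseteq> {1..fst G}"
    by (intro subsetI, rule nu_support) simp
  have "(\<integral>x. f x \<partial>nu_meas G) = (\<integral>x. nu G x * f x \<partial>count_space UNIV)"
    unfolding nu_meas_def point_measure_def by (subst integral_density) (auto simp: nu_nonneg)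
  also have "\<dots> = (\<Sum>i | i \<in> UNIV \<and> nu G i * f i \<noteq> 0. nu G i * f i)"
    by (rule lebesgue_integral_count_space_finite_support[OF finite_subset[OF sub]]) simp
  also have "\<dots> = (\<Sum>i\<in>{1..fst G}. nu G i * f i)"
    using sub by (intro sum.mono_neutral_left) simp_all
  finally show ?thesis .
qed

text \<open>The degree cancels between \<open>nu\<close> and the average, leaving a weight common to
  all vertices; at isolated vertices both sides are zero.\<close>

lemma nu_walk_op: "nu G i * walk_op G v i = (\<Sum>j\<in>nbrs i. v j) / (2 * real (num_edges G))"
proof (cases "nbrs i = {}")
  case True
  then show ?thesis using nu_pos_iff[of i] by (simp add: walk_op_def)
next
  case False
  then have "0 < nu G i" "0 < deg G i"
    using nu_pos_iff[of i] finite_nbrs[of i] by (auto simp: deg_def card_gt_0_iff)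
  then show ?thesis by (simp add: walk_op_def nu_def)
qed

text \<open>The pairing becomes a sum over oriented edges with constant weight, and reversing the
  edges exchanges \<open>v\<close> and \<open>w\<close>.\<close>

lemma walk_op_symmetric: "(\<integral>x. walk_op G v x * w x \<partial>nu_meas G) = (\<integral>x. walk_op G w x * v x \<partial>nu_meas G)"
proof -
  have eq: "(\<integral>x. walk_op G v x * w x \<partial>nu_meas G) = (\<Sum>(i, j)\<in>edges G. v j * w i) / (2 * real (num_edges G))" for v w
  proof -
    have "(\<integral>x. walk_op G v x * w x \<partial>nu_meas G) = (\<Sum>i\<in>{1..fst G}. (nu G i * walk_op G v i) * w i)"
      by (simp add: integral_nu_meas mult.assoc)
    also have "\<dots> = (\<Sum>i\<in>{1..fst G}. \<Sum>j\<in>nbrs i. v j * w i) / (2 * real (num_edges G))"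
      unfolding nu_walk_op by (simp add: sum_divide_distrib sum_distrib_right)
    finally show ?thesis unfolding sum_edges .
  qed
  have "(\<Sum>(i, j)\<in>edges G. v j * w i) = (\<Sum>(i, j)\<in>edges G. w j * v i)"
    by (rule sum.reindex_bij_witness[where i = prod.swap and j = prod.swap]) (auto simp: edge_swap)
  then show ?thesis unfolding eq by simp
qed

lemma walk_op_linear: "walk_op G (\<lambda>x. a * v x + b * w x) y = a * walk_op G v y + b * walk_op G w y"
  by (simp add: walk_op_def sum.distrib sum_distrib_left add_divide_distrib)

lemma walk_op_bounded:
  assumes "\<And>x. \<bar>v x\<bar> \<le> c" shows "\<bar>walk_op G v y\<bar> \<le> c"
proof (cases "nbrs y = {}")
  case True
  then show ?thesis using nu_pos_iff[of y] assms[of y] by (simp add: walk_op_def)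
next
  case False
  then have d: "0 < deg G y" using finite_nbrs[of y] by (auto simp: deg_def card_gt_0_iff)
  have "\<bar>\<Sum>j\<in>nbrs y. v j\<bar> \<le> (\<Sum>j\<in>nbrs y. c)"
    using assms by (intro order_trans[OF sum_abs] sum_mono)
  also have "\<dots> = c * real (deg G y)" by (simp add: deg_def)
  finally have "\<bar>(\<Sum>j\<in>nbrs y. v j) / real (deg G y)\<bar> \<le> c" using d by (simp add: divide_le_eq)
  then show ?thesis using False nu_pos_iff[of y] by (simp add: walk_op_def)
qed

lemma walk_op_positive: "(\<And>x. 0 \<le> v x) \<Longrightarrow> 0 \<le> walk_op G v y"
  by (simp add: walk_op_def sum_nonneg)

lemma walk_op_unital: "AE x in nu_meas G. walk_op G (\<lambda>_. 1) x = 1"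
  unfolding nu_meas_def AE_point_measure
  using nu_pos_iff finite_nbrs by (auto simp: walk_op_def deg_def card_gt_0_iff)

end

section \<open>From walk operators to the limit theorem\<close>

lemma discrete_markov_sequence_walk_op:
  assumes "\<And>i. graph_on (G i) \<and> edges (G i) \<noteq> {}"
  shows "discrete_markov_sequence (\<lambda>i. nu_meas (G i)) (\<lambda>i. walk_op (G i))"
proof -
  interpret nonempty_graph "G i" for i using assms by unfold_locales auto
  show ?thesis
  proof (rule discrete_markov_sequence.intro)
    show "prob_space (nu_meas (G i))" "sets (nu_meas (G i)) = UNIV" for i
      by (rule prob_space_nu_meas sets_nu_meas)+
    show "walk_op (G i) (\<lambda>x. a * v x + b * w x) y = a * walk_op (G i) v y + b * walk_op (G i) w y" for i a b v w y
      by (rule walk_op_linear)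
    show "\<bar>walk_op (G i) v y\<bar> \<le> c" if "\<And>x. \<bar>v x\<bar> \<le> c" for i v c y
      using that by (rule walk_op_bounded)
    show "0 \<le> walk_op (G i) v y" if "\<And>x. 0 \<le> v x" for i v y
      using that by (rule walk_op_positive)
    show "(\<integral>x. walk_op (G i) v x * w x \<partial>nu_meas (G i)) = (\<integral>x. walk_op (G i) w x * v x \<partial>nu_meas (G i))" for i v w
      by (rule walk_op_symmetric)
    show "AE x in nu_meas (G i). walk_op (G i) (\<lambda>_. 1) x = 1" for i by (rule walk_op_unital)
  qed
qed

text \<open>The terms converge for each \<open>k\<close> and are dominated by
  \<open>(1 / 2) ^ Suc k\<close>, since \<open>dH\<close> is at most 1; Tannery's theorem is
  dominated convergence for the series.\<close>

lemma dM_tendsto_0: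
  assumes M: "\<And>i k. profile (M i) (A i) k \<subseteq> vec_prob (2 * k)" and N: "\<And>k. profile N B k \<subseteq> vec_prob (2 * k)"
    and lim: "\<And>k. k \<ge> 1 \<Longrightarrow> (\<lambda>i. dH k (profile (M i) (A i) k) (profile N B k)) \<longlonglongrightarrow> 0"
  shows "(\<lambda>i. dM (M i) (A i) N B) \<longlonglongrightarrow> 0"
proof -
  let ?a = "\<lambda>k i. (1 / 2) ^ Suc k * dH (Suc k) (profile (M i) (A i) (Suc k)) (profile N B (Suc k))"
  have 1: "?a k \<longlonglongrightarrow> 0" for k
    using tendsto_mult[OF tendsto_const lim[of "Suc k"], of "(1 / 2) ^ Suc k"] by simp
  have 2: "norm (?a k i) \<le> (1 / 2) ^ Suc k" for k i
  proof -
    have "dH (Suc k) (profile (M i) (A i) (Suc k)) (profile N B (Suc k)) \<le> 1"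
    proof (rule dH_le[OF M profile_nonempty N profile_nonempty])
      obtain \<mu> \<nu> where \<mu>\<nu>: "\<mu> \<in> profile (M i) (A i) (Suc k)" "\<nu> \<in> profile N B (Suc k)"
        using profile_nonempty by (metis ex_in_conv)
      show "\<exists>\<nu>\<in>profile N B (Suc k). lp_close (2 * Suc k) 1 \<mu> \<nu>" if "\<mu> \<in> profile (M i) (A i) (Suc k)" for \<mu>
        by (rule bexI[OF _ \<mu>\<nu>(2)]) (rule lp_close_1[OF subsetD[OF M that] subsetD[OF N \<mu>\<nu>(2)]])
      show "\<exists>\<mu>\<in>profile (M i) (A i) (Suc k). lp_close (2 * Suc k) 1 \<mu> \<nu>" if "\<nu> \<in> profile N B (Suc k)" for \<nu>
        by (rule bexI[OF _ \<mu>\<nu>(1)]) (rule lp_close_1[OF subsetD[OF M \<mu>\<nu>(1)] subsetD[OF N that]])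
    qed
    moreover have "0 \<le> dH (Suc k) (profile (M i) (A i) (Suc k)) (profile N B (Suc k))"
      by (rule dH_nonneg[OF M profile_nonempty N profile_nonempty])
    ultimately show ?thesis by (simp add: abs_mult mult_left_le)
  qed
  have "(\<lambda>i. \<Sum>k. ?a k i) \<longlonglongrightarrow> (\<Sum>k. 0)"
  proof (rule tannerys_theorem[THEN conjunct2, THEN conjunct2, OF 1])
    show "\<forall>\<^sub>F (k, i) in sequentially \<times>\<^sub>F sequentially. norm (?a k i) \<le> (1 / 2) ^ Suc k"
      using 2 by (intro always_eventually) (simp only: split_paired_All case_prod_conv, blast)
    show "summable (\<lambda>k. (1 / 2 :: real) ^ Suc k)" using power_half_series by (rule sums_summable)
  qed simp
  then show ?thesis by (simp add: dM_def)
qed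

theorem theorem5p4:
  fixes G :: "nat \<Rightarrow> graph"
  assumes "\<forall>i. graph_on (G i) \<and> edges (G i) \<noteq> {}"
  shows "(\<exists>r. strict_mono r \<and> rw_convergent (G \<circ> r)) \<and>
    (rw_convergent G \<longrightarrow>
      (\<exists>(\<Omega> :: real measure) A. markov_graphop \<Omega> A \<and>
         (\<lambda>i. dM (nu_meas (G i)) (walk_op (G i)) \<Omega> A) \<longlonglongrightarrow> 0))"
proof -
  interpret discrete_markov_sequence "\<lambda>i. nu_meas (G i)" "\<lambda>i. walk_op (G i)"
    by (rule discrete_markov_sequence_walk_op) (use assms in blast)
  obtain r and \<Omega> :: "real measure" and B where r: "strict_mono r" and B: "markov_graphop \<Omega> B"
    and lim: "\<forall>k. (\<lambda>i. dH k (profile (nu_meas (G (r i))) (walk_op (G (r i))) k) (profile \<Omega> B k)) \<longlonglongrightarrow> 0"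
    using markov_graphop_subsequence_limit by (elim exE conjE) (rule that)
  let ?P = "\<lambda>i k. profile (nu_meas (G i)) (walk_op (G i)) k" and ?Q = "\<lambda>k. profile \<Omega> B k"
  have P: "?P i k \<subseteq> vec_prob (2 * k)" and Q: "?Q k \<subseteq> vec_prob (2 * k)" for i k
    using subset_trans[OF profile_in_cube_prob cube_prob_subset]
      subset_trans[OF markov_profile_in_cube_prob[OF B] cube_prob_subset] by auto
  have limD: "\<exists>n0. \<forall>i\<ge>n0. dH k (?P (r i) k) (?Q k) < e" if "0 < e" for k e
    using order_tendstoD(2)[OF lim[rule_format, of k] that] by (simp add: eventually_sequentially)
  have "rw_convergent (G \<circ> r)"
    unfolding rw_convergent_def action_convergent_def
  proof (intro allI impI)
    fix k :: nat and e :: real assume "0 < e"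
    then obtain n0 where n0: "\<forall>i\<ge>n0. dH k (?P (r i) k) (?Q k) < e / 2"
      using limD[of "e / 2" k] by auto
    have "dH k (?P (r i) k) (?P (r j) k) < e" if "n0 \<le> i" "n0 \<le> j" for i j
      using dH_triangle[OF P profile_nonempty Q profile_nonempty P profile_nonempty, of k "r i" "r j"]
        dH_commute[of k "?Q k" "?P (r j) k"] n0[rule_format, OF that(1)] n0[rule_format, OF that(2)] by linarith
    then show "\<exists>N. \<forall>i\<ge>N. \<forall>j\<ge>N. dH k (profile (nu_meas ((G \<circ> r) i)) (walk_op ((G \<circ> r) i)) k)
        (profile (nu_meas ((G \<circ> r) j)) (walk_op ((G \<circ> r) j)) k) < e"
      by (intro exI[of _ n0]) simp
  qed
  \<comment> \<open>A Cauchy sequence with a convergent subsequence converges, so the limit operator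
    of the subsequence serves the whole sequence.\<close>
  moreover have "(\<lambda>i. dM (nu_meas (G i)) (walk_op (G i)) \<Omega> B) \<longlonglongrightarrow> 0" if conv: "rw_convergent G"
  proof (rule dM_tendsto_0[OF P Q])
    fix k :: nat assume k: "1 \<le> k"
    show "(\<lambda>i. dH k (?P i k) (?Q k)) \<longlonglongrightarrow> 0"
    proof (rule LIMSEQ_I)
      fix e :: real assume "0 < e"
      then have e: "0 < e / 2" by simp
      obtain n0 where n0: "\<forall>i\<ge>n0. dH k (?P (r i) k) (?Q k) < e / 2" using limD[OF e, of k] ..
      obtain n1 where n1: "\<forall>i\<ge>n1. \<forall>j\<ge>n1. dH k (?P i k) (?P j k) < e / 2"
        using conv[unfolded rw_convergent_def action_convergent_def, rule_format, OF k e] ..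
      have "dH k (?P i k) (?Q k) < e" if "n1 \<le> i" for i
      proof -
        define j where "j = max n0 n1"
        \<comment> \<open>A strictly increasing \<open>r\<close> satisfies
          \<open>j \<le> r j\<close>, so one \<open>j\<close> meets both thresholds.\<close>
        have j: "n0 \<le> j" "n1 \<le> r j" using seq_suble[OF r, of j] by (auto simp: j_def)
        show ?thesis
          using dH_triangle[OF P profile_nonempty P profile_nonempty Q profile_nonempty, of k i "r j"]
            n0[rule_format, OF j(1)] n1[rule_format, OF that j(2)] by linarith
      qed
      then show "\<exists>n0. \<forall>i\<ge>n0. norm (dH k (?P i k) (?Q k) - 0) < e"
        using dH_nonneg[OF P profile_nonempty Q profile_nonempty] by (intro exI[of _ n1]) simp
    qed
  qed
  ultimately show ?thesis using r B by blast
qed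

end
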